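(* Let $d,m$ be positive integers with $m>d/2$. There exists a constant $C>0$, depending only on $d$ and $m$, such that the Lebesgue constant of the interpolation operator $I_h$ with the Matérn kernel $\Phi=\Phi_{m,d}$ on the scaled grid $h\mathbb{Z}^d$ satisfies $$\|I_h\|_\infty\le C,\qquad h\in(0,1].$$
   Context: $\|\cdot\|$ is the Euclidean norm on $\mathbb{R}^d$. The Matérn kernel is $\Phi(x)=\Phi_{m,d}(x)=\|x\|^{m-d/2}K_{m-d/2}(\|x\|)$, $x\in\mathbb{R}^d$ (value at $0$ by continuity), where $K_\nu$ is the modified Bessel function of the third kind (Macdonald function) of order $\nu$. It is continuous and decays exponentially. For $h>0$, $\Phi_h(x):=\Phi(hx)$ and $$\mathcal{S}^h(\Phi_h)=\Big\{\sum_{j\in\mathbb{Z}^d}c_j\,\Phi(\cdot-hj):\ c\in\ell_\infty(\mathbb{Z}^d)\Big\}.$$ The Lagrange function $\chi_h$ is the unique element of $\mathcal{S}^h(\Phi_h)$ with $\chi_h(hj)=\delta_{j0}$ for all $j\in\mathbb{Z}^d$; explicitly, $\chi_h(x)=\sum_{k\in\mathbb{Z}^d}a_k^h\,\Phi(x-hk)$, where $\{a_k^h\}_{k\in\mathbb{Z}^d}\in\ell_1$ is the sequence of Fourier coefficients of $1/\sigma_m(\cdot,h)$, with $\sigma_m(t,h):=\sum_{k\in\mathbb{Z}^d}\Phi_h(k)e^{ik\cdot t}>0$, $t\in\mathbb{R}^d$. For $h\in(0,1]$, the interpolation operator $I_h$ takes a bounded function $f$ on $\mathbb{R}^d$ to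 $$I_hf(x)=\sum_{j\in\mathbb{Z}^d}f(hj)\,\chi_h(x-hj),\quad x\in\mathbb{R}^d.$$ Its Lebesgue constant $\|I_h\|_\infty$ is its operator norm on bounded functions with the sup norm, which equals $$\|I_h\|_\infty=\sup_{x\in\mathbb{R}^d}\sum_{j\in\mathbb{Z}^d}|\chi_h(x-hj)|.$$ *)

theory Defs
  imports "HOL-Analysis.Analysis"
begin

text \<open>
  The modified Bessel function of the third kind \<open>K\<^sub>\<nu>(r)\<close> for \<open>r > 0\<close>, given by its integral
  representation over \<open>(0, \<infinity>)\<close>, which covers integer and non-integer orders uniformly.
\<close>

definition macdonald :: "real \<Rightarrow> real \<Rightarrow> real" where
  "macdonald \<nu> r = (LBINT t:{0<..}. exp (- r * cosh t) * cosh (\<nu> * t))"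

text \<open>The value at the origin is the continuous extension, written as a radial limit.\<close>

definition matern :: "nat \<Rightarrow> real^'d \<Rightarrow> real" where
  "matern m x =
     (let \<nu> = real m - real CARD('d) / 2
      in if x = 0 then Lim (at_right 0) (\<lambda>r. r powr \<nu> * macdonald \<nu> r)
         else norm x powr \<nu> * macdonald \<nu> (norm x))"

definition grid_point :: "real \<Rightarrow> int^'d \<Rightarrow> real^'d" where
  "grid_point h j = (\<chi> i. h * of_int (j $ i))"

definition shift_space :: "nat \<Rightarrow> real \<Rightarrow> (real^'d \<Rightarrow> real) set" where
  "shift_space m h =
     {s. \<exists>c :: int^'d \<Rightarrow> real. bounded (range c) \<and>
         (\<forall>x. ((\<lambda>j. c j * matern m (x - grid_point h j)) has_sum s x) UNIV)}"

definition lagrange :: "nat \<Rightarrow> real \<Rightarrow> real^'d \<Rightarrow> real" where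
  "lagrange m h =
     (THE s. s \<in> shift_space m h \<and> (\<forall>j. s (grid_point h j) = (if j = 0 then 1 else 0)))"

definition interpolant :: "nat \<Rightarrow> real \<Rightarrow> (real^'d \<Rightarrow> real) \<Rightarrow> real^'d \<Rightarrow> real" where
  "interpolant m h f x =
     (\<Sum>\<^sub>\<infinity>j. f (grid_point h j) * lagrange m h (x - grid_point h j))"

text \<open>
  \<open>K\<close> is a bound for the interpolation operator on bounded functions with the sup norm.
  Convergence of the series is demanded explicitly, since \<^const>\<open>infsum\<close> of a
  divergent series is \<open>0\<close>.
\<close>

definition interpolation_bound :: "'d::finite itself \<Rightarrow> nat \<Rightarrow> real \<Rightarrow> real \<Rightarrow> bool" where
  "interpolation_bound _ m h K \<longleftrightarrow>
     (\<forall>f :: real^'d \<Rightarrow> real. bounded (range f) \<longrightarrow>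
        (\<forall>x. (\<lambda>j. f (grid_point h j) * lagrange m h (x - grid_point h j)) summable_on UNIV \<and>
             \<bar>interpolant m h f x\<bar> \<le> K * (SUP y. \<bar>f y\<bar>)))"

text \<open>
  The operator norm; it is \<open>\<infinity>\<close> if the operator is not everywhere defined and bounded.
\<close>

definition lebesgue_constant :: "'d::finite itself \<Rightarrow> nat \<Rightarrow> real \<Rightarrow> ennreal" where
  "lebesgue_constant d m h = Inf {ennreal K | K. 0 \<le> K \<and> interpolation_bound d m h K}"

lemma infsum_ennreal_eq:
  fixes g :: "'a \<Rightarrow> real"
  assumes "g summable_on A" "\<And>x. x \<in> A \<Longrightarrow> 0 \<le> g x"
  shows "(\<Sum>\<^sub>\<infinity>x\<in>A. ennreal (g x)) = ennreal (infsum g A)"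
proof -
  have "(\<Sum>\<^sub>\<infinity>x\<in>A. ennreal (g x)) = (SUP F\<in>{F. finite F \<and> F \<subseteq> A}. \<Sum>x\<in>F. ennreal (g x))"
    by (rule nonneg_infsum_complete) simp
  also have "\<dots> = (SUP F\<in>{F. finite F \<and> F \<subseteq> A}. ennreal (sum g F))"
    by (rule SUP_cong[OF refl], rule sum_ennreal) (use assms(2) in blast)
  also have "\<dots> = ennreal (infsum g A)"
    by (rule infsum_nonneg_is_SUPREMUM_ennreal[OF assms, symmetric])
  finally show ?thesis .
qed

lemma summable_if_infsum_ennreal_finite:
  fixes g :: "'a \<Rightarrow> real"
  assumes nn: "\<And>x. 0 \<le> g x" and le: "(\<Sum>\<^sub>\<infinity>x\<in>A. ennreal (g x)) \<le> ennreal K" and K: "0 \<le> K"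
  shows "g summable_on A" "infsum g A \<le> K"
proof -
  have *: "sum g F \<le> K" if F: "finite F" "F \<subseteq> A" for F
  proof -
    have "ennreal (sum g F) = (\<Sum>x\<in>F. ennreal (g x))" by (simp add: nn)
    also have "\<dots> \<le> (\<Sum>\<^sub>\<infinity>x\<in>A. ennreal (g x))"
      by (subst nonneg_infsum_complete) (use F in \<open>auto intro!: SUP_upper2[of F]\<close>)
    finally show ?thesis using le K by (meson ennreal_le_iff order_trans)
  qed
  show "g summable_on A"
    by (rule nonneg_bdd_above_summable_on) (use nn * in \<open>auto simp: bdd_above_def\<close>)
  then show "infsum g A \<le> K"
    by (rule infsum_le_finite_sums) (use * in auto)
qed

lemma lebesgue_constant_eq_SUP:
  "lebesgue_constant TYPE('d::finite) m h =
     (SUP x :: real^'d. \<Sum>\<^sub>\<infinity>j. ennreal \<bar>lagrange m h (x - grid_point h j)\<bar>)"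
  (is "_ = (SUP x. ?L x)")
proof (rule antisym)
  show "(SUP x. ?L x) \<le> lebesgue_constant TYPE('d) m h"
    unfolding lebesgue_constant_def
  proof (intro Inf_greatest SUP_least)
    fix z and x :: "real^'d"
    assume "z \<in> {ennreal K |K. 0 \<le> K \<and> interpolation_bound TYPE('d) m h K}"
    then obtain K where z: "z = ennreal K" and K: "0 \<le> K" "interpolation_bound TYPE('d) m h K"
      by auto
    define f where "f y = sgn (lagrange m h (x - y))" for y
    have f1: "\<bar>f y\<bar> \<le> 1" for y by (simp add: f_def abs_sgn_eq)
    have "bounded (range f)" using f1 by (auto simp: bounded_iff)
    with K have s: "(\<lambda>j. f (grid_point h j) * lagrange m h (x - grid_point h j)) summable_on UNIV"
      and b: "\<bar>interpolant m h f x\<bar> \<le> K * (SUP y. \<bar>f y\<bar>)"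
      unfolding interpolation_bound_def by blast+
    have e: "f (grid_point h j) * lagrange m h (x - grid_point h j) =
        \<bar>lagrange m h (x - grid_point h j)\<bar>" for j
      by (simp add: f_def mult.commute abs_sgn)
    have "(SUP y. \<bar>f y\<bar>) \<le> 1" by (rule cSUP_least) (use f1 in auto)
    then have "K * (SUP y. \<bar>f y\<bar>) \<le> K" using K by (simp add: mult_left_le)
    with b have "(\<Sum>\<^sub>\<infinity>j. \<bar>lagrange m h (x - grid_point h j)\<bar>) \<le> K"
      unfolding interpolant_def e by linarith
    with s show "?L x \<le> z"
      unfolding z e by (subst infsum_ennreal_eq) (auto intro: ennreal_leI)
  qed
next
  show "lebesgue_constant TYPE('d) m h \<le> (SUP x. ?L x)"
  proof (cases "(SUP x. ?L x) = top")
    case False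
    then obtain K where K: "0 \<le> K" "(SUP x. ?L x) = ennreal K"
      by (cases "SUP x. ?L x" rule: ennreal_cases) blast+
    have "interpolation_bound TYPE('d) m h K"
      unfolding interpolation_bound_def
    proof (intro allI impI)
      fix f :: "real^'d \<Rightarrow> real" and x :: "real^'d"
      assume f: "bounded (range f)"
      let ?B = "SUP y. \<bar>f y\<bar>"
      have bdd: "bdd_above (range (\<lambda>y. \<bar>f y\<bar>))"
        using f by (auto simp: bounded_iff bdd_above_def)
      have fB: "\<bar>f y\<bar> \<le> ?B" for y by (rule cSUP_upper) (use bdd in auto)
      have B: "0 \<le> ?B" using fB[of 0] by linarith
      let ?g = "\<lambda>j. \<bar>lagrange m h (x - grid_point h j)\<bar>"
      let ?s = "\<lambda>j. f (grid_point h j) * lagrange m h (x - grid_point h j)"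
      have "?L x \<le> ennreal K" unfolding K(2)[symmetric] by (rule SUP_upper) simp
      then have g: "?g summable_on UNIV" "infsum ?g UNIV \<le> K"
        using summable_if_infsum_ennreal_finite[OF _ _ K(1), of ?g UNIV] by simp_all
      have sB: "norm (?s j) \<le> ?B * ?g j" for j
        by (simp add: abs_mult mult_right_mono fB)
      have gB: "(\<lambda>j. ?B * ?g j) summable_on UNIV" by (rule summable_on_cmult_right[OF g(1)])
      have ns: "(\<lambda>j. norm (?s j)) summable_on UNIV"
        by (rule summable_on_comparison_test[OF gB]) (use sB in auto)
      have "\<bar>interpolant m h f x\<bar> \<le> (\<Sum>\<^sub>\<infinity>j. norm (?s j))"
        using norm_infsum_bound[OF ns] by (simp only: interpolant_def real_norm_def)
      also have "\<dots> \<le> (\<Sum>\<^sub>\<infinity>j. ?B * ?g j)" by (rule infsum_mono[OF ns gB]) (use sB in auto)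
      also have "\<dots> = ?B * infsum ?g UNIV" by (rule infsum_cmult_right')
      also have "\<dots> \<le> K * ?B" unfolding mult.commute[of K] by (rule mult_left_mono[OF g(2) B])
      finally show "?s summable_on UNIV \<and> \<bar>interpolant m h f x\<bar> \<le> K * ?B"
        using abs_summable_summable[OF ns] by simp
    qed
    then show ?thesis unfolding lebesgue_constant_def K(2) by (intro Inf_lower) (use K in auto)
  qed (simp only: top_greatest)
qed

end

theory Submission
  imports Defs "HOL-Probability.Probability" "HOL-Complex_Analysis.Complex_Analysis"
begin

text \<open>
  After rescaling by \<open>h\<close>, the kernel is a positive multiple of the Fourier transform of
  \<open>w(\<xi>) = 1 / (h\<^sup>2 + \<bar>\<xi>\<bar>\<^sup>2)\<^sup>m\<close> on \<open>\<real>\<^sup>d\<close>, because both sides are mixtures of Gaussians. Folding onto the torus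
  \<open>[-\<pi>, \<pi>]\<^sup>d\<close> turns the translates \<open>\<Phi>\<^sub>h(y - k)\<close> into Fourier coefficients of
  \<open>N\<^sub>y(\<xi>) = \<Sum>\<^sub>l exp(i y \<cdot> (\<xi> + 2\<pi>l)) w(\<xi> + 2\<pi>l)\<close>, and the cardinal function at \<open>y\<close> is the mean of
  \<open>N\<^sub>y / N\<^sub>0\<close> over the torus: at integer points the quotient is a character, and approximating
  \<open>1 / N\<^sub>0\<close> by trigonometric polynomials shows that this mean is a combination of translates of the kernel.

  Uniformity in \<open>h\<close> comes from multiplying \<open>N\<^sub>y\<close> and \<open>N\<^sub>0\<close> by \<open>1 / w\<close>. The resulting series
  are analytic and bounded on a complex strip around the torus whose width does not depend on \<open>h\<close>, although
  \<open>w\<close> degenerates as \<open>h \<rightarrow> 0\<close>, and the new denominator is at least \<open>1\<close> on the torus itself,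
  hence at least \<open>1/2\<close> in modulus on a narrower strip. Moving the contour of one variable at a time gives exponential
  decay of the cardinal function with constants independent of \<open>h\<close>, and summing over the grid bounds the Lebesgue constant.
\<close>

subsection \<open>Sums over lattices and integrals of sums\<close>

text \<open>The obstacle is that \<open>symb\<close> vanishes at complex points at distance
  \<open>h\<close> from the real torus, so the strip in which w is analytic shrinks with
  \<open>h\<close>. Multiplication by \<open>symb ^ m\<close> turns the term l = 0 into a bare
  phase; the other terms divide by \<open>symb\<close> at nonzero lattice shifts only, where its
  real part is bounded below on a strip of fixed width. The price is that the new numerator and
  denominator are no longer periodic. Only their quotient is, and this is checked just on the two
  edges of the contour, where \<open>symb\<close> does not vanish. The final width
  \<open>decay\<close> comes from a Lipschitz estimate: off the real torus the denominator changes
  by at most \<open>5 * m * numer_bound\<close> times the sum of the |Im|, which is kept below 1/2.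
  Since \<open>lagrange\<close> is a definite description, uniqueness among bounded coefficient
  sequences must be proved too: the coefficients found for the cardinal function are a convolution
  inverse of the sampled kernel. Constants that blow up as \<open>h\<close> tends to 0 occur only in
  arguments at fixed \<open>h\<close>, such as exchanging sums and integrals.\<close>

lemma integral_infsum:
  fixes f :: "'i::countable \<Rightarrow> 'a \<Rightarrow> 'b::{banach,second_countable_topology}"
  assumes inf: "infinite (UNIV::'i set)"
    and int: "\<And>i. integrable M (f i)"
    and pt: "\<And>x. x \<in> space M \<Longrightarrow> (\<lambda>i. norm (f i x)) summable_on UNIV"
    and L1: "(\<lambda>i. \<integral>x. norm (f i x) \<partial>M) summable_on UNIV"
  shows "integrable M (\<lambda>x. \<Sum>\<^sub>\<infinity>i. f i x)"
    and "(\<integral>x. (\<Sum>\<^sub>\<infinity>i. f i x) \<partial>M) = (\<Sum>\<^sub>\<infinity>i. \<integral>x. f i x \<partial>M)"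
proof -
  \<comment> \<open>A bijection from the naturals turns unordered sums into series, which can be
    integrated termwise. Summability is asked at every point of the space, because
    \<open>conv\<close> has to hold pointwise.\<close>
  define e where "e = from_nat_into (UNIV::'i set)"
  have e: "bij_betw e UNIV UNIV" unfolding e_def using bij_betw_from_nat_into[OF _ inf] by simp
  have conv: "(\<Sum>\<^sub>\<infinity>i. g i) = (\<Sum>n. g (e n))" if g: "(\<lambda>i. norm (g i)) summable_on UNIV" for g :: "'i \<Rightarrow> 'b"
  proof -
    have "(\<lambda>n. norm (g (e n))) summable_on UNIV"
      by (rule iffD2[OF summable_on_reindex_bij_betw[OF e, of "\<lambda>i. norm (g i)"] g])
    then have "((\<lambda>n. g (e n)) has_sum (\<Sum>\<^sub>\<infinity>n. g (e n))) UNIV"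
      by (rule has_sum_infsum[OF abs_summable_summable])
    then have "(\<lambda>n. g (e n)) sums (\<Sum>\<^sub>\<infinity>n. g (e n))" by (rule has_sum_imp_sums)
    then show ?thesis using infsum_reindex_bij_betw[OF e, of g] by (simp add: sums_iff)
  qed
  have sm: "summable (\<lambda>n. g (e n))" if g: "g summable_on UNIV" for g :: "'i \<Rightarrow> real"
  proof -
    have "(\<lambda>n. g (e n)) summable_on UNIV"
      by (rule iffD2[OF summable_on_reindex_bij_betw[OF e, of g] g])
    then show ?thesis by (rule summable_on_imp_summable)
  qed
  have 1: "AE x in M. summable (\<lambda>n. norm (f (e n) x))" using sm[OF pt] by (intro AE_I2)
  have 2: "summable (\<lambda>n. \<integral>x. norm (f (e n) x) \<partial>M)" using sm[OF L1] .
  have "integrable M (\<lambda>x. \<Sum>n. f (e n) x)" by (rule integrable_suminf[OF int 1 2])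
  then show "integrable M (\<lambda>x. \<Sum>\<^sub>\<infinity>i. f i x)"
    by (rule Bochner_Integration.integrable_cong[OF refl, THEN iffD2, rotated]) (use conv[OF pt] in auto)
  have "(\<integral>x. (\<Sum>\<^sub>\<infinity>i. f i x) \<partial>M) = (\<integral>x. (\<Sum>n. f (e n) x) \<partial>M)"
    by (rule Bochner_Integration.integral_cong[OF refl]) (use conv[OF pt] in auto)
  also have "\<dots> = (\<Sum>n. \<integral>x. f (e n) x \<partial>M)" by (rule integral_suminf[OF int 1 2])
  also have "\<dots> = (\<Sum>\<^sub>\<infinity>i. \<integral>x. f i x \<partial>M)"
  proof (rule conv[symmetric])
    show "(\<lambda>i. norm (\<integral>x. f i x \<partial>M)) summable_on UNIV"
      by (rule summable_on_comparison_test[OF L1]) (auto simp: integral_norm_bound)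
  qed
  finally show "(\<integral>x. (\<Sum>\<^sub>\<infinity>i. f i x) \<partial>M) = (\<Sum>\<^sub>\<infinity>i. \<integral>x. f i x \<partial>M)" .
qed

lemma PiE_UNIV_UNIV [simp]: "PiE UNIV (\<lambda>_. UNIV) = UNIV" by auto

lemma summable_on_prod_fun:
  fixes f :: "'d::finite \<Rightarrow> 'k::countable \<Rightarrow> 'b::{real_normed_field,banach,second_countable_topology}"
  assumes "\<And>j. (\<lambda>n. norm (f j n)) summable_on UNIV"
  shows "(\<lambda>l. norm (\<Prod>j\<in>UNIV. f j (l j))) summable_on UNIV"
proof -
  have "Infinite_Set_Sum.abs_summable_on (\<lambda>l. \<Prod>j\<in>UNIV. f j (l j)) (PiE UNIV (\<lambda>_. UNIV))"
    by (rule abs_summable_on_prod_PiE) (use assms in \<open>auto simp: abs_summable_equivalent\<close>)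
  then show ?thesis by (simp add: abs_summable_equivalent)
qed

lemma infsum_prod_fun:
  fixes f :: "'d::finite \<Rightarrow> 'k::countable \<Rightarrow> 'b::{real_normed_field,banach,second_countable_topology}"
  assumes "\<And>j. (\<lambda>n. norm (f j n)) summable_on UNIV"
  shows "(\<Sum>\<^sub>\<infinity>l. \<Prod>j\<in>UNIV. f j (l j)) = (\<Prod>j\<in>UNIV. \<Sum>\<^sub>\<infinity>n. f j n)"
  using infsum_prod_PiE_abs[of "UNIV::'d set" f "\<lambda>_. UNIV"] assms by simp

lemma infinite_fun_int [simp]: "infinite (UNIV :: ('d::finite \<Rightarrow> int) set)"
proof
  assume "finite (UNIV :: ('d::finite \<Rightarrow> int) set)"
  then have "finite (range (\<lambda>n::int. (\<lambda>_::'d. n)))" by (rule finite_subset[rotated]) simp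
  moreover have "inj (\<lambda>n::int. (\<lambda>_::'d. n))" by (auto simp: inj_def fun_eq_iff)
  ultimately show False using finite_imageD infinite_UNIV_int by blast
qed

lemma summable_on_intI:
  fixes f :: "int \<Rightarrow> real"
  assumes "\<And>n. 0 \<le> f n" "summable (\<lambda>n::nat. f (int n))" "summable (\<lambda>n::nat. f (- int n))"
  shows "f summable_on UNIV"
proof -
  have "f summable_on range int"
    by (subst summable_on_reindex) (use assms in \<open>auto simp: o_def summable_on_UNIV_nonneg_real_iff\<close>)
  moreover have "f summable_on range (\<lambda>n. - int n)"
    by (subst summable_on_reindex) (use assms in \<open>auto simp: o_def summable_on_UNIV_nonneg_real_iff inj_def\<close>)
  ultimately have "f summable_on (range int \<union> range (\<lambda>n. - int n))" using summable_on_union by blast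
  moreover have "range int \<union> range (\<lambda>n. - int n) = UNIV"
  proof (rule UNIV_eq_I[symmetric])
    fix n :: int
    have "n = int (nat n) \<or> n = - int (nat (- n))" by auto
    then show "n \<in> range int \<union> range (\<lambda>n. - int n)" by blast
  qed
  ultimately show ?thesis by simp
qed

text \<open>Used with a = m/d, where the condition reads m > d/2: this is where the smoothness
  assumption of the theorem makes \<open>lattice_weight\<close> summable.\<close>

lemma summable_on_japanese_int:
  assumes a: "a > 1/2"
  shows "(\<lambda>n::int. (1 + (real_of_int n)\<^sup>2) powr - a) summable_on UNIV"
proof -
  have s: "summable (\<lambda>n::nat. (1 + (real n)\<^sup>2) powr - a)"
  proof (rule summable_comparison_test_ev)
    show "summable (\<lambda>n. real n powr (- 2 * a))"
      using a by (subst summable_real_powr_iff) auto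
    have "norm ((1 + (real n)\<^sup>2) powr - a) \<le> real n powr (- 2 * a)" if "n > 0" for n
    proof -
      have "(1 + (real n)\<^sup>2) powr - a \<le> ((real n)\<^sup>2) powr - a"
        using a that by (intro powr_mono2') auto
      also have "\<dots> = real n powr (- 2 * a)"
        using that by (simp add: powr_powr flip: powr_numeral)
      finally show ?thesis by simp
    qed
    then show "\<forall>\<^sub>F n in sequentially. norm ((1 + (real n)\<^sup>2) powr - a) \<le> real n powr (- 2 * a)"
      using eventually_gt_at_top[of "0::nat"] by (rule eventually_mono[rotated])
  qed
  then show ?thesis by (intro summable_on_intI) auto
qed

lemma summable_on_exp_abs_int:
  assumes b: "b > 0"
  shows "(\<lambda>n::int. exp (- b * \<bar>real_of_int n\<bar>)) summable_on UNIV"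
proof -
  have "exp (- b * real n) = exp (- b) ^ n" for n by (simp add: exp_of_nat_mult[symmetric] mult.commute)
  then have "summable (\<lambda>n. exp (- b * real n))" using b by (simp add: summable_geometric)
  then show ?thesis by (intro summable_on_intI) auto
qed

text \<open>Shifting by the integer part of \<open>x\<close> costs only the factor
  \<open>exp b\<close>, so the bound does not depend on \<open>x\<close>.\<close>

lemma exp_abs_shift_int:
  assumes b: "b > 0"
  shows "(\<lambda>n::int. exp (- b * \<bar>x - real_of_int n\<bar>)) summable_on UNIV" (is "?A")
    and "(\<Sum>\<^sub>\<infinity>n::int. exp (- b * \<bar>x - real_of_int n\<bar>))
           \<le> exp b * (\<Sum>\<^sub>\<infinity>n::int. exp (- b * \<bar>real_of_int n\<bar>))" (is "?B")
proof -
  define g where "g n = exp b * exp (- b * \<bar>real_of_int n\<bar>)" for n :: int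
  have bij: "bij_betw (\<lambda>n. n - \<lfloor>x\<rfloor>) UNIV UNIV" 
    by (rule bij_betw_byWitness[where f'="\<lambda>n. n + \<lfloor>x\<rfloor>"]) (simp_all add: image_def)
  have g: "g summable_on UNIV" unfolding g_def
    by (rule summable_on_cmult_right) (rule summable_on_exp_abs_int[OF b])
  have g': "(\<lambda>n. g (n - \<lfloor>x\<rfloor>)) summable_on UNIV"
    by (rule iffD2[OF summable_on_reindex_bij_betw[OF bij, of g] g])
  have le: "exp (- b * \<bar>x - real_of_int n\<bar>) \<le> g (n - \<lfloor>x\<rfloor>)" for n
  proof -
    have "\<bar>real_of_int n - real_of_int \<lfloor>x\<rfloor>\<bar> \<le> 1 + \<bar>x - real_of_int n\<bar>" by linarith
    then have "b * \<bar>real_of_int n - real_of_int \<lfloor>x\<rfloor>\<bar> \<le> b * (1 + \<bar>x - real_of_int n\<bar>)"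
      using b by (intro mult_left_mono) auto
    then show ?thesis unfolding g_def mult_exp_exp by (simp add: algebra_simps)
  qed
  show A: ?A by (rule summable_on_comparison_test[OF g']) (use le in auto)
  have "(\<Sum>\<^sub>\<infinity>n::int. exp (- b * \<bar>x - real_of_int n\<bar>)) \<le> (\<Sum>\<^sub>\<infinity>n. g (n - \<lfloor>x\<rfloor>))"
    by (rule infsum_mono[OF A g']) (use le in auto)
  also have "\<dots> = (\<Sum>\<^sub>\<infinity>n. g n)" by (rule infsum_reindex_bij_betw[OF bij])
  finally show ?B unfolding g_def by (simp add: infsum_cmult_right')
qed

text \<open>Cauchy's theorem on the rectangle between heights 0 and \<open>s\<close>. Periodicity is
  demanded only on the vertical sides, where it makes them cancel; in the application it is verified
  only there, away from the zeros of \<open>symb\<close>.\<close>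

lemma integral_horizontal_shift:
  fixes g :: "complex \<Rightarrow> complex"
  assumes hol: "g holomorphic_on {z. \<bar>Re z\<bar> < r \<and> \<bar>Im z\<bar> < b}" and r: "pi < r" and s: "\<bar>s\<bar> < b"
    and per: "\<And>v. \<bar>v\<bar> < b \<Longrightarrow> g (Complex pi v) = g (Complex (-pi) v)"
  shows "integral {-pi..pi} (\<lambda>u. g (of_real u)) = integral {-pi..pi} (\<lambda>u. g (Complex u s))"
proof -
  let ?S = "{z. \<bar>Re z\<bar> < r \<and> \<bar>Im z\<bar> < b}"
  have "?S = {z. Re z < r} \<inter> {z. Re z > -r} \<inter> {z. Im z < b} \<inter> {z. Im z > -b}" by auto
  then have conv: "convex ?S"
    by (simp add: convex_Int convex_halfspace_Re_lt convex_halfspace_Re_gt convex_halfspace_Im_lt convex_halfspace_Im_gt)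
  let ?a = "Complex (-pi) 0" and ?b = "Complex pi 0" and ?c = "Complex pi s" and ?d = "Complex (-pi) s"
  have in_S: "?a \<in> ?S" "?b \<in> ?S" "?c \<in> ?S" "?d \<in> ?S" using r s pi_gt_zero by auto
  have seg: "closed_segment x y \<subseteq> ?S" if "x \<in> ?S" "y \<in> ?S" for x y
    using closed_segment_subset[OF that conv] .
  have cont: "continuous_on ?S g" using hol by (rule holomorphic_on_imp_continuous_on)
  have ci: "g contour_integrable_on linepath x y" if "x \<in> ?S" "y \<in> ?S" for x y
    by (rule contour_integrable_continuous_linepath) (rule continuous_on_subset[OF cont seg[OF that]])
  let ?p = "linepath ?a ?b +++ linepath ?b ?c +++ linepath ?c ?d +++ linepath ?d ?a"
  have "(g has_contour_integral 0) ?p"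
    by (rule Cauchy_theorem_convex_simple[OF hol conv])
       (use seg in_S in \<open>auto simp: path_image_join simp del: mem_Collect_eq\<close>)
  then have "contour_integral ?p g = 0" by (rule contour_integral_unique)
  then have sum0: "contour_integral (linepath ?a ?b) g + contour_integral (linepath ?b ?c) g
      + contour_integral (linepath ?c ?d) g + contour_integral (linepath ?d ?a) g = 0"
    using ci in_S by (simp add: contour_integrable_join add.assoc)
  have vert: "contour_integral (linepath ?b ?c) g = - contour_integral (linepath ?d ?a) g"
  proof -
    have "contour_integral (linepath ?b ?c) g = contour_integral (linepath ?a ?d) g"
      unfolding contour_integral_integral vector_derivative_linepath_at
    proof (rule Henstock_Kurzweil_Integration.integral_cong)
      fix x :: real assume x: "x \<in> {0..1}"
      have 1: "linepath ?b ?c x = Complex pi (x * s)" "linepath ?a ?d x = Complex (-pi) (x * s)"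
        by (auto simp: linepath_def complex_eq_iff algebra_simps)
      show "g (linepath ?b ?c x) * (?c - ?b) = g (linepath ?a ?d x) * (?d - ?a)"
      proof -
        have "\<bar>x * s\<bar> \<le> \<bar>s\<bar>" using x by (simp add: abs_mult mult_left_le_one_le)
        then have "g (Complex pi (x * s)) = g (Complex (-pi) (x * s))" using s by (intro per) linarith
        then show ?thesis unfolding 1 by (simp add: complex_eq_iff)
      qed
    qed
    also have "\<dots> = - contour_integral (linepath ?d ?a) g"
      using contour_integral_reverse_linepath[of ?a ?d g] continuous_on_subset[OF cont seg[OF in_S(1,4)]]
      by simp
    finally show ?thesis .
  qed
  have horiz: "contour_integral (linepath (Complex (-pi) v) (Complex pi v)) g = integral {-pi..pi} (\<lambda>u. g (Complex u v))" 
    for v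
  proof -
    have l: "linepath (Complex (-pi) v) (Complex pi v) x = linepath (of_real (-pi)) (of_real pi) x + Complex 0 v" for x
      by (simp add: linepath_def complex_eq_iff algebra_simps)
    have k: "Complex pi v - Complex (-pi) v = of_real pi - of_real (-pi)" by (simp add: complex_eq_iff)
    have "contour_integral (linepath (Complex (-pi) v) (Complex pi v)) g
        = contour_integral (linepath (of_real (-pi)) (of_real pi)) (\<lambda>z. g (z + Complex 0 v))"
      unfolding contour_integral_integral vector_derivative_linepath_at unfolding l k ..
    also have "\<dots> = integral {-pi..pi} (\<lambda>u. g (of_real u + Complex 0 v))"
      by (subst contour_integral_linepath_Reals_eq) auto
    also have "(\<lambda>u. g (of_real u + Complex 0 v)) = (\<lambda>u. g (Complex u v))"
      by (rule ext, rule arg_cong[where f=g]) (simp add: complex_eq_iff)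
    finally show ?thesis .
  qed
  have "contour_integral (linepath ?c ?d) g = - contour_integral (linepath ?d ?c) g"
    using contour_integral_reverse_linepath[of ?c ?d g] continuous_on_subset[OF cont seg[OF in_S(3,4)]] by simp
  then show ?thesis using sum0 vert horiz[of 0] horiz[of s]
    by (simp add: complex_of_real_def)
qed

subsection \<open>The symbol near the real torus\<close>

text \<open>At real points \<open>1 / symb h \<xi> ^ m\<close> is the weight w. Squares instead of
  squared moduli keep it analytic, at the price of zeros such as (i h, 0, ..., 0).\<close>

definition symb :: "real \<Rightarrow> ('d::finite \<Rightarrow> complex) \<Rightarrow> complex" where
  "symb h \<xi> = of_real (h\<^sup>2) + (\<Sum>j\<in>UNIV. (\<xi> j)\<^sup>2)"

definition lshift :: "('d \<Rightarrow> int) \<Rightarrow> ('d \<Rightarrow> complex) \<Rightarrow> 'd \<Rightarrow> complex" where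
  "lshift l \<xi> = (\<lambda>j. \<xi> j + of_real (2 * pi * of_int (l j)))"

text \<open>The bound 4 exceeds pi and leaves room around the torus, yet 2 pi - 4 > 9/4, so a
  nonzero lattice shift dominates the imaginary parts. The sum of the |Im| is the quantity in which
  the perturbation bounds are linear.\<close>

definition strip_box :: "('d::finite \<Rightarrow> complex) set" where
  "strip_box = {\<xi>. (\<forall>j. \<bar>Re (\<xi> j)\<bar> \<le> 4) \<and> (\<Sum>j\<in>UNIV. \<bar>Im (\<xi> j)\<bar>) \<le> 1}"

text \<open>A product can be summed one coordinate at a time. The exponent m/d in each factor makes
  it a majorant for the (-m)-th power of 1 + |l|^2.\<close>

definition lattice_weight :: "nat \<Rightarrow> ('d::finite \<Rightarrow> int) \<Rightarrow> real" where
  "lattice_weight m l = (\<Prod>j\<in>UNIV. (1 + (real_of_int (l j))\<^sup>2) powr - (real m / real CARD('d)))"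

text \<open>The case \<open>l = 0\<close> is set apart since \<^term>\<open>symb\<close> has zeros in the strip.\<close>
definition rho :: "real \<Rightarrow> ('d::finite \<Rightarrow> int) \<Rightarrow> ('d \<Rightarrow> complex) \<Rightarrow> complex" where
  "rho h l \<xi> = (if l = (\<lambda>_. 0) then 1 else symb h \<xi> / symb h (lshift l \<xi>))"

definition phase :: "('d::finite \<Rightarrow> real) \<Rightarrow> ('d \<Rightarrow> complex) \<Rightarrow> complex" where
  "phase y \<xi> = exp (\<i> * (\<Sum>j\<in>UNIV. of_real (y j) * \<xi> j))"

text \<open>This is N_y times \<open>symb h \<xi> ^ m\<close>, with the factor moved inside the
  series so that it cancels the singularity of the term l = 0. With y = 0 it is the
  denominator.\<close>

definition numer :: "nat \<Rightarrow> real \<Rightarrow> ('d::finite \<Rightarrow> real) \<Rightarrow> ('d \<Rightarrow> complex) \<Rightarrow> complex" where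
  "numer m h y \<xi> = (\<Sum>\<^sub>\<infinity>l. phase y (lshift l \<xi>) * rho h l \<xi> ^ m)"

text \<open>At most 1 comes from h^2, 16 from each squared real part, and 1 from all squared
  imaginary parts together.\<close>

definition symb_bound :: "'d::finite itself \<Rightarrow> real" where "symb_bound _ = 2 + 16 * real CARD('d)"

text \<open>The 3/2 is the reciprocal of the 2/3 in \<open>norm_symb_lshift_lower\<close>.\<close>

definition numer_bound :: "'d::finite itself \<Rightarrow> nat \<Rightarrow> real" where
  "numer_bound d m = (3/2 * symb_bound d) ^ m * (\<Sum>\<^sub>\<infinity>l::'d \<Rightarrow> int. lattice_weight m l)"

abbreviation Re_part :: "('d \<Rightarrow> complex) \<Rightarrow> 'd \<Rightarrow> complex" where
  "Re_part \<xi> \<equiv> \<lambda>j. of_real (Re (\<xi> j))"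

abbreviation shifted_sq :: "('d::finite \<Rightarrow> int) \<Rightarrow> ('d \<Rightarrow> complex) \<Rightarrow> real" where
  "shifted_sq l \<xi> \<equiv> \<Sum>j\<in>UNIV. (Re (\<xi> j) + 2 * pi * of_int (l j))\<^sup>2"

section \<open>Bounds on the strip that do not depend on h\<close>

lemma lattice_weight_pos: "lattice_weight m l > 0"
  unfolding lattice_weight_def
proof (intro prod_pos ballI)
  fix j
  have "0 < 1 + (real_of_int (l j))\<^sup>2" by (simp add: add_pos_nonneg)
  then show "0 < (1 + (real_of_int (l j))\<^sup>2) powr - (real m / real CARD('a))" by simp
qed

lemma lattice_weight_0 [simp]: "lattice_weight m (\<lambda>_. 0) = 1" by (simp add: lattice_weight_def)

lemma summable_lattice_weight:
  assumes "real m > real CARD('d::finite) / 2"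
  shows "(lattice_weight m :: ('d \<Rightarrow> int) \<Rightarrow> real) summable_on UNIV"
proof -
  have a: "real m / real CARD('d) > 1/2" using assms by (simp add: field_simps)
  have "(\<lambda>l::'d\<Rightarrow>int. norm (lattice_weight m l)) summable_on UNIV" unfolding lattice_weight_def
    by (rule summable_on_prod_fun) (simp add: summable_on_japanese_int[OF a])
  then show ?thesis by (simp add: abs_of_pos[OF lattice_weight_pos])
qed

text \<open>From pi > 25/8 the shifted modulus is at least (25/4) |n| - 4. For |n| >= 1 this exceeds
  |n| and is at least 9/4, and (9/4)^2 = 81/16 > 5.\<close>

lemma abs_int_le_shift:
  assumes "\<bar>x\<bar> \<le> 4" shows "\<bar>real_of_int n\<bar> \<le> \<bar>x + 2 * pi * of_int n\<bar>"
    and "n \<noteq> 0 \<Longrightarrow> 5 \<le> (x + 2 * pi * of_int n)\<^sup>2"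
proof -
  have pi: "pi > 25/8" using pi_approx by simp
  have p: "2 * pi * \<bar>real_of_int n\<bar> \<ge> 25/4 * \<bar>real_of_int n\<bar>" using pi by (intro mult_right_mono) auto
  have t: "\<bar>x + 2 * pi * of_int n\<bar> \<ge> 2 * pi * \<bar>real_of_int n\<bar> - \<bar>x\<bar>"
    using pi abs_triangle_ineq4[of "x + 2 * pi * of_int n" x] by (simp add: abs_mult)
  show "\<bar>real_of_int n\<bar> \<le> \<bar>x + 2 * pi * of_int n\<bar>"
  proof (cases "n = 0")
    case False
    then have "\<bar>real_of_int n\<bar> \<ge> 1" by linarith
    then show ?thesis using p t assms by linarith
  qed simp
  assume "n \<noteq> 0"
  then have "\<bar>real_of_int n\<bar> \<ge> 1" by linarith
  then have "\<bar>x + 2 * pi * of_int n\<bar> \<ge> 9/4" using p t assms by linarith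
  then have "\<bar>x + 2 * pi * of_int n\<bar>\<^sup>2 \<ge> (9/4)\<^sup>2" by (intro power_mono) auto
  then show "5 \<le> (x + 2 * pi * of_int n)\<^sup>2" by (simp add: power2_eq_square)
qed

lemma Re_part_in_strip_box [simp]: "\<xi> \<in> strip_box \<Longrightarrow> Re_part \<xi> \<in> strip_box"
  by (auto simp: strip_box_def)

lemma strip_boxD:
  assumes "\<xi> \<in> strip_box" shows "\<bar>Re (\<xi> j)\<bar> \<le> 4" "\<bar>Im (\<xi> j)\<bar> \<le> 1" "(\<Sum>j\<in>UNIV. (Im (\<xi> j))\<^sup>2) \<le> 1"
proof -
  show "\<bar>Re (\<xi> j)\<bar> \<le> 4" using assms by (simp add: strip_box_def)
  have s: "(\<Sum>j\<in>UNIV. \<bar>Im (\<xi> j)\<bar>) \<le> 1" using assms by (simp add: strip_box_def)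
  have le: "\<bar>Im (\<xi> j)\<bar> \<le> 1" for j using member_le_sum[of j UNIV "\<lambda>j. \<bar>Im (\<xi> j)\<bar>"] s by simp
  then show "\<bar>Im (\<xi> j)\<bar> \<le> 1" .
  have "(Im (\<xi> j))\<^sup>2 \<le> \<bar>Im (\<xi> j)\<bar>" for j
    using mult_left_le[OF le[of j], of "\<bar>Im (\<xi> j)\<bar>"] by (simp add: power2_eq_square flip: abs_mult)
  then have "(\<Sum>j\<in>UNIV. (Im (\<xi> j))\<^sup>2) \<le> (\<Sum>j\<in>UNIV. \<bar>Im (\<xi> j)\<bar>)" by (intro sum_mono)
  with s show "(\<Sum>j\<in>UNIV. (Im (\<xi> j))\<^sup>2) \<le> 1" by simp
qed

lemma shifted_sq_lower:
  fixes \<xi> :: "'d::finite \<Rightarrow> complex"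
  assumes "\<xi> \<in> strip_box"
  shows "(1 / (1 + shifted_sq l \<xi>)) ^ m \<le> lattice_weight m l"
    and "l \<noteq> (\<lambda>_. 0) \<Longrightarrow> 5 \<le> shifted_sq l \<xi>"
proof -
  let ?R = "shifted_sq l \<xi>"
  have mem: "(Re (\<xi> j) + 2 * pi * of_int (l j))\<^sup>2 \<le> ?R" for j
    by (rule member_le_sum) auto
  have R0: "?R \<ge> 0" by (intro sum_nonneg) auto
  have le: "1 + (real_of_int (l j))\<^sup>2 \<le> 1 + ?R" for j
    using mem[of j] abs_int_le_shift(1)[OF strip_boxD(1)[OF assms, of j], of "l j"] 
    by (meson abs_le_square_iff add_left_mono order_trans)
  \<comment> \<open>The m-th power is distributed evenly over the d coordinates, and each factor is
    compared with one coordinate of l.\<close>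
  have "(1 / (1 + ?R)) ^ m = (\<Prod>j\<in>(UNIV::'d set). (1 + ?R) powr - (real m / real CARD('d)))"
    using R0 by (simp add: powr_powr powr_minus_divide power_one_over flip: powr_realpow)
  also have "\<dots> \<le> lattice_weight m l" unfolding lattice_weight_def
    by (intro prod_mono conjI powr_mono2') (use le in \<open>auto simp: add_pos_nonneg\<close>)
  finally show "(1 / (1 + ?R)) ^ m \<le> lattice_weight m l" .
  assume "l \<noteq> (\<lambda>_. 0)"
  then obtain j where "l j \<noteq> 0" by auto
  then show "5 \<le> ?R" using mem[of j] abs_int_le_shift(2)[OF strip_boxD(1)[OF assms, of j], of "l j"] by linarith
qed

text \<open>With R the shifted square, the real part is at least R - 1, since the imaginary parts
  take away at most 1; and R - 1 >= 2/3 (1 + R) amounts to R >= 5. Dropping h^2 keeps the bound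
  independent of \<open>h\<close>.\<close>

lemma norm_symb_lshift_lower:
  fixes \<xi> :: "'d::finite \<Rightarrow> complex"
  assumes "\<xi> \<in> strip_box" "l \<noteq> (\<lambda>_. 0)"
  shows "norm (symb h (lshift l \<xi>)) \<ge> 2/3 * (1 + shifted_sq l \<xi>)"
proof -
  have "Re (symb h (lshift l \<xi>)) = h\<^sup>2 + shifted_sq l \<xi> - (\<Sum>j\<in>UNIV. (Im (\<xi> j))\<^sup>2)"
    by (simp add: symb_def lshift_def Re_power2 sum_subtractf)
  also have "\<dots> \<ge> shifted_sq l \<xi> - 1" using strip_boxD(3)[OF assms(1)] by (smt (verit) zero_le_power2)
  finally have "Re (symb h (lshift l \<xi>)) \<ge> 2/3 * (1 + shifted_sq l \<xi>)"
    using shifted_sq_lower(2)[OF assms] by simp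
  then show ?thesis using complex_Re_le_cmod order_trans by blast
qed

lemma symb_bound_ge: "symb_bound TYPE('d::finite) \<ge> 1" by (simp add: symb_bound_def)

lemma norm_symb_le:
  fixes \<xi> :: "'d::finite \<Rightarrow> complex"
  assumes "\<xi> \<in> strip_box" "0 < h" "h \<le> 1"
  shows "norm (symb h \<xi>) \<le> symb_bound TYPE('d)"
proof -
  have "norm (symb h \<xi>) \<le> norm (complex_of_real (h\<^sup>2)) + (\<Sum>j\<in>UNIV. norm ((\<xi> j)\<^sup>2))"
    unfolding symb_def by (intro norm_triangle_mono order_refl norm_sum)
  also have "\<dots> = h\<^sup>2 + ((\<Sum>j\<in>UNIV. (Re (\<xi> j))\<^sup>2) + (\<Sum>j\<in>UNIV. (Im (\<xi> j))\<^sup>2))"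
    by (simp add: norm_power cmod_power2 sum.distrib)
  also have "\<dots> \<le> 1 + ((\<Sum>j\<in>(UNIV::'d set). 16) + 1)"
  proof (intro add_mono sum_mono)
    show "h\<^sup>2 \<le> 1" using assms by (simp add: power_le_one)
    show "(Re (\<xi> j))\<^sup>2 \<le> 16" for j
      using strip_boxD(1)[OF assms(1), of j] abs_le_square_iff[of "Re (\<xi> j)" 4] by simp
  qed (use strip_boxD(3)[OF assms(1)] in auto)
  finally show ?thesis by (simp add: symb_bound_def)
qed

lemma norm_rho_le:
  fixes \<xi> :: "'d::finite \<Rightarrow> complex"
  assumes "\<xi> \<in> strip_box" "0 < h" "h \<le> 1" "l \<noteq> (\<lambda>_. 0)"
  shows "norm (rho h l \<xi>) \<le> 3/2 * symb_bound TYPE('d) * (1 / (1 + shifted_sq l \<xi>))"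
proof -
  have R: "shifted_sq l \<xi> \<ge> 0" by (intro sum_nonneg) auto
  have "norm (rho h l \<xi>) = norm (symb h \<xi>) / norm (symb h (lshift l \<xi>))"
    using assms(4) by (simp add: rho_def norm_divide)
  also have "\<dots> \<le> symb_bound TYPE('d) / (2/3 * (1 + shifted_sq l \<xi>))"
  proof (rule frac_le)
    show "norm (symb h \<xi>) \<le> symb_bound TYPE('d)" by (intro norm_symb_le assms)
    show "2/3 * (1 + shifted_sq l \<xi>) \<le> norm (symb h (lshift l \<xi>))" by (rule norm_symb_lshift_lower[OF assms(1,4)])
  qed (use R symb_bound_ge[where 'd='d] in auto)
  finally show ?thesis by (simp add: field_simps)
qed

text \<open>A summable majorant free of both \<open>h\<close> and \<open>\<xi>\<close>; the
  uniformity in \<open>h\<close> starts here.\<close>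

lemma norm_rho_power_le:
  fixes \<xi> :: "'d::finite \<Rightarrow> complex"
  assumes "\<xi> \<in> strip_box" "0 < h" "h \<le> 1"
  shows "norm (rho h l \<xi> ^ m) \<le> (3/2 * symb_bound TYPE('d)) ^ m * lattice_weight m l"
proof (cases "l = (\<lambda>_. 0)")
  case True
  then show ?thesis using symb_bound_ge[where 'd='d] by (simp add: rho_def)
next
  case False
  have "norm (rho h l \<xi> ^ m) \<le> (3/2 * symb_bound TYPE('d) * (1 / (1 + shifted_sq l \<xi>))) ^ m"
    unfolding norm_power by (intro power_mono norm_rho_le assms False) auto
  also have "\<dots> = (3/2 * symb_bound TYPE('d)) ^ m * (1 / (1 + shifted_sq l \<xi>)) ^ m"
    by (simp only: power_mult_distrib)
  also have "\<dots> \<le> (3/2 * symb_bound TYPE('d)) ^ m * lattice_weight m l"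
    using shifted_sq_lower(1)[OF assms(1)] symb_bound_ge[where 'd='d] by (intro mult_left_mono) auto
  finally show ?thesis .
qed

lemma symb_diff_le:
  fixes \<xi> :: "'d::finite \<Rightarrow> complex"
  assumes "\<xi> \<in> strip_box"
  shows "norm (symb h (lshift l \<xi>) - symb h (lshift l (Re_part \<xi>)))
     \<le> 2 * (\<Sum>j\<in>UNIV. \<bar>Im (\<xi> j)\<bar>) * (1 + shifted_sq l \<xi>)"
proof -
  define e where "e j = Re (\<xi> j) + 2 * pi * of_int (l j)" for j
  have e: "lshift l \<xi> j = Complex (e j) (Im (\<xi> j))" "lshift l (Re_part \<xi>) j = of_real (e j)" for j
    by (simp_all add: lshift_def e_def complex_eq_iff)
  \<comment> \<open>By (e + i v)^2 - e^2 = v (-v + 2 i e) every term carries a factor |Im|, and 1 +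
    2 |e| <= 2 + e^2 is absorbed into the shifted square.\<close>
  have "symb h (lshift l \<xi>) - symb h (lshift l (Re_part \<xi>))
     = (\<Sum>j\<in>UNIV. of_real (Im (\<xi> j)) * Complex (- Im (\<xi> j)) (2 * e j))"
    unfolding symb_def e by (simp add: complex_eq_iff power2_eq_square sum_subtractf[symmetric] algebra_simps)
  also have "norm \<dots> \<le> (\<Sum>j\<in>UNIV. \<bar>Im (\<xi> j)\<bar> * (2 * (1 + shifted_sq l \<xi>)))"
  proof (rule sum_norm_le)
    fix j
    have "norm (Complex (- Im (\<xi> j)) (2 * e j)) \<le> \<bar>Im (\<xi> j)\<bar> + 2 * \<bar>e j\<bar>"
      using cmod_le[of "Complex (- Im (\<xi> j)) (2 * e j)"] by simp
    also have "\<dots> \<le> 1 + (1 + (e j)\<^sup>2)"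
      using strip_boxD(2)[OF assms, of j] zero_le_power2[of "\<bar>e j\<bar> - 1"]
      by (simp add: power2_eq_square algebra_simps)
    also have "(e j)\<^sup>2 \<le> shifted_sq l \<xi>" unfolding e_def by (rule member_le_sum) auto
    finally have "norm (Complex (- Im (\<xi> j)) (2 * e j)) \<le> 2 * (1 + shifted_sq l \<xi>)"
      using sum_nonneg[of UNIV "\<lambda>j. (Re (\<xi> j) + 2 * pi * of_int (l j))\<^sup>2"] by simp
    then show "norm (of_real (Im (\<xi> j)) * Complex (- Im (\<xi> j)) (2 * e j)) \<le> \<bar>Im (\<xi> j)\<bar> * (2 * (1 + shifted_sq l \<xi>))"
      unfolding norm_mult by (intro mult_mono) auto
  qed
  also have "\<dots> = 2 * (\<Sum>j\<in>UNIV. \<bar>Im (\<xi> j)\<bar>) * (1 + shifted_sq l \<xi>)"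
    unfolding sum_distrib_right[symmetric] by (simp only: mult_ac)
  finally show ?thesis .
qed

text \<open>Dividing by c moves both points into the closed unit disc, where the power map is
  m-Lipschitz. Measuring the distance relative to c keeps c^m, hence the summable majorant, in the
  bound.\<close>

lemma norm_power_diff_le:
  fixes z w :: "'a::{real_normed_field}"
  assumes "norm z \<le> c" "norm w \<le> c" "norm (z - w) \<le> k * c"
  shows "norm (z ^ m - w ^ m) \<le> real m * k * c ^ m"
proof (cases "c = 0")
  case True
  then show ?thesis using assms by (cases m) auto
next
  case False
  then have c: "c > 0" using assms(1) norm_ge_zero[of z] by linarith
  define u v where "u = z / of_real c" and "v = w / of_real c"
  have uv: "z = u * of_real c" "w = v * of_real c" using c by (auto simp: u_def v_def)
  have 1: "norm u \<le> 1" "norm v \<le> 1" using assms c by (auto simp: u_def v_def norm_divide)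
  have 2: "norm (u - v) \<le> k" using assms(3) c
    by (simp add: u_def v_def norm_divide diff_divide_distrib[symmetric] divide_le_eq)
  have "norm (z ^ m - w ^ m) = norm (u ^ m - v ^ m) * c ^ m"
    unfolding uv power_mult_distrib left_diff_distrib[symmetric] norm_mult
    using c by (simp add: norm_power)
  also have "\<dots> \<le> (real m * norm (u - v)) * c ^ m" using c 1 by (intro mult_right_mono norm_power_diff) auto
  also have "\<dots> \<le> (real m * k) * c ^ m" using c 2 by (intro mult_right_mono mult_left_mono) auto
  finally show ?thesis .
qed

lemma rho_diff_le:
  fixes \<xi> :: "'d::finite \<Rightarrow> complex"
  assumes "\<xi> \<in> strip_box" "0 < h" "h \<le> 1"
  shows "norm (rho h l \<xi> ^ m - rho h l (Re_part \<xi>) ^ m)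
    \<le> real m * (5 * (\<Sum>j\<in>UNIV. \<bar>Im (\<xi> j)\<bar>)) * (3/2 * symb_bound TYPE('d)) ^ m * lattice_weight m l"
proof (cases "l = (\<lambda>_. 0)")
  case True
  then show ?thesis using symb_bound_ge[where 'd='d] by (simp add: rho_def sum_nonneg)
next
  case False
  define R K \<delta> where "R = shifted_sq l \<xi>" and "K = symb_bound TYPE('d)" and "\<delta> = (\<Sum>j\<in>UNIV. \<bar>Im (\<xi> j)\<bar>)"
  have R: "R \<ge> 0" unfolding R_def by (intro sum_nonneg) auto
  have d: "\<delta> \<ge> 0" unfolding \<delta>_def by (intro sum_nonneg) auto
  have K: "K \<ge> 1" unfolding K_def by (rule symb_bound_ge)
  define a a' b b' where "a = symb h \<xi>" and "a' = symb h (Re_part \<xi>)"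
    and "b = symb h (lshift l \<xi>)" and "b' = symb h (lshift l (Re_part \<xi>))"
  have b: "norm b \<ge> 2/3 * (1 + R)" unfolding b_def R_def by (rule norm_symb_lshift_lower[OF assms(1) False])
  have b': "norm b' \<ge> 2/3 * (1 + R)"
    using norm_symb_lshift_lower[OF Re_part_in_strip_box[OF assms(1)] False] by (simp add: b'_def R_def)
  have nz: "b \<noteq> 0" "b' \<noteq> 0" using b b' R by auto
  have a': "norm a' \<le> K" unfolding a'_def K_def by (intro norm_symb_le Re_part_in_strip_box assms)
  have db: "norm (b - b') \<le> 2 * \<delta> * (1 + R)" unfolding b_def b'_def R_def \<delta>_def by (rule symb_diff_le[OF assms(1)])
  have z: "lshift (\<lambda>_. 0) \<xi> = \<xi>" for \<xi> :: "'d \<Rightarrow> complex" by (simp add: lshift_def)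
  have "norm (a - a') \<le> 2 * \<delta> * (1 + shifted_sq (\<lambda>_. 0) \<xi>)"
    using symb_diff_le[OF assms(1), of h "\<lambda>_. 0"] unfolding a_def a'_def z \<delta>_def .
  also have "\<dots> \<le> 2 * \<delta> * K"
  proof (intro mult_left_mono)
    have "(Re (\<xi> j))\<^sup>2 \<le> 16" for j
      using strip_boxD(1)[OF assms(1), of j] abs_le_square_iff[of "Re (\<xi> j)" 4] by simp
    then have "(\<Sum>j\<in>UNIV. (Re (\<xi> j))\<^sup>2) \<le> (\<Sum>j\<in>(UNIV::'d set). 16)" by (intro sum_mono)
    then show "1 + shifted_sq (\<lambda>_. 0) \<xi> \<le> K" by (simp add: K_def symb_bound_def)
  qed (use d in auto)
  finally have da: "norm (a - a') \<le> 2 * \<delta> * K" .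
  have "a / b - a' / b' = (a - a') / b + a' * (b' - b) / (b * b')" using nz by (simp add: field_simps)
  also have "norm \<dots> \<le> norm (a - a') / norm b + norm a' * norm (b - b') / (norm b * norm b')"
    by (rule order_trans[OF norm_triangle_ineq]) (simp add: norm_divide norm_mult norm_minus_commute)
  also have "\<dots> \<le> (2 * \<delta> * K) / (2/3 * (1 + R)) + K * (2 * \<delta> * (1 + R)) / ((2/3 * (1 + R)) * (2/3 * (1 + R)))"
    using da db a' b b' R K d by (intro add_mono frac_le mult_mono) auto
  \<comment> \<open>The two fractions contribute 3 and 9/2 times
    \<open>\<delta> * K / (1 + R)\<close>, together 15/2 = 5 * 3/2.\<close>
  also have "\<dots> = 5 * \<delta> * (3/2 * K * (1 / (1 + R)))"
  proof -
    have *: "2 * \<delta> * K / (2/3 * u) + K * (2 * \<delta> * u) / ((2/3 * u) * (2/3 * u)) = 5 * \<delta> * (3/2 * K * (1 / u))"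
      if "u > 0" for u :: real using that by (simp add: field_simps)
    show ?thesis by (rule *) (use R in linarith)
  qed
  finally have diff: "norm (rho h l \<xi> - rho h l (Re_part \<xi>)) \<le> 5 * \<delta> * (3/2 * K * (1 / (1 + R)))"
    using False by (simp add: rho_def a_def a'_def b_def b'_def)
  have "norm (rho h l \<xi> ^ m - rho h l (Re_part \<xi>) ^ m) \<le> real m * (5 * \<delta>) * (3/2 * K * (1 / (1 + R))) ^ m"
  proof (rule norm_power_diff_le[OF _ _ diff])
    show "norm (rho h l \<xi>) \<le> 3/2 * K * (1 / (1 + R))" unfolding R_def K_def by (rule norm_rho_le[OF assms False])
    show "norm (rho h l (Re_part \<xi>)) \<le> 3/2 * K * (1 / (1 + R))"
      using norm_rho_le[OF Re_part_in_strip_box[OF assms(1)] assms(2,3) False] by (simp add: R_def K_def)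
  qed
  also have "(3/2 * K * (1 / (1 + R))) ^ m = (3/2 * K) ^ m * (1 / (1 + R)) ^ m"
    by (simp only: power_mult_distrib)
  also have "real m * (5 * \<delta>) * \<dots> \<le> real m * (5 * \<delta>) * ((3/2 * K) ^ m * lattice_weight m l)"
    using shifted_sq_lower(1)[OF assms(1), of l m] K d by (intro mult_left_mono) (auto simp: R_def)
  finally show ?thesis unfolding K_def \<delta>_def by (simp only: mult.assoc)
qed

lemma norm_infsum_le_infsum:
  fixes f :: "'i \<Rightarrow> 'b::banach"
  assumes M: "M summable_on UNIV" and le: "\<And>i. norm (f i) \<le> M i"
  shows "(\<lambda>i. norm (f i)) summable_on UNIV" "f summable_on UNIV" "norm (\<Sum>\<^sub>\<infinity>i. f i) \<le> (\<Sum>\<^sub>\<infinity>i. M i)"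
proof -
  show 1: "(\<lambda>i. norm (f i)) summable_on UNIV" by (rule summable_on_comparison_test[OF M]) (use le in auto)
  show "f summable_on UNIV" by (rule abs_summable_summable[OF 1])
  have "norm (\<Sum>\<^sub>\<infinity>i. f i) \<le> (\<Sum>\<^sub>\<infinity>i. norm (f i))" by (rule norm_infsum_bound[OF 1])
  also have "\<dots> \<le> (\<Sum>\<^sub>\<infinity>i. M i)" by (rule infsum_mono[OF 1 M]) (use le in auto)
  finally show "norm (\<Sum>\<^sub>\<infinity>i. f i) \<le> (\<Sum>\<^sub>\<infinity>i. M i)" .
qed

lemma infsum_diff_banach:
  fixes f g :: "'i \<Rightarrow> 'b::banach"
  assumes "f summable_on UNIV" "g summable_on UNIV"
  shows "(\<Sum>\<^sub>\<infinity>i. f i - g i) = (\<Sum>\<^sub>\<infinity>i. f i) - (\<Sum>\<^sub>\<infinity>i. g i)"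
  using infsum_add[OF assms(1), of "\<lambda>i. - g i"] assms(2) by (simp add: infsum_uminus summable_on_uminus)

lemma norm_phase: "norm (phase y \<xi>) = exp (- (\<Sum>j\<in>UNIV. y j * Im (\<xi> j)))"
  by (simp add: phase_def Re_sum Im_sum)

lemma norm_phase_lshift [simp]: "norm (phase y (lshift l \<xi>)) = exp (- (\<Sum>j\<in>UNIV. y j * Im (\<xi> j)))"
  by (simp add: norm_phase lshift_def)

lemma phase_0 [simp]: "phase (\<lambda>_. 0) \<xi> = 1" by (simp add: phase_def)

lemma phase_add: "phase (\<lambda>j. y j + z j) \<xi> = phase y \<xi> * phase z \<xi>"
  by (simp add: phase_def exp_add[symmetric] algebra_simps sum.distrib)

lemma phase_int_lshift: "phase (\<lambda>j. of_int (k j)) (lshift l \<xi>) = phase (\<lambda>j. of_int (k j)) \<xi>"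
proof -
  have "\<i> * (\<Sum>j\<in>UNIV. of_real (of_int (k j)) * lshift l \<xi> j)
      = \<i> * (\<Sum>j\<in>UNIV. of_real (of_int (k j)) * \<xi> j) + \<i> * (of_int (\<Sum>j\<in>UNIV. k j * l j) * (of_real pi * 2))"
    by (simp add: lshift_def algebra_simps sum.distrib sum_distrib_left)
  then show ?thesis unfolding phase_def by (simp only: exp_plus_2pin)
qed

context
  fixes m :: nat and h :: real and ty :: "'d::finite itself"
  assumes m: "real m > real CARD('d) / 2" and h: "0 < h" "h \<le> 1"
begin

lemma numer_term_le:
  fixes \<xi> :: "'d \<Rightarrow> complex"
  assumes "\<xi> \<in> strip_box"
  shows "norm (phase y (lshift l \<xi>) * rho h l \<xi> ^ m)
    \<le> exp (- (\<Sum>j\<in>UNIV. y j * Im (\<xi> j))) * ((3/2 * symb_bound TYPE('d)) ^ m * lattice_weight m l)"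
  unfolding norm_mult norm_phase_lshift by (intro mult_left_mono norm_rho_power_le assms h) auto

lemma numer_majorant_summable:
  "(\<lambda>l::'d \<Rightarrow> int. c * ((3/2 * symb_bound TYPE('d)) ^ m * lattice_weight m l)) summable_on UNIV"
  by (intro summable_on_cmult_right summable_lattice_weight m)

lemma infsum_numer_majorant:
  "(\<Sum>\<^sub>\<infinity>l::'d \<Rightarrow> int. c * ((3/2 * symb_bound TYPE('d)) ^ m * lattice_weight m l)) = c * numer_bound TYPE('d) m"
  by (simp add: infsum_cmult_right' numer_bound_def)

text \<open>In the bound \<open>y\<close> enters only through exp(- y . Im \<xi>), the factor that
  becomes exponential decay once the contour is moved.\<close>

lemma numer_summable:
  fixes \<xi> :: "'d \<Rightarrow> complex"
  assumes "\<xi> \<in> strip_box"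
  shows "(\<lambda>l. norm (phase y (lshift l \<xi>) * rho h l \<xi> ^ m)) summable_on UNIV"
    and "(\<lambda>l. phase y (lshift l \<xi>) * rho h l \<xi> ^ m) summable_on UNIV"
    and "norm (numer m h y \<xi>) \<le> exp (- (\<Sum>j\<in>UNIV. y j * Im (\<xi> j))) * numer_bound TYPE('d) m"
  using norm_infsum_le_infsum[OF numer_majorant_summable numer_term_le[OF assms]]
  unfolding numer_def infsum_numer_majorant by blast+

text \<open>The comparison point is the projection to real arguments, where a lower bound is
  available; hence only the imaginary parts enter.\<close>

lemma denom_diff:
  fixes \<xi> :: "'d \<Rightarrow> complex"
  assumes "\<xi> \<in> strip_box"
  shows "norm (numer m h (\<lambda>_. 0) \<xi> - numer m h (\<lambda>_. 0) (Re_part \<xi>))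
     \<le> real m * (5 * (\<Sum>j\<in>UNIV. \<bar>Im (\<xi> j)\<bar>)) * numer_bound TYPE('d) m"
proof -
  let ?c = "real m * (5 * (\<Sum>j\<in>UNIV. \<bar>Im (\<xi> j)\<bar>))"
  have "numer m h (\<lambda>_. 0) \<xi> - numer m h (\<lambda>_. 0) (Re_part \<xi>)
     = (\<Sum>\<^sub>\<infinity>l. rho h l \<xi> ^ m - rho h l (Re_part \<xi>) ^ m)"
    using numer_summable(2)[OF assms, of "\<lambda>_. 0"] numer_summable(2)[OF Re_part_in_strip_box[OF assms], of "\<lambda>_. 0"]
    by (simp add: numer_def infsum_diff_banach)
  also have "norm \<dots> \<le> (\<Sum>\<^sub>\<infinity>l::'d \<Rightarrow> int. ?c * ((3/2 * symb_bound TYPE('d)) ^ m * lattice_weight m l))"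
  proof (rule norm_infsum_le_infsum(3))
    show "(\<lambda>l::'d \<Rightarrow> int. ?c * ((3/2 * symb_bound TYPE('d)) ^ m * lattice_weight m l)) summable_on UNIV"
      by (rule numer_majorant_summable)
    show "norm (rho h l \<xi> ^ m - rho h l (Re_part \<xi>) ^ m) \<le> ?c * ((3/2 * symb_bound TYPE('d)) ^ m * lattice_weight m l)" for l
      using rho_diff_le[OF assms h, of l m] by (simp only: mult.assoc)
  qed
  finally show ?thesis unfolding infsum_numer_majorant .
qed

end

section \<open>Real arguments and the folded series\<close>

definition ct :: "('d \<Rightarrow> real) \<Rightarrow> 'd \<Rightarrow> complex" where "ct t = (\<lambda>j. of_real (t j))"

lemma Re_part_ct: "Re_part \<xi> = ct (\<lambda>j. Re (\<xi> j))" by (simp add: ct_def)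

lemma symb_lshift_ct:
  "symb h (lshift l (ct t)) = of_real (h\<^sup>2 + (\<Sum>j\<in>UNIV. (t j + 2 * pi * of_int (l j))\<^sup>2))"
  by (simp add: symb_def lshift_def ct_def)

lemma lshift_0 [simp]: "lshift (\<lambda>_. 0) \<xi> = \<xi>" by (simp add: lshift_def)

lemma symb_ct: "symb h (ct t) = of_real (h\<^sup>2 + (\<Sum>j\<in>UNIV. (t j)\<^sup>2))"
  by (simp add: symb_def ct_def)

lemma rho_ct: "\<exists>r\<ge>0. rho h l (ct t) = of_real r"
proof (cases "l = (\<lambda>_. 0)")
  case False
  then show ?thesis unfolding rho_def symb_lshift_ct symb_ct
    by (intro exI[of _ "(h\<^sup>2 + (\<Sum>j\<in>UNIV. (t j)\<^sup>2)) / (h\<^sup>2 + (\<Sum>j\<in>UNIV. (t j + 2 * pi * of_int (l j))\<^sup>2))"])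
       (auto intro!: divide_nonneg_nonneg add_nonneg_nonneg sum_nonneg)
qed (auto simp: rho_def intro: exI[of _ 1])

lemma symb_ct_nonzero:
  assumes "h > 0" shows "symb h (lshift l (ct t)) \<noteq> 0"
proof -
  have "0 < h\<^sup>2 + (\<Sum>j\<in>UNIV. (t j + 2 * pi * of_int (l j))\<^sup>2)"
    using assms by (intro add_pos_nonneg sum_nonneg) auto
  then show ?thesis unfolding symb_lshift_ct of_real_eq_0_iff by linarith
qed

text \<open>The folded series N_y. It is genuinely periodic, whereas \<open>numer\<close> carries
  the non-periodic factor \<open>symb ^ m\<close>.\<close>

definition periodized :: "nat \<Rightarrow> real \<Rightarrow> ('d::finite \<Rightarrow> real) \<Rightarrow> ('d \<Rightarrow> complex) \<Rightarrow> complex" where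
  "periodized m h y \<xi> = (\<Sum>\<^sub>\<infinity>l. phase y (lshift l \<xi>) / symb h (lshift l \<xi>) ^ m)"

text \<open>For m > 0 the two sides differ at a zero of \<open>symb\<close>: there the right side is
  0, while the term l = 0 of \<open>numer\<close> is still a phase.\<close>

lemma numer_eq_periodized:
  assumes "symb h \<xi> \<noteq> 0"
  shows "numer m h y \<xi> = symb h \<xi> ^ m * periodized m h y \<xi>"
  unfolding numer_def periodized_def infsum_cmult_right'[symmetric]
  by (rule infsum_cong) (use assms in \<open>auto simp: rho_def power_divide\<close>)

lemma lshift_lshift: "lshift l (lshift k \<xi>) = lshift (\<lambda>j. l j + k j) \<xi>"
  by (auto simp: lshift_def algebra_simps)

lemma periodized_lshift: "periodized m h y (lshift k \<xi>) = periodized m h y \<xi>"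
proof -
  have "bij_betw (\<lambda>l j. l j + k j) UNIV UNIV"
    by (rule bij_betw_byWitness[where f'="\<lambda>l j. l j - k j"]) auto
  from infsum_reindex_bij_betw[OF this, of "\<lambda>l. phase y (lshift l \<xi>) / symb h (lshift l \<xi>) ^ m"]
  show ?thesis unfolding periodized_def lshift_lshift .
qed

text \<open>A character with integer frequencies does not see lattice shifts, so it can be pulled
  out of the series. This yields both the values at grid points and the translates of the
  kernel.\<close>

lemma periodized_phase:
  "periodized m h (\<lambda>j. y j + of_int (k j)) \<xi> = phase (\<lambda>j. of_int (k j)) \<xi> * periodized m h y \<xi>"
  unfolding periodized_def infsum_cmult_right'[symmetric]
  by (rule infsum_cong) (simp add: phase_add phase_int_lshift)

context
  fixes m :: nat and h :: real and ty :: "'d::finite itself"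
  assumes m: "real m > real CARD('d) / 2" and h: "0 < h" "h \<le> 1"
begin

text \<open>At real arguments all terms are nonnegative and the term l = 0 equals 1, whatever
  \<open>h\<close> is.\<close>

lemma Re_denom_ge_1:
  fixes t :: "'d \<Rightarrow> real"
  assumes "ct t \<in> strip_box"
  shows "Re (numer m h (\<lambda>_. 0) (ct t)) \<ge> 1"
proof -
  let ?f = "\<lambda>l. rho h l (ct t) ^ m"
  have s: "?f summable_on UNIV" using numer_summable(2)[OF m h assms, of "\<lambda>_. 0"] by simp
  have nn: "Re (?f l) \<ge> 0" for l
  proof -
    obtain r where "r \<ge> 0" "rho h l (ct t) = of_real r" using rho_ct by blast
    then show ?thesis by (simp flip: of_real_power)
  qed
  have "sum (\<lambda>l. Re (?f l)) {\<lambda>_. 0} \<le> (\<Sum>\<^sub>\<infinity>l. Re (?f l))"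
    by (rule finite_sum_le_infsum) (use nn summable_on_bounded_linear[OF bounded_linear_Re s] in \<open>auto simp: o_def\<close>)
  also have "\<dots> = Re (\<Sum>\<^sub>\<infinity>l. ?f l)"
    using has_sum_bounded_linear[OF bounded_linear_Re has_sum_infsum[OF s]] by (rule infsumI)
  finally show ?thesis by (simp add: numer_def rho_def)
qed

lemma numer_bound_ge_1: "numer_bound TYPE('d) m \<ge> 1"
proof -
  have "sum (lattice_weight m) {\<lambda>_::'d. 0} \<le> (\<Sum>\<^sub>\<infinity>l::'d\<Rightarrow>int. lattice_weight m l)"
    by (rule finite_sum_le_infsum) (use summable_lattice_weight[OF m] lattice_weight_pos in \<open>auto intro: less_imp_le\<close>)
  then have 1: "1 \<le> (\<Sum>\<^sub>\<infinity>l::'d\<Rightarrow>int. lattice_weight m l)" by simp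
  have "1 \<le> (3/2 * symb_bound TYPE('d)) ^ m" by (rule one_le_power) (simp add: symb_bound_def)
  with 1 have "1 * 1 \<le> numer_bound TYPE('d) m" unfolding numer_bound_def by (intro mult_mono) auto
  then show ?thesis by simp
qed

text \<open>With B = \<open>numer_bound\<close> and D the sum of the |Im|, the change from the real
  part is at most 5 m B D. For D <= 1 / (10 m B) this is at most 1/2, half of the lower bound 1 at
  real arguments.\<close>

lemma norm_denom_ge:
  fixes \<xi> :: "'d \<Rightarrow> complex"
  assumes "\<xi> \<in> strip_box" "(\<Sum>j\<in>UNIV. \<bar>Im (\<xi> j)\<bar>) \<le> 1 / (10 * real m * numer_bound TYPE('d) m)"
  shows "norm (numer m h (\<lambda>_. 0) \<xi>) \<ge> 1/2"
proof -
  have m0: "real m > 0" using m by (smt (verit) divide_nonneg_nonneg of_nat_0_le_iff)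
  have S: "numer_bound TYPE('d) m > 0" using numer_bound_ge_1 by linarith
  have "real m * (5 * (\<Sum>j\<in>UNIV. \<bar>Im (\<xi> j)\<bar>)) * numer_bound TYPE('d) m
      \<le> real m * (5 * (1 / (10 * real m * numer_bound TYPE('d) m))) * numer_bound TYPE('d) m"
    using assms(2) S by (intro mult_right_mono mult_left_mono) auto
  also have "\<dots> = 1/2" using S m0 by (simp add: field_simps)
  finally have 1: "norm (numer m h (\<lambda>_. 0) \<xi> - numer m h (\<lambda>_. 0) (Re_part \<xi>)) \<le> 1/2"
    using denom_diff[OF m h assms(1)] by linarith
  have "1 \<le> norm (numer m h (\<lambda>_. 0) (Re_part \<xi>))"
    using Re_denom_ge_1[of "\<lambda>j. Re (\<xi> j)"] Re_part_in_strip_box[OF assms(1)] complex_Re_le_cmod order_trans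
    unfolding Re_part_ct by blast
  then show ?thesis using 1 norm_triangle_ineq3[of "numer m h (\<lambda>_. 0) \<xi>" "numer m h (\<lambda>_. 0) (Re_part \<xi>)"] by linarith
qed

section \<open>Analyticity and continuity of the series\<close>

lemma rho_strip_nonzero:
  fixes \<xi> :: "'d \<Rightarrow> complex"
  assumes "\<xi> \<in> strip_box" "l \<noteq> (\<lambda>_. 0)"
  shows "symb h (lshift l \<xi>) \<noteq> 0"
  using norm_symb_lshift_lower[OF assms, of h] shifted_sq_lower(2)[OF assms] by auto

text \<open>Weierstrass M-test. The majorant may depend on \<open>y\<close>, since only regularity
  at fixed \<open>y\<close> is at stake; |Im| <= 1 bounds the phase.\<close>

lemma numer_uniform_limit:
  assumes "A \<subseteq> strip_box"
  shows "uniform_limit (A :: ('d \<Rightarrow> complex) set) (\<lambda>X \<xi>. \<Sum>l\<in>X. phase y (lshift l \<xi>) * rho h l \<xi> ^ m)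
     (\<lambda>\<xi>. numer m h y \<xi>) (finite_subsets_at_top UNIV)"
  unfolding numer_def
proof (rule Weierstrass_m_test_general[OF _ numer_majorant_summable[OF m h]])
  fix l :: "'d \<Rightarrow> int" and \<xi> :: "'d \<Rightarrow> complex" assume "\<xi> \<in> A"
  then have x: "\<xi> \<in> strip_box" using assms by blast
  have "- (\<Sum>j\<in>UNIV. y j * Im (\<xi> j)) \<le> (\<Sum>j\<in>UNIV. \<bar>y j\<bar>)" unfolding sum_negf[symmetric]
  proof (rule sum_mono)
    fix j
    have "- (y j * Im (\<xi> j)) \<le> \<bar>y j\<bar> * \<bar>Im (\<xi> j)\<bar>" by (metis abs_ge_minus_self abs_mult)
    also have "\<dots> \<le> \<bar>y j\<bar>" using strip_boxD(2)[OF x, of j] by (simp add: mult_left_le)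
    finally show "- (y j * Im (\<xi> j)) \<le> \<bar>y j\<bar>" .
  qed
  then have "exp (- (\<Sum>j\<in>UNIV. y j * Im (\<xi> j))) * ((3/2 * symb_bound TYPE('d)) ^ m * lattice_weight m l)
     \<le> exp (\<Sum>j\<in>UNIV. \<bar>y j\<bar>) * ((3/2 * symb_bound TYPE('d)) ^ m * lattice_weight m l)"
    using symb_bound_ge[where 'd='d] lattice_weight_pos[of m l] by (intro mult_right_mono) auto
  then show "norm (phase y (lshift l \<xi>) * rho h l \<xi> ^ m)
     \<le> exp (\<Sum>j\<in>UNIV. \<bar>y j\<bar>) * ((3/2 * symb_bound TYPE('d)) ^ m * lattice_weight m l)"
    using numer_term_le[OF m h x] order_trans by blast
qed

lemma coordinate_in_strip_box:
  fixes t :: "'d \<Rightarrow> real"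
  assumes "\<And>j. \<bar>t j\<bar> \<le> 4" "\<bar>Re z\<bar> \<le> 4" "\<bar>Im z\<bar> \<le> 1"
  shows "(ct t)(i := z) \<in> strip_box"
proof -
  have "(\<Sum>j\<in>UNIV. \<bar>Im (((ct t)(i := z)) j)\<bar>) = (\<Sum>j\<in>{i}. \<bar>Im z\<bar>)"
    by (rule sum.mono_neutral_cong_right) (auto simp: ct_def)
  then show ?thesis using assms by (auto simp: strip_box_def ct_def)
qed

lemma symb_holomorphic: "(\<lambda>z. symb h (lshift l ((ct t)(i := z)))) holomorphic_on S"
proof -
  have "(\<lambda>z. lshift l ((ct t)(i := z)) j) holomorphic_on S" for j
    unfolding lshift_def by (cases "j = i") (auto intro!: holomorphic_intros)
  then show ?thesis unfolding symb_def by (intro holomorphic_intros)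
qed

lemma phase_holomorphic: "(\<lambda>z. phase y (lshift l ((ct t)(i := z)))) holomorphic_on S"
proof -
  have "(\<lambda>z. lshift l ((ct t)(i := z)) j) holomorphic_on S" for j
    unfolding lshift_def by (cases "j = i") (auto intro!: holomorphic_intros)
  then show ?thesis unfolding phase_def by (intro holomorphic_intros)
qed

text \<open>A locally uniform limit of holomorphic partial sums. Only one variable is complex, which
  is the setting of the contour shifts.\<close>

lemma numer_holomorphic:
  fixes t :: "'d \<Rightarrow> real"
  assumes t: "\<And>j. \<bar>t j\<bar> \<le> 4"
  shows "(\<lambda>z. numer m h y ((ct t)(i := z))) holomorphic_on {z. \<bar>Re z\<bar> < 4 \<and> \<bar>Im z\<bar> < 1}"
    (is "?g holomorphic_on ?S")
proof -
  have "?S = {z. Re z < 4} \<inter> {z. Re z > -4} \<inter> {z. Im z < 1} \<inter> {z. Im z > -1}" by auto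
  then have "open ?S" by (simp add: open_halfspace_Re_lt open_halfspace_Re_gt open_halfspace_Im_lt open_halfspace_Im_gt open_Int)
  have inb: "(ct t)(i := z) \<in> strip_box" if "z \<in> ?S" for z
    using that t by (intro coordinate_in_strip_box) auto
  let ?f = "\<lambda>X z. \<Sum>l\<in>X. phase y (lshift l ((ct t)(i := z))) * rho h l ((ct t)(i := z)) ^ m"
  have rho: "(\<lambda>z. rho h l ((ct t)(i := z))) holomorphic_on ?S" for l
  proof (cases "l = (\<lambda>_. 0)")
    case False
    have "(\<lambda>z. symb h ((ct t)(i := z)) / symb h (lshift l ((ct t)(i := z)))) holomorphic_on ?S"
      using symb_holomorphic[of "\<lambda>_. 0" t i ?S] rho_strip_nonzero[OF inb False]
      by (intro holomorphic_on_divide symb_holomorphic) auto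
    then show ?thesis using False by (simp add: rho_def)
  qed (simp add: rho_def)
  have f: "?f X holomorphic_on ?S" for X
    by (intro holomorphic_intros phase_holomorphic rho)
  have "\<exists>e>0. ?g holomorphic_on ball z e" if z: "z \<in> ?S" for z
  proof -
    obtain r where r: "r > 0" "cball z r \<subseteq> ?S" using \<open>open ?S\<close> z open_contains_cball by blast
    have ul: "uniform_limit (cball z r) ?f ?g (finite_subsets_at_top UNIV)"
    proof -
      have "uniform_limit ((\<lambda>z. (ct t)(i := z)) ` cball z r) (\<lambda>X \<xi>. \<Sum>l\<in>X. phase y (lshift l \<xi>) * rho h l \<xi> ^ m)
         (\<lambda>\<xi>. numer m h y \<xi>) (finite_subsets_at_top UNIV)"
        by (rule numer_uniform_limit) (use inb r in blast)
      then show ?thesis unfolding uniform_limit_iff by simp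
    qed
    have cf: "continuous_on (cball z r) (?f X) \<and> ?f X holomorphic_on ball z r" for X
      by (intro conjI holomorphic_on_imp_continuous_on[OF holomorphic_on_subset[OF f r(2)]]
          holomorphic_on_subset[OF f] order_trans[OF ball_subset_cball r(2)])
    have "?g holomorphic_on ball z r"
      by (rule holomorphic_uniform_limit[OF always_eventually[OF allI[OF cf]] ul finite_subsets_at_top_neq_bot])
    with r show ?thesis by blast
  qed
  then have "?g analytic_on ?S" unfolding analytic_on_def by blast
  then show ?thesis by (rule analytic_imp_holomorphic)
qed

lemma numer_continuous:
  "continuous_on {t. \<forall>j. \<bar>t j\<bar> \<le> 4} (\<lambda>t :: 'd \<Rightarrow> real. numer m h y (ct t))" (is "continuous_on ?A _")
proof -
  have inb: "ct t \<in> strip_box" if "t \<in> ?A" for t :: "'d \<Rightarrow> real"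
    using that by (auto simp: strip_box_def ct_def)
  let ?f = "\<lambda>X t. \<Sum>l\<in>X. phase y (lshift l (ct t)) * rho h l (ct t) ^ m"
  have co: "continuous_on ?A (\<lambda>t. lshift l (ct t) j)" for l j
    unfolding lshift_def ct_def
    by (intro continuous_intros continuous_on_subset[OF continuous_on_product_coordinates]) auto
  have sy: "continuous_on ?A (\<lambda>t. symb h (lshift l (ct t)))" for l
    unfolding symb_def by (intro continuous_intros co)
  have ph: "continuous_on ?A (\<lambda>t. phase y (lshift l (ct t)))" for l
    unfolding phase_def by (intro continuous_intros co)
  have rho: "continuous_on ?A (\<lambda>t. rho h l (ct t))" for l :: "'d \<Rightarrow> int"
  proof (cases "l = (\<lambda>_. 0)")
    case False
    have "continuous_on ?A (\<lambda>t. symb h (ct t) / symb h (lshift l (ct t)))"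
      using sy[of "\<lambda>_. 0"] rho_strip_nonzero[OF inb False]
      by (intro continuous_on_divide sy) auto
    then show ?thesis using False by (simp add: rho_def)
  qed (simp add: rho_def)
  have "uniform_limit ?A ?f (\<lambda>t. numer m h y (ct t)) (finite_subsets_at_top UNIV)"
  proof -
    have "uniform_limit (ct ` ?A) (\<lambda>X \<xi>. \<Sum>l\<in>X. phase y (lshift l \<xi>) * rho h l \<xi> ^ m)
       (\<lambda>\<xi>. numer m h y \<xi>) (finite_subsets_at_top UNIV)"
      by (rule numer_uniform_limit) (use inb in blast)
    then show ?thesis unfolding uniform_limit_iff by simp
  qed
  then show ?thesis
    by (rule uniform_limit_theorem[rotated]) (auto intro!: always_eventually continuous_intros ph rho)
qed

end

subsection \<open>Integration over the torus\<close>

text \<open>Closed, so that the torus is a compact cube; the doubled end point is a null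
  set.\<close>

abbreviation arc :: "real measure" where "arc \<equiv> restrict_space lborel {-pi..pi}"

lemma abs_le_pi: "\<bar>x\<bar> \<le> pi \<longleftrightarrow> x \<in> {-pi..pi}" by (auto simp: abs_le_iff)

definition torus :: "('d::finite \<Rightarrow> real) measure" where
  "torus = PiM UNIV (\<lambda>_. arc)"

lemma space_torus: "space torus = {t. \<forall>j. \<bar>t j\<bar> \<le> pi}"
  by (auto simp: torus_def space_PiM space_restrict_space abs_le_pi PiE_iff)

lemma space_torus_le_4: "t \<in> space torus \<Longrightarrow> \<bar>t j\<bar> \<le> 4"
  using pi_less_4 by (auto simp: space_torus intro: order_trans[of _ pi])

lemma ct_in_strip_box: "t \<in> space torus \<Longrightarrow> ct t \<in> strip_box"
  using space_torus_le_4 by (auto simp: strip_box_def ct_def)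

interpretation arcs: product_sigma_finite "\<lambda>_::'d::finite. arc"
proof -
  interpret sigma_finite_measure arc
    by (intro sigma_finite_measure_restrict_space sigma_finite_lborel) auto
  show "product_sigma_finite (\<lambda>_::'d::finite. arc)" by unfold_locales
qed

lemma integrable_arc_const [simp]: "integrable arc (\<lambda>_. c::'b::{banach,second_countable_topology})"
proof -
  have "finite_measure arc" by (intro finite_measure_restrict_space finite_measureI) (auto simp: emeasure_restrict_space space_restrict_space)
  then show ?thesis by (rule finite_measure.integrable_const)
qed

lemma integral_arc_const: "(\<integral>_. c \<partial>arc) = (2 * pi) *\<^sub>R (c::'b::{banach,second_countable_topology})"
  by (simp add: measure_restrict_space space_restrict_space)

lemma integrable_arcs_const:
  "integrable (PiM I (\<lambda>_::'d::finite. arc)) (\<lambda>_. c::real)"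
proof -
  have "integrable (PiM I (\<lambda>_::'d. arc)) (\<lambda>x. \<Prod>i\<in>I. 1::real)"
    by (rule arcs.product_integrable_prod) auto
  then have "integrable (PiM I (\<lambda>_::'d. arc)) (\<lambda>x. c * (\<Prod>i\<in>I. 1::real))" by (rule integrable_mult_right)
  then show ?thesis by simp
qed

lemma integral_torus_const: "(\<integral>t. c \<partial>(torus :: ('d::finite \<Rightarrow> real) measure)) = (2 * pi) ^ CARD('d) * (c::real)"
proof -
  have "(\<integral>t. (\<Prod>i\<in>UNIV. 1::real) \<partial>(torus :: ('d::finite \<Rightarrow> real) measure)) = (2 * pi) ^ CARD('d)"
    unfolding torus_def using arcs.product_integral_prod[of UNIV "\<lambda>_ _. 1::real"]
    by (simp add: measure_restrict_space space_restrict_space)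
  then show ?thesis by (simp add: mult.commute)
qed

lemma integrable_torus_bounded:
  fixes f :: "('d::finite \<Rightarrow> real) \<Rightarrow> 'b::{banach,second_countable_topology}"
  assumes "f \<in> borel_measurable torus" "\<And>t. t \<in> space torus \<Longrightarrow> norm (f t) \<le> B"
  shows "integrable torus f"
  by (rule Bochner_Integration.integrable_bound[OF _ assms(1), of "\<lambda>_. B"])
     (use assms(2) integrable_arcs_const in \<open>fastforce simp: torus_def intro: AE_I2 order_trans[OF _ abs_ge_self]\<close>)+

lemma norm_integral_torus_le:
  fixes f :: "('d::finite \<Rightarrow> real) \<Rightarrow> 'b::{banach,second_countable_topology}"
  assumes "\<And>t. t \<in> space torus \<Longrightarrow> norm (f t) \<le> B"
  shows "norm (\<integral>t. f t \<partial>torus) \<le> (2 * pi) ^ CARD('d) * B"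
proof -
  have "norm (\<integral>t. f t \<partial>torus) \<le> (\<integral>t. norm (f t) \<partial>torus)" by (rule integral_norm_bound)
  also have "\<dots> \<le> (\<integral>t. B \<partial>(torus :: ('d \<Rightarrow> real) measure))"
    by (rule integral_mono') (use assms integrable_arcs_const in \<open>auto simp: torus_def intro: order_trans[OF norm_ge_zero]\<close>)
  finally show ?thesis unfolding integral_torus_const .
qed

text \<open>Over a finite index set the product sigma-algebra of the coordinates is the Borel
  sigma-algebra of the product topology.\<close>

lemma borel_measurable_torus:
  fixes f :: "('d::finite \<Rightarrow> real) \<Rightarrow> 'b::topological_space"
  assumes "continuous_on (space torus) f"
  shows "f \<in> borel_measurable torus"
proof -
  have "(\<lambda>t j. t j) \<in> measurable torus (PiM UNIV (\<lambda>_::'d. borel :: real measure))"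
  proof (rule measurable_PiM_single')
    fix j
    have "(\<lambda>t. t j) \<in> measurable torus arc" unfolding torus_def by (rule measurable_component_singleton) simp
    moreover have "(\<lambda>x. x) \<in> measurable arc (borel :: real measure)"
      by (rule measurable_restrict_space1) simp
    ultimately show "(\<lambda>t. t j) \<in> borel_measurable torus" by (rule measurable_compose)
  qed auto
  then have "(\<lambda>t. t) \<in> measurable torus (borel :: ('d \<Rightarrow> real) measure)"
    unfolding measurable_cong_sets[OF refl sets_PiM_equal_borel] .
  then have "(\<lambda>t. t) \<in> measurable torus (restrict_space borel (space torus) :: ('d \<Rightarrow> real) measure)"
    by (simp add: measurable_restrict_space2_iff)
  from measurable_compose[OF this borel_measurable_continuous_on_restrict[OF assms]]
  show ?thesis .
qed

lemma integrable_torus_continuous: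
  fixes f :: "('d::finite \<Rightarrow> real) \<Rightarrow> 'b::{banach,second_countable_topology}"
  assumes "continuous_on (space torus) f" "\<And>t. t \<in> space torus \<Longrightarrow> norm (f t) \<le> B"
  shows "integrable torus f"
  by (rule integrable_torus_bounded[OF borel_measurable_torus[OF assms(1)] assms(2)])

lemma integral_torus_coordinate:
  fixes f :: "('d::finite \<Rightarrow> real) \<Rightarrow> 'b::{banach,second_countable_topology}"
  assumes "integrable torus f"
  shows "(\<integral>t. f t \<partial>torus) = (\<integral>x. (\<integral>y. f (x(i := y)) \<partial>arc) \<partial>PiM (UNIV - {i}) (\<lambda>_. arc))"
  using arcs.product_integral_insert[of "UNIV - {i}" i f] assms by (simp add: torus_def insert_absorb)

lemma integral_arc_eq:
  fixes g :: "real \<Rightarrow> complex"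
  assumes "continuous_on {-pi..pi} g"
  shows "(\<integral>y. g y \<partial>arc) = integral {-pi..pi} g"
proof -
  have "(\<integral>y. g y \<partial>arc) = set_lebesgue_integral lborel {-pi..pi} g"
    by (simp add: integral_restrict_space set_lebesgue_integral_def)
  also have "\<dots> = integral {-pi..pi} g"
    by (rule set_borel_integral_eq_integral(2)) (rule borel_integrable_atLeastAtMost'[OF assms])
  finally show ?thesis .
qed

text \<open>Fubini isolates the variable \<open>i\<close>; for fixed real values of the others its
  contour is moved to height \<open>s\<close>, where the integrand is bounded by
  \<open>B\<close>.\<close>

lemma norm_torus_integral_shift_le:
  fixes F :: "('d::finite \<Rightarrow> complex) \<Rightarrow> complex"
  assumes int: "integrable torus (\<lambda>t. F (ct t))"
    and hol: "\<And>t. t \<in> space torus \<Longrightarrow> (\<lambda>z. F ((ct t)(i := z))) holomorphic_on {z. \<bar>Re z\<bar> < 4 \<and> \<bar>Im z\<bar> < b}"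
    and per: "\<And>t v. t \<in> space torus \<Longrightarrow> \<bar>v\<bar> < b \<Longrightarrow> F ((ct t)(i := Complex pi v)) = F ((ct t)(i := Complex (-pi) v))"
    and bd: "\<And>t u. t \<in> space torus \<Longrightarrow> \<bar>u\<bar> \<le> pi \<Longrightarrow> norm (F ((ct t)(i := Complex u s))) \<le> B"
    and s: "\<bar>s\<bar> < b"
  shows "norm (\<integral>t. F (ct t) \<partial>torus) \<le> (2 * pi) ^ CARD('d) * B"
proof -
  let ?M = "PiM (UNIV - {i}) (\<lambda>_::'d. arc)"
  have inner: "norm (\<integral>y. F (ct (x(i := y))) \<partial>arc) \<le> 2 * pi * B" if x: "x \<in> space ?M" for x
  proof -
    \<comment> \<open>Points of the smaller product are \<open>undefined\<close> at
      \<open>i\<close>; 0 is an arbitrary filler that puts \<open>t\<close> on the torus and is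
      overwritten by \<open>z\<close>.\<close>
    define t where "t = x(i := 0)"
    have t: "t \<in> space torus" using x
      by (auto simp: t_def space_torus space_PiM PiE_iff space_restrict_space abs_le_pi)
    define g where "g z = F ((ct t)(i := z))" for z
    have eq: "F (ct (x(i := y))) = g (of_real y)" for y
      unfolding g_def by (rule arg_cong[where f=F]) (auto simp: t_def ct_def)
    have g: "g holomorphic_on {z. \<bar>Re z\<bar> < 4 \<and> \<bar>Im z\<bar> < b}" unfolding g_def by (rule hol[OF t])
    then have gc: "continuous_on {z. \<bar>Re z\<bar> < 4 \<and> \<bar>Im z\<bar> < b} g" by (rule holomorphic_on_imp_continuous_on)
    have cont: "continuous_on {-pi..pi} (\<lambda>u. g (Complex u v))" if "\<bar>v\<bar> < b" for v
      by (rule continuous_on_compose2[OF gc])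
         (use that pi_less_4 in \<open>auto simp: Complex_eq intro!: continuous_intros\<close>)
    have b: "b > 0" using s by linarith
    have "(\<integral>y. F (ct (x(i := y))) \<partial>arc) = integral {-pi..pi} (\<lambda>u. g (of_real u))"
      unfolding eq by (rule integral_arc_eq) (use cont[of 0] b in \<open>simp add: complex_of_real_def\<close>)
    also have "\<dots> = integral {-pi..pi} (\<lambda>u. g (Complex u s))"
      by (rule integral_horizontal_shift[OF g pi_less_4 s]) (use per[OF t] in \<open>simp add: g_def\<close>)
    also have "norm \<dots> \<le> B * (pi - - pi)"
      by (rule integral_bound[OF _ cont[OF s]]) (use bd[OF t] in \<open>auto simp: g_def abs_le_iff\<close>)
    finally show ?thesis by (simp add: mult_ac)
  qed
  have "norm (\<integral>t. F (ct t) \<partial>torus) \<le> (\<integral>x. norm (\<integral>y. F (ct (x(i := y))) \<partial>arc) \<partial>?M)"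
    unfolding integral_torus_coordinate[OF int, of i] by (rule integral_norm_bound)
  also have "\<dots> \<le> (\<integral>x. 2 * pi * B \<partial>?M)"
    by (rule integral_mono') (use inner integrable_arcs_const order_trans[OF norm_ge_zero inner] in auto)
  \<comment> \<open>Fubini for a constant, read backwards, avoids computing the volume of the torus
    of dimension d - 1.\<close>
  also have "\<dots> = (\<integral>t. B \<partial>(torus :: ('d \<Rightarrow> real) measure))"
  proof -
    have "integrable torus (\<lambda>_ :: 'd \<Rightarrow> real. B)" unfolding torus_def by (rule integrable_arcs_const)
    from integral_torus_coordinate[OF this, of i] show ?thesis
      by (simp only: integral_arc_const real_scaleR_def)
  qed
  finally show ?thesis unfolding integral_torus_const .
qed

section \<open>Exponential decay by contour shift\<close>

text \<open>The threshold of \<open>norm_denom_ge\<close>: with one complex variable, up to this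
  height the denominator has modulus at least 1/2.\<close>

definition decay :: "'d::finite itself \<Rightarrow> nat \<Rightarrow> real" where
  "decay d m = 1 / (10 * real m * numer_bound d m)"

text \<open>An integral, not yet a mean: the factor \<open>(2 * pi) ^ CARD('d)\<close> is divided
  out in \<open>cardinal_fun\<close>, where also y = x / h is inserted.\<close>

definition cardinal_int :: "nat \<Rightarrow> real \<Rightarrow> ('d::finite \<Rightarrow> real) \<Rightarrow> complex" where
  "cardinal_int m h y = (\<integral>t. periodized m h y (ct t) / periodized m h (\<lambda>_. 0) (ct t) \<partial>torus)"

text \<open>Up to normalisation these are the Fourier coefficients of 1 / sigma_m, since sigma_m is
  a positive multiple of N_0.\<close>

definition inverse_coeff :: "nat \<Rightarrow> real \<Rightarrow> ('d::finite \<Rightarrow> int) \<Rightarrow> complex" where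
  "inverse_coeff m h k = (\<integral>t. phase (\<lambda>j. of_int (k j)) (ct t) / periodized m h (\<lambda>_. 0) (ct t) \<partial>torus)"

context
  fixes m :: nat and h :: real and ty :: "'d::finite itself"
  assumes m: "real m > real CARD('d) / 2" and h: "0 < h" "h \<le> 1"
begin

abbreviation denom :: "('d \<Rightarrow> complex) \<Rightarrow> complex" where "denom \<equiv> numer m h (\<lambda>_. 0)"

lemma m_ge_1: "real m \<ge> 1"
proof -
  have "real m > 0" using m by (smt (verit) divide_nonneg_nonneg of_nat_0_le_iff)
  then show ?thesis by simp
qed

lemma decay_bounds: "0 < decay TYPE('d) m" "decay TYPE('d) m \<le> 1"
proof -
  have "1 * 1 \<le> real m * numer_bound TYPE('d) m"
    using m_ge_1 numer_bound_ge_1[OF m h] by (intro mult_mono) auto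
  then show "0 < decay TYPE('d) m" "decay TYPE('d) m \<le> 1" by (auto simp: decay_def field_simps)
qed

lemma strip_point:
  fixes t :: "'d \<Rightarrow> real"
  assumes "t \<in> space torus" "\<bar>Re z\<bar> \<le> 4" "\<bar>Im z\<bar> \<le> decay TYPE('d) m"
  shows "(ct t)(i := z) \<in> strip_box" "norm (denom ((ct t)(i := z))) \<ge> 1/2"
    "(\<Sum>j\<in>UNIV. y j * Im (((ct t)(i := z)) j)) = y i * Im z"
proof -
  show 1: "(ct t)(i := z) \<in> strip_box"
    using assms decay_bounds space_torus_le_4[OF assms(1)] by (intro coordinate_in_strip_box[OF m h]) auto
  have "(\<Sum>j\<in>UNIV. \<bar>Im (((ct t)(i := z)) j)\<bar>) = (\<Sum>j\<in>{i}. \<bar>Im z\<bar>)"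
    by (rule sum.mono_neutral_cong_right) (auto simp: ct_def)
  then show "norm (denom ((ct t)(i := z))) \<ge> 1/2"
    using assms(3) by (intro norm_denom_ge[OF m h 1]) (simp add: decay_def)
  have "(\<Sum>j\<in>UNIV. y j * Im (((ct t)(i := z)) j)) = (\<Sum>j\<in>{i}. y i * Im z)"
    by (rule sum.mono_neutral_cong_right) (auto simp: ct_def)
  then show "(\<Sum>j\<in>UNIV. y j * Im (((ct t)(i := z)) j)) = y i * Im z" by simp
qed

lemma continuous_numer_torus: "continuous_on (space torus) (\<lambda>t :: 'd \<Rightarrow> real. numer m h y (ct t))"
  by (rule continuous_on_subset[OF numer_continuous[OF m h]]) (use space_torus_le_4 in blast)

lemma norm_denom_torus_ge_1: "t \<in> space torus \<Longrightarrow> 1 \<le> norm (denom (ct (t :: 'd \<Rightarrow> real)))"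
  using Re_denom_ge_1[OF m h ct_in_strip_box] complex_Re_le_cmod order_trans by blast

lemma denom_torus_nonzero: "t \<in> space torus \<Longrightarrow> denom (ct (t :: 'd \<Rightarrow> real)) \<noteq> 0"
  using norm_denom_torus_ge_1[of t] by auto

lemma norm_numer_torus_le:
  assumes "t \<in> space torus" shows "norm (numer m h y (ct (t :: 'd \<Rightarrow> real))) \<le> numer_bound TYPE('d) m"
  using numer_summable(3)[OF m h ct_in_strip_box[OF assms], of y] by (simp add: ct_def)

text \<open>On the edges the real part is at least pi^2 - 1 > 0, so there the quotients can be
  rewritten through the periodic series.\<close>

lemma symb_shift_edge_nonzero:
  fixes t :: "'d \<Rightarrow> real"
  assumes "\<bar>v\<bar> \<le> 1" "\<bar>u\<bar> = pi"
  shows "symb h ((ct t)(i := Complex u v)) \<noteq> 0"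
proof -
  let ?x = "(ct t)(i := Complex u v)"
  have "Re (symb h ?x) = h\<^sup>2 + (\<Sum>j\<in>UNIV. Re ((?x j)\<^sup>2))" by (simp add: symb_def)
  moreover have "(\<Sum>j\<in>UNIV. Re ((?x j)\<^sup>2)) = Re ((?x i)\<^sup>2) + (\<Sum>j\<in>UNIV - {i}. Re ((?x j)\<^sup>2))"
    by (rule sum.remove) auto
  moreover have "(\<Sum>j\<in>UNIV - {i}. Re ((?x j)\<^sup>2)) \<ge> 0"
    by (rule sum_nonneg) (auto simp: ct_def Re_power2)
  moreover have "Re ((?x i)\<^sup>2) = u\<^sup>2 - v\<^sup>2" by (simp add: Re_power2)
  moreover have "u\<^sup>2 = pi\<^sup>2" using assms(2) by (metis power2_abs)
  moreover have "v\<^sup>2 \<le> 1" using assms(1) by (simp add: abs_square_le_1)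
  moreover have "pi\<^sup>2 > 1" using pi_gt3 by (simp add: one_less_power)
  moreover have "h\<^sup>2 \<ge> 0" by simp
  ultimately have "Re (symb h ((ct t)(i := Complex u v))) > 0" by linarith
  then show ?thesis by auto
qed

lemma numer_eq_ct: 
  "numer m h y (ct (t :: 'd \<Rightarrow> real)) = symb h (ct t) ^ m * periodized m h y (ct t)" "symb h (ct t) \<noteq> 0"
  using symb_ct_nonzero[OF h(1), of "\<lambda>_. 0" t] by (auto intro: numer_eq_periodized)

lemma shift_edge: "(ct t)(i := Complex pi v) = lshift (\<lambda>j. if j = i then 1 else 0) ((ct t)(i := Complex (-pi) v))"
  by (auto simp: lshift_def complex_eq_iff)

lemma periodized_edge:
  "periodized m h y ((ct t)(i := Complex pi v)) = periodized m h y ((ct t)(i := Complex (-pi) v))"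
  unfolding shift_edge periodized_lshift ..

lemma cardinal_int_eq: "cardinal_int m h y = (\<integral>t. numer m h y (ct t) / denom (ct t) \<partial>torus)"
  unfolding cardinal_int_def
  by (rule Bochner_Integration.integral_cong) (auto simp: numer_eq_ct)

lemma inverse_coeff_eq: "inverse_coeff m h k =
   (\<integral>t. phase (\<lambda>j. of_int (k j)) (ct t) * symb h (ct t) ^ m / denom (ct t) \<partial>torus)"
  unfolding inverse_coeff_def
  by (rule Bochner_Integration.integral_cong) (auto simp: numer_eq_ct)

text \<open>Numerator and denominator share the non-periodic factor \<open>symb ^ m\<close>. It
  cancels, and what remains is built from \<open>periodized\<close> and integer characters.\<close>

lemma edge_quotient:
  fixes t :: "'d \<Rightarrow> real"
  assumes "\<bar>v\<bar> < decay TYPE('d) m"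
  shows "numer m h y ((ct t)(i := Complex pi v)) / denom ((ct t)(i := Complex pi v))
       = numer m h y ((ct t)(i := Complex (-pi) v)) / denom ((ct t)(i := Complex (-pi) v))"
    and "phase (\<lambda>j. of_int (k j)) ((ct t)(i := Complex pi v)) * symb h ((ct t)(i := Complex pi v)) ^ m / denom ((ct t)(i := Complex pi v))
      = phase (\<lambda>j. of_int (k j)) ((ct t)(i := Complex (-pi) v)) * symb h ((ct t)(i := Complex (-pi) v)) ^ m / denom ((ct t)(i := Complex (-pi) v))"
proof -
  have nz: "symb h ((ct t)(i := Complex pi v)) \<noteq> 0" "symb h ((ct t)(i := Complex (-pi) v)) \<noteq> 0"
    using assms decay_bounds(2) by (intro symb_shift_edge_nonzero; simp)+
  show "numer m h y ((ct t)(i := Complex pi v)) / denom ((ct t)(i := Complex pi v))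
       = numer m h y ((ct t)(i := Complex (-pi) v)) / denom ((ct t)(i := Complex (-pi) v))"
    using nz by (simp add: numer_eq_periodized periodized_edge)
  have "phase (\<lambda>j. of_int (k j)) ((ct t)(i := Complex pi v)) = phase (\<lambda>j. of_int (k j)) ((ct t)(i := Complex (-pi) v))"
    unfolding shift_edge phase_int_lshift ..
  then show "phase (\<lambda>j. of_int (k j)) ((ct t)(i := Complex pi v)) * symb h ((ct t)(i := Complex pi v)) ^ m / denom ((ct t)(i := Complex pi v))
      = phase (\<lambda>j. of_int (k j)) ((ct t)(i := Complex (-pi) v)) * symb h ((ct t)(i := Complex (-pi) v)) ^ m / denom ((ct t)(i := Complex (-pi) v))"
    using nz by (simp add: numer_eq_periodized periodized_edge)
qed

lemma strip_subset_box:
  fixes t :: "'d \<Rightarrow> real"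
  assumes t: "t \<in> space torus" and z: "\<bar>Re z\<bar> < 4 \<and> \<bar>Im z\<bar> < decay TYPE('d) m"
  shows "denom ((ct t)(i := z)) \<noteq> 0"
  using strip_point(2)[OF t, of z i] z by force

lemma numer_holomorphic_strip:
  fixes t :: "'d \<Rightarrow> real"
  assumes t: "t \<in> space torus"
  shows "(\<lambda>z. numer m h y ((ct t)(i := z))) holomorphic_on {z. \<bar>Re z\<bar> < 4 \<and> \<bar>Im z\<bar> < decay TYPE('d) m}"
  by (rule holomorphic_on_subset[OF numer_holomorphic[OF m h]])
     (use t space_torus_le_4 decay_bounds(2) in auto)

text \<open>The contour of integration in the \<open>i\<close>-th variable is moved to the side where the phase decays.\<close>
lemma norm_cardinal_int_le:
  fixes y :: "'d \<Rightarrow> real"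
  shows "norm (cardinal_int m h y) \<le> (2 * pi) ^ CARD('d) * (2 * numer_bound TYPE('d) m * exp (- (decay TYPE('d) m / 2) * \<bar>y i\<bar>))"
proof -
  define a where "a = decay TYPE('d) m"
  \<comment> \<open>Half the width keeps the line strictly inside the open strip, and becomes the
    decay rate.\<close>
  define s where "s = sgn (y i) * (a / 2)"
  have a: "0 < a" using decay_bounds by (simp add: a_def)
  have s: "\<bar>s\<bar> < a" using a by (auto simp: s_def sgn_if)
  have sy: "y i * s = a / 2 * \<bar>y i\<bar>" by (simp add: s_def sgn_if)
  show ?thesis unfolding cardinal_int_eq
  proof (rule norm_torus_integral_shift_le[where i = i and s = s and b = a])
    show "integrable torus (\<lambda>t. numer m h y (ct t) / denom (ct t))"
    proof (rule integrable_torus_continuous)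
      show "continuous_on (space torus) (\<lambda>t. numer m h y (ct t) / denom (ct t))"
        by (intro continuous_on_divide continuous_numer_torus) (use denom_torus_nonzero in blast)
      show "norm (numer m h y (ct t) / denom (ct t)) \<le> numer_bound TYPE('d) m / 1" if "t \<in> space torus" for t :: "'d \<Rightarrow> real"
        unfolding norm_divide using norm_numer_torus_le[OF that] norm_denom_torus_ge_1[OF that] numer_bound_ge_1[OF m h]
        by (intro frac_le) auto
    qed
    show "(\<lambda>z. numer m h y ((ct t)(i := z)) / denom ((ct t)(i := z))) holomorphic_on {z. \<bar>Re z\<bar> < 4 \<and> \<bar>Im z\<bar> < a}"
      if "t \<in> space torus" for t :: "'d \<Rightarrow> real"
      using strip_subset_box[OF that] unfolding a_def
      by (intro holomorphic_on_divide numer_holomorphic_strip that) auto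
    fix t :: "'d \<Rightarrow> real" and u :: real assume t: "t \<in> space torus"
    show "norm (numer m h y ((ct t)(i := Complex u s)) / denom ((ct t)(i := Complex u s)))
        \<le> 2 * numer_bound TYPE('d) m * exp (- (decay TYPE('d) m / 2) * \<bar>y i\<bar>)" if "\<bar>u\<bar> \<le> pi"
    proof -
      have u: "\<bar>Re (Complex u s)\<bar> \<le> 4" "\<bar>Im (Complex u s)\<bar> \<le> decay TYPE('d) m"
        using that pi_less_4 s by (auto simp: a_def)
      have n: "norm (numer m h y ((ct t)(i := Complex u s))) \<le> exp (- (a / 2 * \<bar>y i\<bar>)) * numer_bound TYPE('d) m"
        using numer_summable(3)[OF m h strip_point(1)[OF t u], of y i] unfolding strip_point(3)[OF t u] complex.sel sy .
      have "norm (numer m h y ((ct t)(i := Complex u s)) / denom ((ct t)(i := Complex u s)))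
          \<le> (exp (- (a / 2 * \<bar>y i\<bar>)) * numer_bound TYPE('d) m) / (1/2)"
        unfolding norm_divide using n strip_point(2)[OF t u, of i] numer_bound_ge_1[OF m h] by (intro frac_le) auto
      then show ?thesis by (simp add: a_def mult_ac)
    qed
    show "numer m h y ((ct t)(i := Complex pi v)) / denom ((ct t)(i := Complex pi v))
      = numer m h y ((ct t)(i := Complex (-pi) v)) / denom ((ct t)(i := Complex (-pi) v))" if "\<bar>v\<bar> < a" for v
      using edge_quotient(1) that unfolding a_def by blast
  qed (rule s)
qed

text \<open>The same contour shift, with the bounded analytic factor \<open>symb ^ m\<close> in
  place of the numerator series. It makes the coefficients absolutely summable, as the uniqueness of
  the Lagrange function requires.\<close>

lemma norm_inverse_coeff_le:
  fixes k :: "'d \<Rightarrow> int"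
  shows "norm (inverse_coeff m h k) \<le> (2 * pi) ^ CARD('d) * (2 * symb_bound TYPE('d) ^ m * exp (- (decay TYPE('d) m / 2) * \<bar>of_int (k i)\<bar>))"
proof -
  define a where "a = decay TYPE('d) m"
  define y :: "'d \<Rightarrow> real" where "y = (\<lambda>j. of_int (k j))"
  define s where "s = sgn (y i) * (a / 2)"
  have a: "0 < a" using decay_bounds by (simp add: a_def)
  have s: "\<bar>s\<bar> < a" using a by (auto simp: s_def sgn_if)
  have sy: "y i * s = a / 2 * \<bar>y i\<bar>" by (simp add: s_def sgn_if)
  have symb_bound: "symb_bound TYPE('d) ^ m \<ge> 0" using symb_bound_ge[where 'd='d] by simp
  show ?thesis unfolding inverse_coeff_eq
  proof (rule norm_torus_integral_shift_le[where i = i and s = s and b = a])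
    show "integrable torus (\<lambda>t. phase (\<lambda>j. of_int (k j)) (ct t) * symb h (ct t) ^ m / denom (ct t))"
    proof (rule integrable_torus_continuous)
      have co: "continuous_on (space torus) (\<lambda>t :: 'd \<Rightarrow> real. ct t j)" for j
        unfolding ct_def
        by (intro continuous_intros continuous_on_subset[OF continuous_on_product_coordinates]) auto
      have "continuous_on (space torus) (\<lambda>t :: 'd \<Rightarrow> real. phase (\<lambda>j. of_int (k j)) (ct t))"
        unfolding phase_def by (intro continuous_intros co)
      moreover have "continuous_on (space torus) (\<lambda>t :: 'd \<Rightarrow> real. symb h (ct t))"
        unfolding symb_def by (intro continuous_intros co)
      ultimately show "continuous_on (space torus) (\<lambda>t. phase (\<lambda>j. of_int (k j)) (ct t) * symb h (ct t) ^ m / denom (ct t))"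
        by (intro continuous_on_divide continuous_numer_torus continuous_intros ballI denom_torus_nonzero)
      show "norm (phase (\<lambda>j. of_int (k j)) (ct t) * symb h (ct t) ^ m / denom (ct t)) \<le> symb_bound TYPE('d) ^ m / 1"
        if t: "t \<in> space torus" for t :: "'d \<Rightarrow> real"
      proof -
        have "norm (symb h (ct t)) ^ m \<le> symb_bound TYPE('d) ^ m"
          by (intro power_mono norm_symb_le ct_in_strip_box t h) auto
        then show ?thesis unfolding norm_divide norm_mult norm_phase norm_power
          using norm_denom_torus_ge_1[OF that] symb_bound by (intro frac_le) (auto simp: ct_def)
      qed
    qed
    show "(\<lambda>z. phase (\<lambda>j. of_int (k j)) ((ct t)(i := z)) * symb h ((ct t)(i := z)) ^ m / denom ((ct t)(i := z)))
        holomorphic_on {z. \<bar>Re z\<bar> < 4 \<and> \<bar>Im z\<bar> < a}"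
      if "t \<in> space torus" for t :: "'d \<Rightarrow> real"
      using strip_subset_box[OF that] symb_holomorphic[OF m h, of "\<lambda>_. 0" t i] phase_holomorphic[OF m h, of "\<lambda>j. of_int (k j)" "\<lambda>_. 0" t i] 
      unfolding a_def by (intro holomorphic_on_divide holomorphic_intros numer_holomorphic_strip that) auto
    fix t :: "'d \<Rightarrow> real" and u :: real assume t: "t \<in> space torus"
    show "norm (phase (\<lambda>j. of_int (k j)) ((ct t)(i := Complex u s)) * symb h ((ct t)(i := Complex u s)) ^ m / denom ((ct t)(i := Complex u s)))
        \<le> 2 * symb_bound TYPE('d) ^ m * exp (- (decay TYPE('d) m / 2) * \<bar>of_int (k i)\<bar>)" if "\<bar>u\<bar> \<le> pi"
    proof -
      have u: "\<bar>Re (Complex u s)\<bar> \<le> 4" "\<bar>Im (Complex u s)\<bar> \<le> decay TYPE('d) m"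
        using that pi_less_4 s by (auto simp: a_def)
      have p: "norm (phase y ((ct t)(i := Complex u s))) = exp (- (a / 2 * \<bar>y i\<bar>))"
        unfolding norm_phase strip_point(3)[OF t u] using sy by simp
      have q: "norm (symb h ((ct t)(i := Complex u s))) ^ m \<le> symb_bound TYPE('d) ^ m"
        by (intro power_mono norm_symb_le strip_point(1) t u h) auto
      have "norm (phase y ((ct t)(i := Complex u s)) * symb h ((ct t)(i := Complex u s)) ^ m / denom ((ct t)(i := Complex u s)))
          \<le> (exp (- (a / 2 * \<bar>y i\<bar>)) * symb_bound TYPE('d) ^ m) / (1/2)"
        unfolding norm_divide norm_mult norm_power p using q strip_point(2)[OF t u, of i] symb_bound
        by (intro frac_le mult_left_mono) auto
      then show ?thesis by (simp add: a_def mult_ac y_def)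
    qed
    show "phase (\<lambda>j. of_int (k j)) ((ct t)(i := Complex pi v)) * symb h ((ct t)(i := Complex pi v)) ^ m / denom ((ct t)(i := Complex pi v))
      = phase (\<lambda>j. of_int (k j)) ((ct t)(i := Complex (-pi) v)) * symb h ((ct t)(i := Complex (-pi) v)) ^ m / denom ((ct t)(i := Complex (-pi) v))" if "\<bar>v\<bar> < a" for v
      using edge_quotient(2) that unfolding a_def by blast
  qed (rule s)
qed

end

subsection \<open>Gaussian mixtures\<close>

lemma integrable_exp_neg_abs:
  assumes c: "c > 0"
  shows "integrable lborel (\<lambda>x::real. exp (- c * \<bar>x\<bar>))"
proof -
  have "(\<lambda>x. exp (- c * x)) absolutely_integrable_on {0..}"
    using has_integral_exp_minus_to_infinity[OF c, of 0]
    by (intro nonnegative_absolutely_integrable_1) (auto simp: has_integral_iff)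
  then have 1: "integrable lborel (\<lambda>x. indicator {0..} x *\<^sub>R exp (- c * x))"
    unfolding set_integrable_def by (subst (asm) integrable_completion) auto
  have 2: "integrable lborel (\<lambda>x. indicator {0..} (-x) *\<^sub>R exp (- c * (- x)))"
    using lborel_integrable_real_affine[OF 1, of "-1" 0] by simp
  show ?thesis
    by (rule Bochner_Integration.integrable_bound[OF Bochner_Integration.integrable_add[OF 1 2]])
       (auto simp: indicator_def abs_if)
qed

text \<open>To the left exp (a x) decays by itself. To the right, y <= exp y at y = exp x / n gives
  exp (exp x) >= (exp x / n)^n, and n >= a + 1 leaves decay of rate at least 1.\<close>

lemma integrable_gamma_integral:
  assumes a: "a > 0"
  shows "integrable lborel (\<lambda>x::real. exp (a * x - exp x))"
proof -
  obtain n :: nat where n: "real n \<ge> a + 1" using real_arch_simple by blast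
  have n0: "n > 0" using n a by (cases n) auto
  define c where "c = min a 1"
  have c: "c > 0" "c \<le> a" "c \<le> 1" using a by (auto simp: c_def)
  have "exp (a * x - exp x) \<le> (1 + real n ^ n) * exp (- c * \<bar>x\<bar>)" for x
  proof (cases "x \<ge> 0")
    case False
    have "exp (a * x - exp x) \<le> exp (a * x)" by simp
    also have "\<dots> \<le> exp (- c * \<bar>x\<bar>)" using False c by (simp add: mult_right_mono_neg)
    also have "\<dots> \<le> (1 + real n ^ n) * exp (- c * \<bar>x\<bar>)" by (simp add: algebra_simps)
    finally show ?thesis .
  next
    case True
    have "exp x / n \<le> exp (exp x / n)" using exp_ge_add_one_self[of "exp x / n"] by linarith
    then have "(exp x / n) ^ n \<le> exp (exp x / n) ^ n" by (intro power_mono) auto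
    also have "\<dots> = exp (exp x)" using n0 by (simp add: exp_of_nat_mult[symmetric])
    finally have "exp x ^ n \<le> real n ^ n * exp (exp x)"
      using n0 by (simp add: power_divide field_simps)
    then have "exp (n * x) \<le> real n ^ n * exp (exp x)" by (simp only: exp_of_nat_mult)
    then have "exp (n * x) * exp (a * x - exp x - n * x) \<le> real n ^ n * exp (exp x) * exp (a * x - exp x - n * x)"
      by (intro mult_right_mono) auto
    moreover have "exp (n * x) * exp (a * x - exp x - n * x) = exp (a * x - exp x)"
      and "exp (exp x) * exp (a * x - exp x - n * x) = exp ((a - n) * x)"
      by (simp_all add: mult_exp_exp algebra_simps)
    ultimately have "exp (a * x - exp x) \<le> real n ^ n * exp ((a - n) * x)"
      by (simp only: mult.assoc)
    also have "\<dots> \<le> real n ^ n * exp (- c * \<bar>x\<bar>)"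
    proof (intro mult_left_mono)
      have "(a - n) * x \<le> (- c) * x" using n c True by (intro mult_right_mono) auto
      then show "exp ((a - n) * x) \<le> exp (- c * \<bar>x\<bar>)" using True by simp
    qed simp
    also have "\<dots> \<le> (1 + real n ^ n) * exp (- c * \<bar>x\<bar>)" by (intro mult_right_mono) auto
    finally show ?thesis .
  qed
  then show ?thesis
    by (intro Bochner_Integration.integrable_bound[OF integrable_mult_right[OF integrable_exp_neg_abs[OF c(1)], of "1 + real n ^ n"]])
       (auto intro!: AE_I2 simp: abs_of_nonneg add_nonneg_nonneg)
qed

text \<open>Euler's Gamma(a) after u = exp x. In this variable a rescaling of u is a translation,
  under which Lebesgue measure is invariant.\<close>

definition gamma_integral :: "real \<Rightarrow> real" where "gamma_integral a = (\<integral>x. exp (a * x - exp x) \<partial>lborel)"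

lemma gamma_integral_scaled:
  assumes a: "a > 0" and q: "q > 0"
  shows "integrable lborel (\<lambda>x::real. exp (a * x - q * exp x))"
    and "(\<integral>x. exp (a * x - q * exp x) \<partial>lborel) = gamma_integral a * q powr (- a)"
proof -
  have eq: "exp (a * x - q * exp x) = q powr (- a) * exp (a * (ln q + 1 * x) - exp (ln q + 1 * x))" for x
    using q by (simp add: powr_def mult_exp_exp exp_add algebra_simps)
  show "integrable lborel (\<lambda>x::real. exp (a * x - q * exp x))" unfolding eq
    by (intro integrable_mult_right lborel_integrable_real_affine integrable_gamma_integral a) auto
  show "(\<integral>x. exp (a * x - q * exp x) \<partial>lborel) = gamma_integral a * q powr (- a)" unfolding eq gamma_integral_def
    by (subst (2) lborel_integral_real_affine[where c=1 and t="ln q"]) auto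
qed

lemma gamma_integral_pos:
  assumes "a > 0" shows "gamma_integral a > 0"
proof -
  have "0 < exp (- exp 1 :: real)" by simp
  also have "\<dots> = (\<integral>x. indicator {0..1::real} x *\<^sub>R exp (- exp 1) \<partial>lborel)" by simp
  also have "\<dots> \<le> gamma_integral a" unfolding gamma_integral_def
  proof (rule integral_mono[OF _ integrable_gamma_integral[OF assms]])
    show "integrable lborel (\<lambda>x. indicator {0..1::real} x *\<^sub>R exp (- exp 1 :: real))"
      by (rule integrable_indicator) auto
    show "indicator {0..1} x *\<^sub>R exp (- exp 1) \<le> exp (a * x - exp x)" for x :: real
    proof (cases "x \<in> {0..1}")
      case True
      then have "exp x \<le> exp 1" "0 \<le> a * x" using assms by auto
      then have "- exp 1 \<le> a * x - exp x" by linarith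
      then show ?thesis using True by simp
    qed simp
  qed
  finally show ?thesis .
qed

text \<open>With u = exp x this is the integral of u^(a-1) exp(- h^2 u - r^2 / (4 u)) over u > 0, a
  mixture of Gaussians in r.\<close>

definition Psi :: "real \<Rightarrow> real \<Rightarrow> real \<Rightarrow> real" where
  "Psi a h r = (\<integral>x. exp (a * x - h\<^sup>2 * exp x - r\<^sup>2 / 4 * exp (- x)) \<partial>lborel)"

lemma integrable_Psi:
  assumes "a > 0" "h > 0"
  shows "integrable lborel (\<lambda>x::real. exp (a * x - h\<^sup>2 * exp x - r\<^sup>2 / 4 * exp (- x)))"
  by (rule Bochner_Integration.integrable_bound[OF gamma_integral_scaled(1)[of a "h\<^sup>2"]]) (use assms in auto)

text \<open>The translation x = t + ln (r/2) makes the exponential terms symmetric, namely - r cosh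
  t. Folding the line at 0 then produces cosh (a t) and the factor 1/2.\<close>

lemma macdonald_eq_Psi:
  assumes a: "a > 0" and r: "r > 0"
  shows "r powr a * macdonald a r = 2 powr (a - 1) * Psi a 1 r"
proof -
  define f where "f t = exp (a * t - r * cosh t)" for t
  have shift: "exp (a * x - 1\<^sup>2 * exp x - r\<^sup>2 / 4 * exp (- x)) = (r / 2) powr a * f (- ln (r / 2) + 1 * x)" for x
  proof -
    have "r * cosh (x - ln (r / 2)) = exp x + r\<^sup>2 / 4 * exp (- x)"
      using r by (simp add: cosh_def exp_diff exp_minus field_simps power2_eq_square)
    then show ?thesis using r by (simp add: f_def powr_def mult_exp_exp algebra_simps)
  qed
  have "integrable lborel (\<lambda>x. (r / 2) powr a * f (- ln (r / 2) + 1 * x))"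
    using integrable_Psi[OF a, of 1 r] unfolding shift by simp
  then have "integrable lborel (\<lambda>x. f (- ln (r / 2) + 1 * x))" using r by simp
  then have f: "integrable lborel f" by (subst (asm) lborel_integrable_real_affine_iff) auto
  then have f': "integrable lborel (\<lambda>t. f (- t))"
    using lborel_integrable_real_affine[OF f, of "-1" 0] by simp
  have "Psi a 1 r = (r / 2) powr a * (\<integral>t. f t \<partial>lborel)"
    unfolding Psi_def shift by (subst (2) lborel_integral_real_affine[where c=1 and t="- ln (r / 2)"]) auto
  moreover have "macdonald a r = (\<integral>t. f t \<partial>lborel) / 2"
  proof -
    have i1: "integrable lborel (\<lambda>t. indicator {0<..} t *\<^sub>R f t)" 
      and i2: "integrable lborel (\<lambda>t. indicator {0<..} t *\<^sub>R f (- t))"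
      and i3: "integrable lborel (\<lambda>t. indicator {..<0} t *\<^sub>R f t)"
      by (intro integrable_mult_indicator f f'; simp)+
    have "macdonald a r = (\<integral>t. (indicator {0<..} t *\<^sub>R f t + indicator {0<..} t *\<^sub>R f (- t)) / 2 \<partial>lborel)"
      unfolding macdonald_def set_lebesgue_integral_def
      by (intro Bochner_Integration.integral_cong)
         (auto simp: f_def indicator_def cosh_def mult_exp_exp field_simps)
    also have "\<dots> = ((\<integral>t. indicator {0<..} t *\<^sub>R f t \<partial>lborel) + (\<integral>t. indicator {0<..} t *\<^sub>R f (- t) \<partial>lborel)) / 2"
      using i1 i2 by simp
    also have "(\<integral>t. indicator {0<..} t *\<^sub>R f (- t) \<partial>lborel) = (\<integral>t. indicator {..<0} t *\<^sub>R f t \<partial>lborel)"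
      by (subst (2) lborel_integral_real_affine[where c="-1" and t=0])
         (auto intro!: Bochner_Integration.integral_cong simp: indicator_def)
    also have "(\<integral>t. indicator {0<..} t *\<^sub>R f t \<partial>lborel) + (\<integral>t. indicator {..<0} t *\<^sub>R f t \<partial>lborel)
        = (\<integral>t. indicator {0<..} t *\<^sub>R f t + indicator {..<0} t *\<^sub>R f t \<partial>lborel)"
      using i1 i3 by simp
    also have "\<dots> = (\<integral>t. f t \<partial>lborel)"
    proof (rule integral_cong_AE)
      show "AE t in lborel. indicator {0<..} t *\<^sub>R f t + indicator {..<0} t *\<^sub>R f t = f t"
        using AE_lborel_singleton[of "0::real"] by eventually_elim (auto simp: indicator_def)
    qed (use f i1 i3 in auto)
    finally show ?thesis .
  qed
  moreover have "r powr a = 2 powr a * (r / 2) powr a" using r by (simp add: powr_divide)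
  moreover have "2 powr a = 2 * 2 powr (a - 1)" by (simp add: powr_diff)
  ultimately show ?thesis by simp
qed

text \<open>Needed because \<open>matern\<close> is defined at the origin by a limit. For a > 0 the
  integrand with r = 0 is an integrable majorant.\<close>

lemma Psi_tendsto_at_0:
  assumes a: "a > 0"
  shows "((\<lambda>r. Psi a 1 r) \<longlongrightarrow> Psi a 1 0) (at_right 0)"
  unfolding tendsto_at_iff_sequentially o_def
proof (intro allI impI)
  fix X :: "nat \<Rightarrow> real" assume X: "X \<longlonglongrightarrow> 0"
  show "(\<lambda>i. Psi a 1 (X i)) \<longlonglongrightarrow> Psi a 1 0"
    unfolding Psi_def
    by (rule integral_dominated_convergence[where w="\<lambda>x. exp (a * x - exp x)"])
       (use integrable_gamma_integral[OF a] in \<open>auto intro!: AE_I2 tendsto_eq_intros X\<close>)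
qed

lemma matern_eq_Psi:
  fixes x :: "real^'d"
  assumes m: "real m > real CARD('d) / 2"
  defines "a \<equiv> real m - real CARD('d) / 2"
  shows "matern m x = 2 powr (a - 1) * Psi a 1 (norm x)"
proof -
  have a: "a > 0" using m by (simp add: a_def)
  have "((\<lambda>r. 2 powr (a - 1) * Psi a 1 r) \<longlongrightarrow> 2 powr (a - 1) * Psi a 1 0) (at_right 0)"
    by (intro tendsto_intros Psi_tendsto_at_0 a)
  then have "((\<lambda>r. r powr a * macdonald a r) \<longlongrightarrow> 2 powr (a - 1) * Psi a 1 0) (at_right 0)"
    by (rule Lim_transform_eventually)
       (use eventually_at_right_less[of "0::real"] in \<open>auto elim!: eventually_mono simp: macdonald_eq_Psi[OF a]\<close>)
  then have "Lim (at_right 0) (\<lambda>r. r powr a * macdonald a r) = 2 powr (a - 1) * Psi a 1 0"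
    by (intro tendsto_Lim) auto
  then show ?thesis by (auto simp: matern_def Let_def a_def[symmetric] macdonald_eq_Psi[OF a])
qed

text \<open>Translation by 2 ln h trades the grid width for the parameter \<open>h\<close> of
  \<open>symb\<close>.\<close>

lemma Psi_scale:
  assumes "a > 0" "h > 0"
  shows "Psi a 1 (h * r) = h powr (2 * a) * Psi a h r"
proof -
  have "exp (a * (2 * ln h + 1 * x) - 1\<^sup>2 * exp (2 * ln h + 1 * x) - (h * r)\<^sup>2 / 4 * exp (- (2 * ln h + 1 * x)))
     = h powr (2 * a) * exp (a * x - h\<^sup>2 * exp x - r\<^sup>2 / 4 * exp (- x))" for x
  proof -
    have e: "exp (2 * ln h) = h\<^sup>2" using assms by (simp add: exp_double)
    have "exp (2 * ln h + 1 * x) = h\<^sup>2 * exp x" by (simp add: exp_add e)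
    moreover have "exp (- (2 * ln h + 1 * x)) = exp (- x) / h\<^sup>2"
      unfolding exp_minus exp_add e by (simp add: field_simps)
    moreover have "exp (a * (2 * ln h + 1 * x) - A - B) = h powr (2 * a) * exp (a * x - A - B)" for A B
      using assms by (simp add: powr_def mult_exp_exp algebra_simps)
    ultimately show ?thesis using assms by (simp add: power_mult_distrib)
  qed
  then show ?thesis unfolding Psi_def
    by (subst lborel_integral_real_affine[where c=1 and t="2 * ln h"]) auto
qed

lemma Psi_nonneg: "Psi a h r \<ge> 0"
  unfolding Psi_def by (rule Bochner_Integration.integral_nonneg) simp

text \<open>One half of h^2 exp x is kept for convergence; the other half together with r^2/4
  exp(-x) dominates h r / 2 by completing a square. The constant blows up as h tends to 0, so this
  serves only summability at fixed \<open>h\<close>.\<close>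

lemma Psi_le:
  assumes a: "a > 0" and h: "h > 0" and r: "r \<ge> 0"
  shows "Psi a h r \<le> exp (- (h / 2) * r) * (gamma_integral a * (h\<^sup>2 / 2) powr (- a))"
proof -
  have "exp (a * x - h\<^sup>2 * exp x - r\<^sup>2 / 4 * exp (- x)) \<le> exp (- (h / 2) * r) * exp (a * x - h\<^sup>2 / 2 * exp x)" for x
  proof -
    define u v where "u = exp (x / 2)" and "v = exp (- x / 2)"
    have uv: "exp x = u\<^sup>2" "exp (- x) = v\<^sup>2" "u * v = 1"
      by (auto simp: u_def v_def mult_exp_exp exp_double[symmetric])
    have "0 \<le> (h * u - r * v / 2)\<^sup>2" by simp
    then have "h * r * (u * v) \<le> h\<^sup>2 * u\<^sup>2 + r\<^sup>2 / 4 * v\<^sup>2"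
      by (simp add: power2_eq_square algebra_simps)
    then have A: "h * r \<le> h\<^sup>2 * u\<^sup>2 + r\<^sup>2 / 4 * v\<^sup>2" using uv(3) by simp
    have B: "0 \<le> r\<^sup>2 / 4 * v\<^sup>2" by simp
    have "h * r / 2 \<le> h\<^sup>2 / 2 * exp x + r\<^sup>2 / 4 * exp (- x)"
      unfolding uv using A B by linarith
    then have "a * x - h\<^sup>2 * exp x - r\<^sup>2 / 4 * exp (- x) \<le> - (h / 2) * r + (a * x - h\<^sup>2 / 2 * exp x)"
      by (simp add: algebra_simps)
    then show ?thesis unfolding mult_exp_exp by simp
  qed
  then have "Psi a h r \<le> (\<integral>x. exp (- (h / 2) * r) * exp (a * x - h\<^sup>2 / 2 * exp x) \<partial>lborel)"
    unfolding Psi_def by (intro integral_mono integrable_Psi a h integrable_mult_right gamma_integral_scaled(1)) (use h in auto)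
  also have "\<dots> = exp (- (h / 2) * r) * (gamma_integral a * (h\<^sup>2 / 2) powr (- a))"
    using gamma_integral_scaled(2)[OF a, of "h\<^sup>2 / 2"] h by simp
  finally show ?thesis .
qed

section \<open>Fourier transform of Gaussians and tiling of the frequency space\<close>

text \<open>Scaling by sqrt (2 s) reduces this to the characteristic function of the standard normal
  distribution.\<close>

lemma gaussian_fourier:
  assumes s: "s > 0"
  shows "integrable lborel (\<lambda>x. exp (\<i> * of_real (y * x) - of_real (s * x\<^sup>2)) :: complex)"
    and "of_real (sqrt (s / pi)) * (\<integral>x. exp (\<i> * of_real (y * x) - of_real (s * x\<^sup>2)) \<partial>lborel)
      = (of_real (exp (- (y\<^sup>2 / (4 * s)))) :: complex)"
proof -
  define g :: "real \<Rightarrow> complex" where "g x = std_normal_density x *\<^sub>R iexp (y / sqrt (2 * s) * x)" for x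
  have eq: "exp (\<i> * of_real (y * x) - of_real (s * x\<^sup>2)) = of_real (sqrt (2 * pi)) * g (0 + sqrt (2 * s) * x)" for x
  proof -
    have 1: "y / sqrt (2 * s) * (0 + sqrt (2 * s) * x) = y * x" using s by simp
    have 2: "- (0 + sqrt (2 * s) * x)\<^sup>2 / 2 = - (s * x\<^sup>2)" using s by (simp add: power_mult_distrib)
    show ?thesis unfolding g_def std_normal_density_def 1 2
      by (simp add: exp_diff exp_minus scaleR_conv_of_real divide_inverse flip: exp_of_real)
  qed
  have "integrable lborel (\<lambda>x. std_normal_density x)" by simp
  then have g: "integrable lborel g"
  proof (rule Bochner_Integration.integrable_bound)
    show "g \<in> borel_measurable lborel" unfolding g_def[abs_def] by measurable
  qed (auto simp: g_def)
  show 1: "integrable lborel (\<lambda>x. exp (\<i> * of_real (y * x) - of_real (s * x\<^sup>2)) :: complex)"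
    unfolding eq by (intro integrable_mult_right lborel_integrable_real_affine g) (use s in auto)
  have "(\<integral>x. g x \<partial>lborel) = char std_normal_distribution (y / sqrt (2 * s))"
    unfolding char_def g_def by (subst integral_density) auto
  also have "\<dots> = of_real (exp (- (y\<^sup>2 / (4 * s))))"
    using s by (simp add: char_std_normal_distribution power_divide)
  finally have "(\<integral>x. g x \<partial>lborel) = of_real (exp (- (y\<^sup>2 / (4 * s))))" .
  then have "\<bar>sqrt (2 * s)\<bar> *\<^sub>R (\<integral>x. g (0 + sqrt (2 * s) * x) \<partial>lborel) = of_real (exp (- (y\<^sup>2 / (4 * s))))"
    using lborel_integral_real_affine[of "sqrt (2 * s)" g 0] s by simp
  moreover have "sqrt (s / pi) * sqrt (2 * pi) = \<bar>sqrt (2 * s)\<bar>"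
    using s by (simp add: real_sqrt_mult[symmetric])
  ultimately show "of_real (sqrt (s / pi)) * (\<integral>x. exp (\<i> * of_real (y * x) - of_real (s * x\<^sup>2)) \<partial>lborel)
      = (of_real (exp (- (y\<^sup>2 / (4 * s)))) :: complex)"
    unfolding eq by (simp add: scaleR_conv_of_real mult.assoc[symmetric] flip: of_real_mult)
qed

text \<open>Convergence of the sum comes from the disjointness of the cells: over finitely many of
  them the integrals of the norm add up to at most that of \<open>norm (f x)\<close> over the
  line.\<close>

lemma integral_cells:
  fixes f :: "real \<Rightarrow> 'b::{banach,second_countable_topology}"
  assumes f: "integrable lborel f"
  shows "integrable arc (\<lambda>u. f (u + 2 * pi * of_int n))"
    and "(\<lambda>n::int. norm (\<integral>u. f (u + 2 * pi * of_int n) \<partial>arc)) summable_on UNIV"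
    and "(\<integral>x. f x \<partial>lborel) = (\<Sum>\<^sub>\<infinity>n::int. \<integral>u. f (u + 2 * pi * of_int n) \<partial>arc)"
proof -
  \<comment> \<open>Half-open, so that every point lies in exactly one cell; a translate of the
    closed \<open>arc\<close> differs from it by a null set.\<close>
  define C where "C n = {2 * pi * of_int n - pi ..< 2 * pi * of_int n + pi}" for n :: int
  define fn where "fn n x = indicator (C n) x *\<^sub>R f x" for n x
  have fn: "integrable lborel (fn n)" for n
    unfolding fn_def C_def by (intro integrable_mult_indicator f) auto
  have shift: "f (u + 2 * pi * of_int n) = f (2 * pi * of_int n + 1 * u)" for u n by (simp add: add.commute)
  have "integrable lborel (\<lambda>u. indicator {-pi..pi} u *\<^sub>R f (u + 2 * pi * of_int n))" for n
    unfolding shift by (intro integrable_mult_indicator lborel_integrable_real_affine f) auto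
  then show ii: "integrable arc (\<lambda>u. f (u + 2 * pi * of_int n))" for n
    by (subst integrable_restrict_space) auto
  have eq: "(\<integral>x. fn n x \<partial>lborel) = (\<integral>u. f (u + 2 * pi * of_int n) \<partial>arc)" for n
  proof -
    have "(\<integral>x. fn n x \<partial>lborel) = (\<integral>u. fn n (2 * pi * of_int n + 1 * u) \<partial>lborel)"
      by (subst lborel_integral_real_affine[where c=1 and t="2 * pi * of_int n"]) auto
    also have "\<dots> = (\<integral>u. indicator {-pi..pi} u *\<^sub>R f (u + 2 * pi * of_int n) \<partial>lborel)"
    proof (rule integral_cong_AE)
      show "AE u in lborel. fn n (2 * pi * of_int n + 1 * u) = indicator {-pi..pi} u *\<^sub>R f (u + 2 * pi * of_int n)"
        using AE_lborel_singleton[of pi]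
        by eventually_elim (auto simp: fn_def C_def indicator_def add.commute)
      show "(\<lambda>u. fn n (2 * pi * of_int n + 1 * u)) \<in> borel_measurable lborel"
        by (intro borel_measurable_integrable lborel_integrable_real_affine fn) auto
      show "(\<lambda>u. indicator {-pi..pi} u *\<^sub>R f (u + 2 * pi * of_int n)) \<in> borel_measurable lborel"
        using ii by (subst (asm) integrable_restrict_space) auto
    qed
    also have "\<dots> = (\<integral>u. f (u + 2 * pi * of_int n) \<partial>arc)" by (subst integral_restrict_space) auto
    finally show ?thesis .
  qed
  have cell: "x \<in> C n \<longleftrightarrow> n = \<lfloor>(x + pi) / (2 * pi)\<rfloor>" for x n
  proof -
    have "n = \<lfloor>(x + pi) / (2 * pi)\<rfloor> \<longleftrightarrow> of_int n \<le> (x + pi) / (2 * pi) \<and> (x + pi) / (2 * pi) < of_int n + 1"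
      by (subst eq_commute) (rule floor_eq_iff)
    also have "\<dots> \<longleftrightarrow> x \<in> C n" by (auto simp: C_def field_simps)
    finally show ?thesis by blast
  qed
  have fn0: "fn n x = (if n = \<lfloor>(x + pi) / (2 * pi)\<rfloor> then f x else 0)" for n x
    using cell[of x n] by (auto simp: fn_def)
  have pt: "((\<lambda>n. norm (fn n x)) has_sum norm (f x)) UNIV" "((\<lambda>n. fn n x) has_sum f x) UNIV" for x
    unfolding fn0 by (rule has_sum_finite_neutralI[of "{\<lfloor>(x + pi) / (2 * pi)\<rfloor>}"]; simp)+
  have L1: "(\<lambda>n. \<integral>x. norm (fn n x) \<partial>lborel) summable_on UNIV"
  proof (rule nonneg_bdd_above_summable_on)
    show "bdd_above (sum (\<lambda>n. \<integral>x. norm (fn n x) \<partial>lborel) ` {F. F \<subseteq> UNIV \<and> finite F})"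
    proof (rule bdd_aboveI2)
      fix F :: "int set" assume "F \<in> {F. F \<subseteq> UNIV \<and> finite F}"
      then have F: "finite F" by simp
      have "(\<Sum>n\<in>F. \<integral>x. norm (fn n x) \<partial>lborel) = (\<integral>x. (\<Sum>n\<in>F. norm (fn n x)) \<partial>lborel)"
        using fn by (subst Bochner_Integration.integral_sum) auto
      also have "\<dots> \<le> (\<integral>x. norm (f x) \<partial>lborel)"
      proof (rule integral_mono)
        show "(\<Sum>n\<in>F. norm (fn n x)) \<le> norm (f x)" for x
          using finite_sum_le_infsum[OF has_sum_imp_summable[OF pt(1)[of x]] F] infsumI[OF pt(1)[of x]] by simp
      qed (use f fn in auto)
      finally show "(\<Sum>n\<in>F. \<integral>x. norm (fn n x) \<partial>lborel) \<le> (\<integral>x. norm (f x) \<partial>lborel)" .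
    qed
  qed auto
  show "(\<lambda>n::int. norm (\<integral>u. f (u + 2 * pi * of_int n) \<partial>arc)) summable_on UNIV"
    unfolding eq[symmetric] by (rule summable_on_comparison_test[OF L1]) (auto simp: integral_norm_bound)
  have "(\<integral>x. f x \<partial>lborel) = (\<integral>x. (\<Sum>\<^sub>\<infinity>n. fn n x) \<partial>lborel)" by (simp add: infsumI[OF pt(2)])
  also have "\<dots> = (\<Sum>\<^sub>\<infinity>n. \<integral>x. fn n x \<partial>lborel)"
    by (rule integral_infsum(2)[OF infinite_UNIV_int fn has_sum_imp_summable[OF pt(1)] L1])
  finally show "(\<integral>x. f x \<partial>lborel) = (\<Sum>\<^sub>\<infinity>n::int. \<integral>u. f (u + 2 * pi * of_int n) \<partial>arc)" unfolding eq .
qed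

definition cell_sq :: "('d::finite \<Rightarrow> int) \<Rightarrow> ('d \<Rightarrow> real) \<Rightarrow> real" where
  "cell_sq l t = (\<Sum>j\<in>UNIV. (t j + 2 * pi * of_int (l j))\<^sup>2)"

lemma phase_exp_prod:
  fixes y t :: "'d::finite \<Rightarrow> real"
  shows "(\<Prod>j\<in>UNIV. exp (\<i> * of_real (y j * (t j + 2 * pi * of_int (l j))) - of_real (s * (t j + 2 * pi * of_int (l j))\<^sup>2)))
     = phase y (lshift l (ct t)) * of_real (exp (- s * cell_sq l t))"
proof -
  have "(\<Prod>j\<in>UNIV. exp (\<i> * of_real (y j * (t j + 2 * pi * of_int (l j))) - of_real (s * (t j + 2 * pi * of_int (l j))\<^sup>2)))
     = exp (\<Sum>j\<in>UNIV. \<i> * of_real (y j * (t j + 2 * pi * of_int (l j))) - of_real (s * (t j + 2 * pi * of_int (l j))\<^sup>2))"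
    by (simp only: exp_sum finite)
  also have "(\<Sum>j\<in>UNIV. \<i> * of_real (y j * (t j + 2 * pi * of_int (l j))) - of_real (s * (t j + 2 * pi * of_int (l j))\<^sup>2))
     = \<i> * (\<Sum>j\<in>UNIV. of_real (y j) * lshift l (ct t) j) + of_real (- s * cell_sq l t)"
    by (simp add: sum_subtractf sum_negf sum_distrib_left lshift_def ct_def cell_sq_def)
  finally show ?thesis by (simp only: exp_add phase_def exp_of_real)
qed

text \<open>Both the tensor product structure of the Gaussian and the tiling of the frequency space by
  translates of the torus are used here, one coordinate at a time.\<close>
lemma gaussian_product:
  fixes y :: "'d::finite \<Rightarrow> real"
  assumes s: "s > 0"
  defines "E \<equiv> \<lambda>l. \<integral>t. phase y (lshift l (ct t)) * of_real (exp (- s * cell_sq l t)) \<partial>torus"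
  shows "(\<lambda>l. norm (E l)) summable_on UNIV"
    and "of_real (exp (- ((\<Sum>j\<in>UNIV. (y j)\<^sup>2) / (4 * s)))) = of_real (sqrt (s / pi) ^ CARD('d)) * (\<Sum>\<^sub>\<infinity>l. E l)"
proof -
  define g :: "real \<Rightarrow> real \<Rightarrow> complex" where "g v x = exp (\<i> * of_real (v * x) - of_real (s * x\<^sup>2))" for v x
  define e where "e v n = (\<integral>u. g v (u + 2 * pi * of_int n) \<partial>arc)" for v n
  have g: "integrable lborel (g v)" for v unfolding g_def by (rule gaussian_fourier(1)[OF s])
  have E: "E l = (\<Prod>j\<in>UNIV. e (y j) (l j))" for l
  proof -
    have "(\<Prod>j\<in>UNIV. e (y j) (l j)) = (\<integral>t. (\<Prod>j\<in>UNIV. g (y j) (t j + 2 * pi * of_int (l j))) \<partial>torus)"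
      unfolding e_def torus_def
      using arcs.product_integral_prod[of UNIV "\<lambda>j u. g (y j) (u + 2 * pi * of_int (l j))"] integral_cells(1)[OF g] by simp
    then show ?thesis unfolding E_def g_def phase_exp_prod by simp
  qed
  have sm: "(\<lambda>n. norm (e (y j) n)) summable_on UNIV" for j unfolding e_def by (rule integral_cells(2)[OF g])
  show "(\<lambda>l. norm (E l)) summable_on UNIV" unfolding E by (rule summable_on_prod_fun[OF sm])
  have "(\<Sum>\<^sub>\<infinity>l. E l) = (\<Prod>j\<in>UNIV. \<integral>x. g (y j) x \<partial>lborel)"
    unfolding E by (subst infsum_prod_fun[OF sm]) (simp add: e_def[abs_def] integral_cells(3)[OF g])
  then have "of_real (sqrt (s / pi) ^ CARD('d)) * (\<Sum>\<^sub>\<infinity>l. E l) = (\<Prod>j\<in>UNIV. of_real (sqrt (s / pi)) * (\<integral>x. g (y j) x \<partial>lborel))"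
    by (simp add: prod.distrib)
  also have "\<dots> = (\<Prod>j\<in>UNIV. of_real (exp (- ((y j)\<^sup>2 / (4 * s)))))"
    unfolding g_def gaussian_fourier(2)[OF s] ..
  also have "\<dots> = of_real (exp (\<Sum>j\<in>UNIV. - ((y j)\<^sup>2 / (4 * s))))"
    by (simp only: exp_sum finite of_real_prod)
  finally show "of_real (exp (- ((\<Sum>j\<in>UNIV. (y j)\<^sup>2) / (4 * s)))) = of_real (sqrt (s / pi) ^ CARD('d)) * (\<Sum>\<^sub>\<infinity>l. E l)"
    by (simp add: sum_negf sum_divide_distrib)
qed

section \<open>The kernel as an integral over the torus\<close>

lemma borel_measurable_phase_torus: "(\<lambda>t. phase y (lshift l (ct t))) \<in> borel_measurable torus"
proof (rule borel_measurable_torus)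
  have co: "continuous_on (space torus) (\<lambda>t. lshift l (ct t) j)" for j and l :: "'a \<Rightarrow> int"
    unfolding lshift_def ct_def
    by (intro continuous_intros continuous_on_subset[OF continuous_on_product_coordinates]) auto
  show "continuous_on (space torus) (\<lambda>t. phase y (lshift l (ct t)))"
    unfolding phase_def by (intro continuous_intros co)
qed

lemma borel_measurable_cell_sq: "cell_sq l \<in> borel_measurable torus"
  unfolding cell_sq_def[abs_def]
  by (intro borel_measurable_torus continuous_intros continuous_on_subset[OF continuous_on_product_coordinates]) auto

lemma Im_ct [simp]: "Im (ct t j) = 0" by (simp add: ct_def)

text \<open>The factor pi^(-d/2) comes from the normalisation of the Gaussian transforms, Gamma(m)
  from the integration over the scale.\<close>

definition kappa :: "'d::finite itself \<Rightarrow> nat \<Rightarrow> real" where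
  "kappa _ m = sqrt (1 / pi) ^ CARD('d) * gamma_integral (real m)"

context
  fixes m :: nat and h :: real and ty :: "'d::finite itself"
  assumes m: "real m > real CARD('d) / 2" and h: "0 < h" "h \<le> 1"
begin

lemma symb_lower_torus: "norm (symb h (lshift l (ct (t :: 'd \<Rightarrow> real)))) = h\<^sup>2 + cell_sq l t" "h\<^sup>2 + cell_sq l t > 0"
proof -
  show 1: "h\<^sup>2 + cell_sq l t > 0" unfolding cell_sq_def using h by (intro add_pos_nonneg sum_nonneg) auto
  then show "norm (symb h (lshift l (ct (t :: 'd \<Rightarrow> real)))) = h\<^sup>2 + cell_sq l t"
    unfolding symb_lshift_ct cell_sq_def[symmetric] norm_of_real by simp
qed

definition "cell_const = (3/2 * symb_bound TYPE('d)) ^ m / (h\<^sup>2) ^ m"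

text \<open>Read off from the bound for \<open>rho\<close>, since \<open>symb\<close> is at least
  h^2 on the torus. The constant depends on \<open>h\<close>, which is harmless: it only justifies
  exchanging sums and integrals.\<close>

lemma inverse_symb_le:
  assumes t: "t \<in> space torus"
  shows "1 / (h\<^sup>2 + cell_sq l (t :: 'd \<Rightarrow> real)) ^ m \<le> cell_const * lattice_weight m l"
proof -
  have r: "rho h l (ct t) = symb h (ct t) / symb h (lshift l (ct t))"
    using symb_ct_nonzero[OF h(1), of "\<lambda>_. 0" t] by (auto simp: rho_def)
  have "cell_sq (\<lambda>_. 0) t \<ge> 0" unfolding cell_sq_def by (intro sum_nonneg) auto
  then have "(h\<^sup>2) ^ m \<le> norm (symb h (ct t)) ^ m"
    using symb_lower_torus(1)[of "\<lambda>_. 0" t] by (intro power_mono) auto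
  then have "(h\<^sup>2) ^ m * (1 / (h\<^sup>2 + cell_sq l t) ^ m) \<le> norm (symb h (ct t)) ^ m * (1 / (h\<^sup>2 + cell_sq l t) ^ m)"
    using symb_lower_torus(2)[of l t] by (intro mult_right_mono) auto
  also have "\<dots> = norm (rho h l (ct t) ^ m)"
    unfolding r norm_power norm_divide symb_lower_torus(1) by (simp add: power_divide)
  also have "\<dots> \<le> (3/2 * symb_bound TYPE('d)) ^ m * lattice_weight m l"
    by (rule norm_rho_power_le[OF ct_in_strip_box[OF t] h])
  finally show ?thesis using h unfolding cell_const_def by (simp add: field_simps)
qed

lemma integral_radial:
  fixes l :: "'d \<Rightarrow> int"
  shows "integrable lborel (\<lambda>x. exp (real m * x - (h\<^sup>2 + cell_sq l t) * exp x))"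
    and "(\<integral>x. exp (real m * x - (h\<^sup>2 + cell_sq l t) * exp x) \<partial>lborel) = gamma_integral (real m) / (h\<^sup>2 + cell_sq l t) ^ m"
proof -
  have m0: "real m > 0" using m_ge_1[OF m h] by simp
  show "integrable lborel (\<lambda>x. exp (real m * x - (h\<^sup>2 + cell_sq l t) * exp x))"
    by (rule gamma_integral_scaled(1)[OF m0 symb_lower_torus(2)])
  show "(\<integral>x. exp (real m * x - (h\<^sup>2 + cell_sq l t) * exp x) \<partial>lborel) = gamma_integral (real m) / (h\<^sup>2 + cell_sq l t) ^ m"
    unfolding gamma_integral_scaled(2)[OF m0 symb_lower_torus(2)]
    using symb_lower_torus(2)[of l t] by (simp add: powr_minus powr_realpow divide_inverse)
qed

text \<open>Integrated over the logarithmic scale \<open>x\<close> it gives Gamma(m) times a term of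
  the folded series; integrated over \<open>t\<close>, up to a factor, one cell of a Gaussian
  Fourier integral.\<close>

definition "kern y l x t = phase y (lshift l (ct (t :: 'd \<Rightarrow> real))) * of_real (exp (real m * x - (h\<^sup>2 + cell_sq l t) * exp x))"

lemma pair_torus_lborel: "pair_sigma_finite (torus :: ('d \<Rightarrow> real) measure) (lborel :: real measure)"
proof -
  have "sigma_finite_measure (torus :: ('d \<Rightarrow> real) measure)"
    unfolding torus_def by (rule arcs.sigma_finite) simp
  then show ?thesis by (simp add: pair_sigma_finite_def sigma_finite_lborel)
qed

lemma inverse_symb_integrable:
  "integrable torus (\<lambda>t :: 'd \<Rightarrow> real. 1 / (h\<^sup>2 + cell_sq l t) ^ m)"
proof (rule integrable_torus_bounded)
  show "(\<lambda>t :: 'd \<Rightarrow> real. 1 / (h\<^sup>2 + cell_sq l t) ^ m) \<in> borel_measurable torus"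
    using borel_measurable_cell_sq[of l] by measurable
  show "norm (1 / (h\<^sup>2 + cell_sq l t) ^ m) \<le> cell_const * lattice_weight m l" if "t \<in> space torus" for t :: "'d \<Rightarrow> real"
    using inverse_symb_le[OF that, of l] symb_lower_torus(2)[of l t] by simp
qed

lemma kern_integrable:
  fixes y :: "'d \<Rightarrow> real"
  shows "integrable (torus \<Otimes>\<^sub>M lborel) (\<lambda>(t, x). kern y l x t)"
proof (rule pair_sigma_finite.Fubini_integrable[OF pair_torus_lborel])
  note [measurable] = borel_measurable_phase_torus[of y l] borel_measurable_cell_sq[of l]
  show "(\<lambda>(t, x). kern y l x t) \<in> borel_measurable (torus \<Otimes>\<^sub>M lborel)"
    unfolding kern_def by measurable
  have n: "norm (kern y l x t) = exp (real m * x - (h\<^sup>2 + cell_sq l t) * exp x)" for x t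
    by (simp add: kern_def norm_mult)
  have "integrable torus (\<lambda>t. gamma_integral (real m) * (1 / (h\<^sup>2 + cell_sq l t) ^ m))"
    by (intro integrable_mult_right inverse_symb_integrable)
  then show "integrable torus (\<lambda>t. \<integral>x. norm (case (t, x) of (t, x) \<Rightarrow> kern y l x t) \<partial>lborel)"
    by (simp add: n integral_radial(2))
  show "AE t in torus. integrable lborel (\<lambda>x. case (t, x) of (t, x) \<Rightarrow> kern y l x t)"
  proof (rule AE_I2)
    fix t :: "'d \<Rightarrow> real"
    have "integrable lborel (\<lambda>x. complex_of_real (exp (real m * x - (h\<^sup>2 + cell_sq l t) * exp x)))"
      by (intro integrable_of_real integral_radial(1))
    then show "integrable lborel (\<lambda>x. case (t, x) of (t, x) \<Rightarrow> kern y l x t)"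
      unfolding kern_def by (simp del: of_real_exp)
  qed
qed

lemma norm_kern: "norm (kern y l x t) = exp (real m * x - (h\<^sup>2 + cell_sq l t) * exp x)"
  by (simp add: kern_def norm_mult)

text \<open>Each Gaussian of the mixture \<open>Psi\<close> is expanded over the frequency cells.
  After exchanging cells, frequency and scale, the scale integral evaluates to Gamma(m) times the
  reciprocal m-th power of \<open>symb\<close>.\<close>

lemma Psi_eq_torus_integral:
  fixes y :: "'d \<Rightarrow> real"
  shows "of_real (Psi (real m - real CARD('d) / 2) h (sqrt (\<Sum>j\<in>UNIV. (y j)\<^sup>2)))
    = of_real (kappa TYPE('d) m) * (\<integral>t. periodized m h y (ct t) \<partial>torus)"
proof -
  define a where "a = real m - real CARD('d) / 2"
  have a: "a > 0" using m by (simp add: a_def)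
  interpret P: pair_sigma_finite "torus :: ('d \<Rightarrow> real) measure" "lborel :: real measure"
    by (rule pair_torus_lborel)
  define w where "w l x = (\<integral>t. kern y l x t \<partial>torus)" for l x
  define c :: complex where "c = of_real (sqrt (1 / pi) ^ CARD('d))"
  have wE: "w l x = of_real (exp (real m * x - h\<^sup>2 * exp x)) *
      (\<integral>t. phase y (lshift l (ct t)) * of_real (exp (- exp x * cell_sq l t)) \<partial>torus)" for l x
  proof -
    have *: "kern y l x t = of_real (exp (real m * x - h\<^sup>2 * exp x)) * (phase y (lshift l (ct t)) * of_real (exp (- exp x * cell_sq l t)))" for t
    proof -
      have "exp (real m * x - (h\<^sup>2 + cell_sq l t) * exp x) = exp (real m * x - h\<^sup>2 * exp x) * exp (- exp x * cell_sq l t)"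
        unfolding mult_exp_exp by (simp add: algebra_simps)
      then show ?thesis unfolding kern_def by (simp only: of_real_mult mult_ac)
    qed
    show ?thesis unfolding w_def * by (rule integral_mult_right_zero)
  qed
  have pt: "(\<lambda>l. norm (w l x)) summable_on UNIV" for x
    unfolding wE norm_mult
    by (intro summable_on_cmult_right gaussian_product(1)) simp
  have val: "of_real (exp (a * x - h\<^sup>2 * exp x - (\<Sum>j\<in>UNIV. (y j)\<^sup>2) / 4 * exp (- x))) = c * (\<Sum>\<^sub>\<infinity>l. w l x)" for x
  proof -
    have "(\<Sum>j\<in>UNIV. (y j)\<^sup>2) / 4 * exp (- x) = (\<Sum>j\<in>UNIV. (y j)\<^sup>2) / (4 * exp x)"
      by (simp add: exp_minus field_simps)
    then have "of_real (exp (a * x - h\<^sup>2 * exp x - (\<Sum>j\<in>UNIV. (y j)\<^sup>2) / 4 * exp (- x)))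
      = of_real (exp (a * x - h\<^sup>2 * exp x)) * complex_of_real (exp (- ((\<Sum>j\<in>UNIV. (y j)\<^sup>2) / (4 * exp x))))"
      unfolding of_real_mult[symmetric] mult_exp_exp by simp
    also have "\<dots> = of_real (exp (a * x - h\<^sup>2 * exp x) * sqrt (exp x / pi) ^ CARD('d)) *
        (\<Sum>\<^sub>\<infinity>l. \<integral>t. phase y (lshift l (ct t)) * of_real (exp (- exp x * cell_sq l t)) \<partial>torus)"
      unfolding gaussian_product(2)[OF exp_gt_zero] of_real_mult mult.assoc ..
    \<comment> \<open>The Gaussian normalisation contributes exp (d x / 2), which raises the
      exponent from a = m - d/2 to m.\<close>
    also have "exp (a * x - h\<^sup>2 * exp x) * sqrt (exp x / pi) ^ CARD('d) = sqrt (1 / pi) ^ CARD('d) * exp (real m * x - h\<^sup>2 * exp x)"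
    proof -
      have "sqrt (exp x) = exp (x / 2)" by (rule real_sqrt_unique) (auto simp: exp_double[symmetric])
      then have "sqrt (exp x / pi) ^ CARD('d) = sqrt (1 / pi) ^ CARD('d) * exp (real CARD('d) * (x / 2))"
        unfolding exp_of_nat_mult by (simp add: real_sqrt_divide power_divide)
      then show ?thesis by (simp add: a_def mult_exp_exp algebra_simps)
    qed
    also have "of_real (sqrt (1 / pi) ^ CARD('d) * exp (real m * x - h\<^sup>2 * exp x)) *
        (\<Sum>\<^sub>\<infinity>l. \<integral>t. phase y (lshift l (ct t)) * of_real (exp (- exp x * cell_sq l t)) \<partial>torus) = c * (\<Sum>\<^sub>\<infinity>l. w l x)"
      unfolding wE infsum_cmult_right' c_def of_real_mult mult.assoc ..
    finally show ?thesis .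
  qed
  have wi: "integrable lborel (w l)" for l
    unfolding w_def using P.integrable_snd[OF kern_integrable[of y l]] by simp
  have swap: "(\<integral>x. w l x \<partial>lborel) = of_real (gamma_integral (real m)) * (\<integral>t. phase y (lshift l (ct t)) / symb h (lshift l (ct t)) ^ m \<partial>torus)" for l
  proof -
    have "(\<integral>x. w l x \<partial>lborel) = (\<integral>t. \<integral>x. kern y l x t \<partial>lborel \<partial>torus)"
      unfolding w_def by (rule P.Fubini_integral[OF kern_integrable])
    also have "\<dots> = (\<integral>t. of_real (gamma_integral (real m)) * (phase y (lshift l (ct t)) / symb h (lshift l (ct t)) ^ m) \<partial>torus)"
    proof (rule Bochner_Integration.integral_cong[OF refl])
      fix t :: "'d \<Rightarrow> real"
      have "(\<integral>x. kern y l x t \<partial>lborel) = phase y (lshift l (ct t)) * of_real (\<integral>x. exp (real m * x - (h\<^sup>2 + cell_sq l t) * exp x) \<partial>lborel)"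
        unfolding kern_def by (simp only: integral_mult_right_zero integral_complex_of_real)
      also have "\<dots> = of_real (gamma_integral (real m)) * (phase y (lshift l (ct t)) / symb h (lshift l (ct t)) ^ m)"
        unfolding integral_radial(2) symb_lshift_ct cell_sq_def[symmetric] by (simp add: divide_inverse)
      finally show "(\<integral>x. kern y l x t \<partial>lborel) = of_real (gamma_integral (real m)) * (phase y (lshift l (ct t)) / symb h (lshift l (ct t)) ^ m)" .
    qed
    finally show ?thesis unfolding integral_mult_right_zero .
  qed
  have lattice_weight: "(\<lambda>l :: 'd \<Rightarrow> int. C * lattice_weight m l) summable_on UNIV" for C by (intro summable_on_cmult_right summable_lattice_weight m)
  \<comment> \<open>After exchanging the order of integration, the norm of \<open>kern\<close>
    integrates over the scale to a multiple of the reciprocal power bounded by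
    \<open>inverse_symb_le\<close>.\<close>
  have L1: "(\<lambda>l. \<integral>x. norm (w l x) \<partial>lborel) summable_on UNIV"
  proof (rule summable_on_comparison_test[OF lattice_weight])
    fix l :: "'d \<Rightarrow> int"
    have nk: "integrable (torus \<Otimes>\<^sub>M lborel) (\<lambda>(t, x). norm (kern y l x t))"
      using integrable_norm[OF kern_integrable[of y l]] by (simp add: case_prod_unfold)
    have "(\<integral>x. norm (w l x) \<partial>lborel) \<le> (\<integral>x. \<integral>t. norm (kern y l x t) \<partial>torus \<partial>lborel)"
    proof (rule integral_mono)
      show "integrable lborel (\<lambda>x. \<integral>t. norm (kern y l x t) \<partial>torus)"
        by (rule P.integrable_snd[OF nk])
      show "integrable lborel (\<lambda>x. norm (w l x))" by (rule integrable_norm[OF wi])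
      show "norm (w l x) \<le> (\<integral>t. norm (kern y l x t) \<partial>torus)" for x
        unfolding w_def by (rule integral_norm_bound)
    qed
    also have "\<dots> = (\<integral>t. \<integral>x. norm (kern y l x t) \<partial>lborel \<partial>torus)"
      by (rule P.Fubini_integral[OF nk])
    also have "\<dots> = (\<integral>t. gamma_integral (real m) * (1 / (h\<^sup>2 + cell_sq l t) ^ m) \<partial>(torus :: ('d \<Rightarrow> real) measure))"
      unfolding norm_kern integral_radial(2) by simp
    also have "\<dots> \<le> norm (\<integral>t. gamma_integral (real m) * (1 / (h\<^sup>2 + cell_sq l t) ^ m) \<partial>(torus :: ('d \<Rightarrow> real) measure))" by simp
    also have "\<dots> \<le> (2 * pi) ^ CARD('d) * (gamma_integral (real m) * (cell_const * lattice_weight m l))"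
    proof (rule norm_integral_torus_le)
      fix t :: "'d \<Rightarrow> real" assume t: "t \<in> space torus"
      have g: "gamma_integral (real m) > 0" using m_ge_1[OF m h] by (intro gamma_integral_pos) simp
      then have "norm (gamma_integral (real m) * (1 / (h\<^sup>2 + cell_sq l t) ^ m)) = gamma_integral (real m) * (1 / (h\<^sup>2 + cell_sq l t) ^ m)"
        using symb_lower_torus(2)[of l t] by simp
      also have "\<dots> \<le> gamma_integral (real m) * (cell_const * lattice_weight m l)"
        using g inverse_symb_le[OF t, of l] by (intro mult_left_mono) auto
      finally show "norm (gamma_integral (real m) * (1 / (h\<^sup>2 + cell_sq l t) ^ m)) \<le> gamma_integral (real m) * (cell_const * lattice_weight m l)" .
    qed
    finally show "(\<integral>x. norm (w l x) \<partial>lborel) \<le> ((2 * pi) ^ CARD('d) * (gamma_integral (real m) * cell_const)) * lattice_weight m l"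
      by (simp only: mult.assoc)
  qed simp
  have sy: "norm (phase y (lshift l (ct t)) / symb h (lshift l (ct t)) ^ m) = 1 / (h\<^sup>2 + cell_sq l t) ^ m" for l t
    by (simp add: norm_divide norm_power symb_lower_torus(1))
  have T: "(\<Sum>\<^sub>\<infinity>l. \<integral>t. phase y (lshift l (ct t)) / symb h (lshift l (ct t)) ^ m \<partial>torus) = (\<integral>t. periodized m h y (ct t) \<partial>torus)"
    unfolding periodized_def
  proof (rule integral_infsum(2)[symmetric])
    fix l :: "'d \<Rightarrow> int"
    note [measurable] = borel_measurable_phase_torus[of y l] borel_measurable_cell_sq[of l]
    have "(\<lambda>t. phase y (lshift l (ct t)) / symb h (lshift l (ct t)) ^ m) \<in> borel_measurable torus"
      unfolding symb_lshift_ct cell_sq_def[symmetric] by measurable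
    then show "integrable torus (\<lambda>t. phase y (lshift l (ct t)) / symb h (lshift l (ct t)) ^ m)"
      by (rule integrable_torus_bounded) (use inverse_symb_le[of _ l] in \<open>simp only: sy\<close>)
  next
    fix t :: "'d \<Rightarrow> real" assume t: "t \<in> space torus"
    show "(\<lambda>l. norm (phase y (lshift l (ct t)) / symb h (lshift l (ct t)) ^ m)) summable_on UNIV"
      unfolding sy by (rule summable_on_comparison_test[OF lattice_weight inverse_symb_le[OF t]])
       (use symb_lower_torus(2)[of _ t] in \<open>auto intro: less_imp_le\<close>)
  next
    show "(\<lambda>l. \<integral>t. norm (phase y (lshift l (ct t)) / symb h (lshift l (ct t)) ^ m) \<partial>torus) summable_on UNIV"
    proof (rule summable_on_comparison_test[OF lattice_weight])
      fix l :: "'d \<Rightarrow> int"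
      have "norm (\<integral>t. norm (phase y (lshift l (ct t)) / symb h (lshift l (ct t)) ^ m) \<partial>torus) \<le> (2 * pi) ^ CARD('d) * (cell_const * lattice_weight m l)"
      proof (rule norm_integral_torus_le)
        fix t :: "'d \<Rightarrow> real" assume t: "t \<in> space torus"
        show "norm (norm (phase y (lshift l (ct t)) / symb h (lshift l (ct t)) ^ m)) \<le> cell_const * lattice_weight m l"
          unfolding sy using inverse_symb_le[OF t, of l] symb_lower_torus(2)[of l t] by simp
      qed
      then show "(\<integral>t. norm (phase y (lshift l (ct t)) / symb h (lshift l (ct t)) ^ m) \<partial>torus) \<le> ((2 * pi) ^ CARD('d) * cell_const) * lattice_weight m l"
        by (simp only: mult.assoc real_norm_def)
    qed auto
  qed simp
  have "of_real (Psi a h (sqrt (\<Sum>j\<in>UNIV. (y j)\<^sup>2)))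
     = (\<integral>x. complex_of_real (exp (a * x - h\<^sup>2 * exp x - (\<Sum>j\<in>UNIV. (y j)\<^sup>2) / 4 * exp (- x))) \<partial>lborel)"
    unfolding Psi_def integral_complex_of_real by (simp add: sum_nonneg)
  also have "\<dots> = c * (\<integral>x. (\<Sum>\<^sub>\<infinity>l. w l x) \<partial>lborel)" unfolding val by simp
  also have "(\<integral>x. (\<Sum>\<^sub>\<infinity>l. w l x) \<partial>lborel) = (\<Sum>\<^sub>\<infinity>l. \<integral>x. w l x \<partial>lborel)"
    by (rule integral_infsum(2)[OF infinite_fun_int wi pt L1])
  also have "\<dots> = of_real (gamma_integral (real m)) * (\<integral>t. periodized m h y (ct t) \<partial>torus)"
    unfolding swap infsum_cmult_right' T ..
  finally show ?thesis unfolding a_def c_def kappa_def of_real_mult mult.assoc .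
qed

end

lemma kappa_pos:
  assumes "m > 0" shows "kappa TYPE('d::finite) m > 0"
  using assms gamma_integral_pos[of "real m"] by (simp add: kappa_def)

subsection \<open>Trigonometric polynomials\<close>

text \<open>Finite linear combinations of characters with integer frequencies, generated so that
  identities linear in the function follow by induction.\<close>

inductive trig :: "(('d::finite \<Rightarrow> real) \<Rightarrow> complex) \<Rightarrow> bool" where
  trig_phase: "trig (\<lambda>t. c * phase (\<lambda>j. of_int (k j)) (ct t))"
| trig_add: "trig f \<Longrightarrow> trig g \<Longrightarrow> trig (\<lambda>t. f t + g t)"

lemma trig_const: "trig (\<lambda>_. c)"
  using trig_phase[of c "\<lambda>_. 0"] by simp

lemma trig_cmult: "trig f \<Longrightarrow> trig (\<lambda>t. c * f t)"
proof (induction rule: trig.induct)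
  case (trig_phase b k)
  then show ?case using trig.trig_phase[of "c * b" k] by (simp add: mult.assoc)
next
  case (trig_add f g)
  then show ?case using trig.trig_add by (simp add: distrib_left)
qed

lemma trig_sum:
  assumes "finite I" "\<And>i. i \<in> I \<Longrightarrow> trig (f i)" shows "trig (\<lambda>t. \<Sum>i\<in>I. f i t)"
  using assms by (induction rule: finite_induct) (auto intro: trig_const trig_add)

lemma trig_mult: "trig f \<Longrightarrow> trig g \<Longrightarrow> trig (\<lambda>t. f t * g t)"
proof (induction rule: trig.induct)
  case (trig_phase c k)
  from this have "trig (\<lambda>t. phase (\<lambda>j. of_int (k j)) (ct t) * g t)"
  proof (induction rule: trig.induct)
    case (trig_phase b l)
    have *: "phase (\<lambda>j. of_int (k j)) \<xi> * (b * phase (\<lambda>j. of_int (l j)) \<xi>) = b * phase (\<lambda>j. of_int (k j + l j)) \<xi>" for \<xi>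
      by (simp add: phase_add)
    show ?case unfolding * by (rule trig.trig_phase)
  next
    case (trig_add f g)
    then show ?case using trig.trig_add by (simp add: distrib_left)
  qed
  then show ?case using trig_cmult by (simp add: mult.assoc)
next
  case (trig_add f g)
  then show ?case using trig.trig_add by (simp add: distrib_right)
qed

lemma continuous_ct: "continuous_on A (\<lambda>t. ct t j)"
  unfolding ct_def by (intro continuous_intros continuous_on_subset[OF continuous_on_product_coordinates]) auto

lemma continuous_phase_ct: "continuous_on A (\<lambda>t. phase y (ct t))"
  unfolding phase_def by (intro continuous_intros continuous_ct)

lemma norm_phase_ct: "norm (phase y (ct t)) = 1"
  by (simp add: norm_phase)

lemma trig_continuous_bounded:
  assumes "trig f" shows "continuous_on A f" "\<exists>B. \<forall>t. norm (f t) \<le> B"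
proof -
  show "continuous_on A f" using assms
    by induction (intro continuous_intros continuous_phase_ct; assumption)+
  show "\<exists>B. \<forall>t. norm (f t) \<le> B" using assms
  proof induction
    case (trig_phase c k)
    then show ?case by (auto simp: norm_mult norm_phase_ct)
  next
    case (trig_add f g)
    then obtain B C where "\<forall>t. norm (f t) \<le> B" "\<forall>t. norm (g t) \<le> C" by blast
    then show ?case by (intro exI[of _ "B + C"] allI norm_triangle_mono) auto
  qed
qed

lemma trig_cis: "trig (\<lambda>t. cis (t j))" "trig (\<lambda>t. cis (- t j))"
proof -
  have "(\<Sum>i\<in>UNIV. of_real (of_int (if i = j then c else 0)) * ct t i) = (\<Sum>i\<in>{j}. of_int c * of_real (t j))" for c t
    by (rule sum.mono_neutral_cong_right) (auto simp: ct_def)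
  then have e: "phase (\<lambda>i. of_int (if i = j then c else 0)) (ct t) = exp (\<i> * (of_int c * of_real (t j)))" for c t
    by (simp add: phase_def)
  show "trig (\<lambda>t. cis (t j))" "trig (\<lambda>t. cis (- t j))"
    using trig_phase[of 1 "\<lambda>i. if i = j then 1 else 0"] trig_phase[of 1 "\<lambda>i. if i = j then -1 else 0"]
    unfolding e cis_conv_exp by simp_all
qed

lemma trig_cos_sin: "trig (\<lambda>t. of_real (cos (t j)))" "trig (\<lambda>t. of_real (sin (t j)))"
proof -
  have c: "of_real (cos x) = (1/2) * cis x + (1/2) * cis (- x)" and s: "of_real (sin x) = (- \<i> / 2) * cis x + (\<i> / 2) * cis (- x)" for x
    by (auto simp: complex_eq_iff)
  show "trig (\<lambda>t. of_real (cos (t j)))" "trig (\<lambda>t. of_real (sin (t j)))"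
    unfolding c s by (intro trig_add trig_cmult trig_cis)+
qed

text \<open>By induction only real-linear functionals need work. On the vector of the cis t_j such a
  functional is a combination of the cos t_j and sin t_j, with its values on the axes 1 and i as
  coefficients.\<close>

lemma trig_real_polynomial:
  fixes g :: "complex^'d \<Rightarrow> real"
  assumes "real_polynomial_function g"
  shows "trig (\<lambda>t. of_real (g (\<chi> j. cis (t j))))"
  using assms
proof induction
  case (linear f)
  then interpret bounded_linear f .
  have "f (\<chi> j. cis (t j)) = (\<Sum>j\<in>UNIV. cos (t j) * f (axis j 1) + sin (t j) * f (axis j \<i>))" for t :: "'d \<Rightarrow> real"
  proof -
    have "(\<chi> j. cis (t j)) = (\<Sum>j\<in>UNIV. cos (t j) *\<^sub>R axis j 1 + sin (t j) *\<^sub>R axis j \<i>)"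
      by (simp add: vec_eq_iff axis_def if_distrib[where f="(*\<^sub>R) _"] sum.distrib complex_eq_iff cong: if_cong)
    then show ?thesis by (simp add: sum add scaleR)
  qed
  then show ?case
    by (simp only: of_real_sum of_real_add of_real_mult)
       (intro trig_sum trig_add trig_mult trig_cos_sin trig_const finite)
next
  case (mult f g)
  then show ?case by (simp add: trig_mult)
next
  case (add f g)
  then show ?case by (simp add: trig_add)
qed (simp add: trig_const)

lemma compact_torus_cart: "compact {x :: real^'d. \<forall>j. \<bar>x $ j\<bar> \<le> pi}"
proof -
  have "{x :: real^'d. \<forall>j. \<bar>x $ j\<bar> \<le> pi} = cbox (\<chi> j. - pi) (\<chi> j. pi)"
    by (auto simp: mem_box_cart abs_le_pi)
  then show ?thesis by simp
qed

text \<open>A continuous periodic function descends to the compact image of the cube in \<open>\<complex>\<^sup>d\<close>, where its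
  graph is compact, hence closed; so the Stone--Weierstrass theorem applies to it there.\<close>
lemma trig_dense_real:
  fixes R :: "('d::finite \<Rightarrow> real) \<Rightarrow> real"
  assumes cont: "continuous_on (space torus) R"
    and per: "\<And>t t'. t \<in> space torus \<Longrightarrow> t' \<in> space torus \<Longrightarrow> (\<And>j. cis (t j) = cis (t' j)) \<Longrightarrow> R t = R t'"
    and e: "e > 0"
  obtains T where "trig T" "\<And>t. t \<in> space torus \<Longrightarrow> norm (of_real (R t) - T t) < e"
proof -
  define Q where "Q = {x :: real^'d. \<forall>j. \<bar>x $ j\<bar> \<le> pi}"
  define E where "E x = (\<chi> j. cis (x $ j))" for x :: "real^'d"
  define r where "r x = R (\<lambda>j. x $ j)" for x :: "real^'d"
  \<comment> \<open>\<open>inv_into\<close> picks some preimage; by \<open>per\<close> the value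
    does not depend on the choice.\<close>
  define f where "f z = r (inv_into Q E z)" for z
  have Q: "compact Q" unfolding Q_def by (rule compact_torus_cart)
  have inT: "(\<lambda>j. x $ j) \<in> space torus" if "x \<in> Q" for x using that by (simp add: Q_def space_torus)
  have contE: "continuous_on Q E" unfolding E_def cis_conv_exp by (intro continuous_intros)
  have contr: "continuous_on Q r" unfolding r_def
    by (rule continuous_on_compose2[OF cont]) (use inT in \<open>auto intro!: continuous_intros\<close>)
  have fE: "f (E x) = r x" if x: "x \<in> Q" for x
  proof -
    have 1: "inv_into Q E (E x) \<in> Q" "E (inv_into Q E (E x)) = E x"
      using x by (auto intro: inv_into_into f_inv_into_f)
    show ?thesis unfolding f_def r_def
      by (rule per[OF inT inT]) (use 1 x in \<open>auto simp: E_def vec_eq_iff\<close>)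
  qed
  have "continuous_on (E ` Q) f"
  proof (subst continuous_closed_graph_eq)
    show "compact (r ` Q)" by (rule compact_continuous_image[OF contr Q])
    show "f \<in> E ` Q \<rightarrow> r ` Q" using fE by auto
    have "(\<lambda>x. (x, f x)) ` E ` Q = (\<lambda>x. (E x, r x)) ` Q" using fE by (auto simp: image_iff)
    moreover have "compact ((\<lambda>x. (E x, r x)) ` Q)"
      by (intro compact_continuous_image Q continuous_on_Pair contE contr)
    ultimately show "closedin (top_of_set (E ` Q \<times> r ` Q)) ((\<lambda>x. (x, f x)) ` E ` Q)"
      using fE by (intro closed_subset) (auto intro: compact_imp_closed)
  qed
  then obtain g where g: "real_polynomial_function g" "\<And>z. z \<in> E ` Q \<Longrightarrow> \<bar>f z - g z\<bar> < e"
    using Stone_Weierstrass_real_polynomial_function[OF compact_continuous_image[OF contE Q] _ e] by blast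
  show ?thesis
  proof
    show "trig (\<lambda>t. of_real (g (\<chi> j. cis (t j))))" by (rule trig_real_polynomial[OF g(1)])
    fix t :: "'d \<Rightarrow> real" assume t: "t \<in> space torus"
    then have x: "(\<chi> j. t j) \<in> Q" by (simp add: Q_def space_torus)
    then have "\<bar>r (\<chi> j. t j) - g (E (\<chi> j. t j))\<bar> < e" using g(2) fE[OF x] by fastforce
    then show "norm (complex_of_real (R t) - of_real (g (\<chi> j. cis (t j)))) < e"
      unfolding of_real_diff[symmetric] norm_of_real by (simp add: r_def E_def)
  qed
qed

lemma trig_dense:
  fixes W :: "('d::finite \<Rightarrow> real) \<Rightarrow> complex"
  assumes cont: "continuous_on (space torus) W"
    and per: "\<And>t t'. t \<in> space torus \<Longrightarrow> t' \<in> space torus \<Longrightarrow> (\<And>j. cis (t j) = cis (t' j)) \<Longrightarrow> W t = W t'"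
    and e: "e > 0"
  obtains T where "trig T" "\<And>t. t \<in> space torus \<Longrightarrow> norm (W t - T t) < e"
proof -
  have e2: "e / 2 > 0" using e by simp
  have contRe: "continuous_on (space torus) (\<lambda>t. Re (W t))"
    and contIm: "continuous_on (space torus) (\<lambda>t. Im (W t))"
    by (intro continuous_intros cont)+
  have perRe: "Re (W t) = Re (W t')" and perIm: "Im (W t) = Im (W t')"
    if "t \<in> space torus" "t' \<in> space torus" "\<And>j. cis (t j) = cis (t' j)" for t t'
    using per[OF that] by simp_all
  obtain T1 where T1: "trig T1" "\<And>t. t \<in> space torus \<Longrightarrow> norm (of_real (Re (W t)) - T1 t) < e / 2"
    using trig_dense_real[OF contRe perRe e2] by blast
  obtain T2 where T2: "trig T2" "\<And>t. t \<in> space torus \<Longrightarrow> norm (of_real (Im (W t)) - T2 t) < e / 2"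
    using trig_dense_real[OF contIm perIm e2] by blast
  show ?thesis
  proof
    show "trig (\<lambda>t. T1 t + \<i> * T2 t)" by (intro trig_add trig_cmult T1 T2)
    fix t :: "'d \<Rightarrow> real" assume t: "t \<in> space torus"
    have "W t - (T1 t + \<i> * T2 t) = (of_real (Re (W t)) - T1 t) + \<i> * (of_real (Im (W t)) - T2 t)"
      by (subst complex_eq[of "W t"]) (simp add: algebra_simps)
    also have "norm \<dots> \<le> norm (of_real (Re (W t)) - T1 t) + norm (of_real (Im (W t)) - T2 t)"
      by (rule order_trans[OF norm_triangle_ineq]) (simp add: norm_mult)
    finally show "norm (W t - (T1 t + \<i> * T2 t)) < e" using T1(2)[OF t] T2(2)[OF t] by linarith
  qed
qed

lemma integral_phase_torus:
  fixes k :: "'d::finite \<Rightarrow> int"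
  shows "(\<integral>t. phase (\<lambda>j. of_int (k j)) (ct t) \<partial>torus) = (if k = (\<lambda>_. 0) then (2 * pi) ^ CARD('d) else 0)"
proof -
  have c: "continuous_on {-pi..pi} (\<lambda>u. exp (\<i> * of_real (of_int n * u)))" for n
    by (intro continuous_intros)
  have i: "integrable arc (\<lambda>u. exp (\<i> * of_real (of_int n * u)))" for n
    by (subst integrable_restrict_space) (use borel_integrable_atLeastAtMost'[OF c] in \<open>auto simp: set_integrable_def\<close>)
  have z: "(\<integral>u. exp (\<i> * of_real (of_int n * u)) \<partial>arc) = (if n = 0 then 2 * pi else 0)" for n :: int
  proof (cases "n = 0")
    case False
    have "((\<lambda>u. exp (\<i> * of_real (of_int n * u))) has_integral
        exp (\<i> * of_real (of_int n * pi)) / (\<i> * of_int n) - exp (\<i> * of_real (of_int n * (-pi))) / (\<i> * of_int n)) {-pi..pi}"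
    proof (rule fundamental_theorem_of_calculus)
      show "((\<lambda>u. exp (\<i> * of_real (of_int n * u)) / (\<i> * of_int n)) has_vector_derivative exp (\<i> * of_real (of_int n * u))) (at u within {-pi..pi})" for u
      proof -
        have "((\<lambda>z. exp (c * z) / c) has_field_derivative exp (c * of_real u)) (at (of_real u))" if "c \<noteq> 0" for c :: complex
          using that by (auto intro!: derivative_eq_intros)
        from this[of "\<i> * of_int n"] 
        have "((\<lambda>z. exp (\<i> * (of_int n * z)) / (\<i> * of_int n)) has_field_derivative exp (\<i> * (of_int n * of_real u))) (at (of_real u))"
          using False by (simp add: mult.assoc)
        from has_vector_derivative_real_field[OF this] show ?thesis
          by (simp add: o_def has_vector_derivative_at_within)
      qed
    qed simp
    moreover have "exp (\<i> * of_real (of_int n * pi)) = exp (\<i> * of_real (of_int n * (-pi)))"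
      unfolding exp_eq by (intro exI[of _ n]) (simp add: algebra_simps)
    ultimately have "integral {-pi..pi} (\<lambda>u. exp (\<i> * of_real (of_int n * u))) = 0"
      by (simp add: integral_unique)
    then show ?thesis using False unfolding integral_arc_eq[OF c] by simp
  qed (simp add: measure_restrict_space space_restrict_space scaleR_conv_of_real)
  have "(\<integral>t. phase (\<lambda>j. of_int (k j)) (ct t) \<partial>torus) = (\<integral>t. (\<Prod>j\<in>UNIV. exp (\<i> * of_real (of_int (k j) * t j))) \<partial>torus)"
    by (simp add: phase_def ct_def exp_sum sum_distrib_left)
  also have "\<dots> = (\<Prod>j\<in>UNIV. if k j = 0 then 2 * pi else 0)"
    unfolding torus_def using arcs.product_integral_prod[of UNIV "\<lambda>j u. exp (\<i> * of_real (of_int (k j) * u))"] i z by simp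
  also have "\<dots> = (if k = (\<lambda>_. 0) then (2 * pi) ^ CARD('d) else 0)"
    by (auto simp: fun_eq_iff)
  finally show ?thesis .
qed

section \<open>The cardinal integral as a combination of translates of the kernel\<close>

context
  fixes m :: nat and h :: real and ty :: "'d::finite itself"
  assumes m: "real m > real CARD('d) / 2" and h: "0 < h" "h \<le> 1"
begin

abbreviation "per y t \<equiv> periodized m h y (ct (t :: 'd \<Rightarrow> real))"
abbreviation "iph k \<equiv> (\<lambda>j::'d. real_of_int (k j))"

lemma per_eq: "per y t = numer m h y (ct t) / symb h (ct t) ^ m"
  using numer_eq_ct(1)[OF m h, of y t] numer_eq_ct(2)[OF m h, of t] by simp

lemma continuous_symb_torus: "continuous_on A (\<lambda>t :: 'd \<Rightarrow> real. symb h (ct t))"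
  unfolding symb_def by (intro continuous_intros continuous_ct)

lemma continuous_per: "continuous_on (space torus) (per y)"
  unfolding per_eq
  by (intro continuous_on_divide continuous_on_power continuous_symb_torus continuous_numer_torus[OF m h])
     (simp add: numer_eq_ct(2)[OF m h])

lemma norm_per_le: 
  assumes "t \<in> space torus" shows "norm (per y t) \<le> numer_bound TYPE('d) m / (h\<^sup>2) ^ m"
proof -
  have "cell_sq (\<lambda>_. 0) t \<ge> 0" unfolding cell_sq_def by (intro sum_nonneg) auto
  then have "(h\<^sup>2) ^ m \<le> norm (symb h (ct t)) ^ m"
    using symb_lower_torus(1)[OF m h, of "\<lambda>_. 0" t] by (intro power_mono) auto
  then show ?thesis unfolding per_eq norm_divide norm_power[of "symb h (ct t)"]
    using norm_numer_torus_le[OF m h assms, of y] numer_bound_ge_1[OF m h] h by (intro frac_le) auto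
qed

lemma per0_nonzero: "t \<in> space torus \<Longrightarrow> per (\<lambda>_. 0) t \<noteq> 0"
  using denom_torus_nonzero[OF m h, of t] numer_eq_ct(1)[OF m h, of "\<lambda>_. 0" t] numer_eq_ct(2)[OF m h, of t] by auto

text \<open>By \<open>moment_eq_Psi\<close> a positive multiple of the kernel, in rescaled
  coordinates.\<close>

definition "moment y = (\<integral>t. per y t \<partial>torus)"

lemma per_shift: "per (\<lambda>j. y j - of_int (k j)) t = phase (iph (\<lambda>j. - k j)) (ct t) * per y t"
  using periodized_phase[of m h y "\<lambda>j. - k j" "ct t"] by simp

text \<open>Both sides are linear in T. For a single character of frequency l, orthogonality leaves
  only k = -l, and multiplying N_y by the character translates \<open>y\<close>; so the sum has one
  term and no convergence question arises.\<close>

lemma trig_reproduction: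
  assumes "trig T"
  shows "((\<lambda>k. (\<integral>t. T t * phase (iph k) (ct t) \<partial>torus) * moment (\<lambda>j. y j - of_int (k j)))
     has_sum (2 * pi) ^ CARD('d) * (\<integral>t. per y t * T t \<partial>torus)) UNIV"
  using assms
proof induction
  case (trig_phase c l)
  have eq: "(\<integral>t. c * phase (iph l) (ct t) * phase (iph k) (ct t) \<partial>torus) = (if k = (\<lambda>j. - l j) then c * (2 * pi) ^ CARD('d) else 0)" for k
  proof -
    have *: "c * phase (iph l) (ct t) * phase (iph k) (ct t) = c * phase (iph (\<lambda>j. l j + k j)) (ct t)" for t :: "'d \<Rightarrow> real"
      by (simp add: phase_add)
    have **: "(\<lambda>j. l j + k j) = (\<lambda>_. 0) \<longleftrightarrow> k = (\<lambda>j. - l j)" by (auto simp: fun_eq_iff eq_neg_iff_add_eq_0 add.commute)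
    show ?thesis unfolding * integral_mult_right_zero integral_phase_torus ** by simp
  qed
  have "(\<integral>t. per y t * (c * phase (iph l) (ct t)) \<partial>torus) = c * moment (\<lambda>j. y j - of_int (- l j))"
    unfolding moment_def per_shift integral_mult_right_zero[symmetric] by (simp add: mult_ac)
  then show ?case unfolding eq
    by (intro has_sum_finite_neutralI[of "{\<lambda>j. - l j}"]) auto
next
  case (trig_add f g)
  have int: "integrable torus (\<lambda>t. f t * phase (iph k) (ct t))" "integrable torus (\<lambda>t. per y t * f t)" 
    if tf: "trig f" for f :: "('d \<Rightarrow> real) \<Rightarrow> complex" and k y
  proof -
    obtain B where B: "\<And>t. norm (f t) \<le> B" using trig_continuous_bounded(2)[OF tf] by blast
    show "integrable torus (\<lambda>t. f t * phase (iph k) (ct t))"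
      by (rule integrable_torus_continuous[where B=B])
         (use B in \<open>auto intro!: continuous_intros trig_continuous_bounded(1)[OF tf] continuous_phase_ct simp: norm_mult norm_phase_ct\<close>)
    show "integrable torus (\<lambda>t. per y t * f t)"
    proof (rule integrable_torus_continuous)
      show "continuous_on (space torus) (\<lambda>t. per y t * f t)"
        by (intro continuous_on_mult continuous_per trig_continuous_bounded(1)[OF tf])
      show "norm (per y t * f t) \<le> numer_bound TYPE('d) m / (h\<^sup>2) ^ m * B" if "t \<in> space torus" for t
        unfolding norm_mult using norm_per_le[OF that, of y] B[of t] numer_bound_ge_1[OF m h] h by (intro mult_mono) auto
    qed
  qed
  show ?case
    using has_sum_add[OF trig_add.IH] int[OF trig_add.hyps(1)] int[OF trig_add.hyps(2)]
    by (simp add: distrib_left distrib_right)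
qed

lemma moment_eq_Psi:
  "moment y = of_real (Psi (real m - real CARD('d) / 2) h (sqrt (\<Sum>j\<in>UNIV. (y j)\<^sup>2)) / kappa TYPE('d) m)"
proof -
  have "kappa TYPE('d) m \<noteq> 0" using kappa_pos[where 'd='d, of m] m_ge_1[OF m h] by force
  then show ?thesis using Psi_eq_torus_integral[OF m h, of y] by (simp add: moment_def field_simps)
qed

text \<open>The Euclidean norm is at least the mean of the coordinate moduli, which splits the
  exponential decay of \<open>Psi\<close> into a product over the coordinates.\<close>

lemma Psi_summable:
  fixes y :: "'d \<Rightarrow> real"
  shows "(\<lambda>k. Psi (real m - real CARD('d) / 2) h (sqrt (\<Sum>j\<in>UNIV. (y j - of_int (k j))\<^sup>2))) summable_on UNIV"
proof -
  define b where "b = h / 2 / real CARD('d)"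
  define a where "a = real m - real CARD('d) / 2"
  have b: "b > 0" and a: "a > 0" using h m by (auto simp: b_def a_def)
  define C where "C = gamma_integral a * (h\<^sup>2 / 2) powr (- a)"
  have C: "C \<ge> 0" using gamma_integral_pos[OF a] by (simp add: C_def)
  have "(\<lambda>k. norm (\<Prod>j\<in>UNIV. exp (- b * \<bar>y j - of_int (k j)\<bar>))) summable_on UNIV"
    by (rule summable_on_prod_fun) (use exp_abs_shift_int(1)[OF b] in simp)
  then have "(\<lambda>k. C * norm (\<Prod>j\<in>UNIV. exp (- b * \<bar>y j - of_int (k j)\<bar>))) summable_on UNIV"
    by (rule summable_on_cmult_right)
  then show ?thesis
  proof (rule summable_on_comparison_test)
    fix k :: "'d \<Rightarrow> int"
    define r where "r = sqrt (\<Sum>j\<in>UNIV. (y j - of_int (k j))\<^sup>2)"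
    have "\<bar>y j - of_int (k j)\<bar> \<le> r" for j
    proof -
      have "(y j - of_int (k j))\<^sup>2 \<le> (\<Sum>j\<in>UNIV. (y j - of_int (k j))\<^sup>2)" by (rule member_le_sum) auto
      then show ?thesis unfolding r_def by (intro real_le_rsqrt) simp
    qed
    then have "(\<Sum>j\<in>(UNIV::'d set). \<bar>y j - of_int (k j)\<bar>) \<le> real CARD('d) * r"
      using sum_bounded_above[of "UNIV::'d set" "\<lambda>j. \<bar>y j - of_int (k j)\<bar>" r] by simp
    then have "b * (\<Sum>j\<in>(UNIV::'d set). \<bar>y j - of_int (k j)\<bar>) \<le> b * (real CARD('d) * r)"
      using b by (intro mult_left_mono) auto
    also have "\<dots> = h / 2 * r" by (simp add: b_def)
    finally have "exp (- (h / 2) * r) \<le> exp (\<Sum>j\<in>UNIV. - b * \<bar>y j - of_int (k j)\<bar>)"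
      by (simp add: sum_negf sum_distrib_left)
    also have "\<dots> = norm (\<Prod>j\<in>UNIV. exp (- b * \<bar>y j - of_int (k j)\<bar>))" by (simp add: exp_sum prod_nonneg)
    finally have "exp (- (h / 2) * r) \<le> norm (\<Prod>j\<in>UNIV. exp (- b * \<bar>y j - of_int (k j)\<bar>))" .
    then have "exp (- (h / 2) * r) * C \<le> norm (\<Prod>j\<in>UNIV. exp (- b * \<bar>y j - of_int (k j)\<bar>)) * C"
      using C by (rule mult_right_mono)
    moreover have "Psi a h r \<le> exp (- (h / 2) * r) * C"
      unfolding C_def by (rule Psi_le[OF a h(1)]) (simp add: r_def sum_nonneg)
    ultimately show "Psi (real m - real CARD('d) / 2) h (sqrt (\<Sum>j\<in>UNIV. (y j - of_int (k j))\<^sup>2))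
       \<le> C * norm (\<Prod>j\<in>UNIV. exp (- b * \<bar>y j - of_int (k j)\<bar>))"
      unfolding r_def[symmetric] a_def[symmetric] by (simp add: mult.commute)
  qed (rule Psi_nonneg)
qed

text \<open>With a trigonometric polynomial T in place of 1 / N_0 the identity is exact. A uniform
  error e between the two changes each coefficient by at most (2 pi)^d e; as the moments are
  absolutely summable, both sides move by O(e).\<close>

lemma cardinal_int_has_sum:
  fixes y :: "'d \<Rightarrow> real"
  shows "((\<lambda>k. inverse_coeff m h k * moment (\<lambda>j. y j - of_int (k j))) has_sum (2 * pi) ^ CARD('d) * cardinal_int m h y) UNIV"
proof -
  let ?P = "(2 * pi) ^ CARD('d)"
  define M where "M k = moment (\<lambda>j. y j - of_int (k j))" for k
  define W where "W t = 1 / per (\<lambda>_. 0) t" for t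
  define \<alpha> where "\<alpha> k = inverse_coeff m h (k :: 'd \<Rightarrow> int)" for k
  have P: "?P > 0" by simp
  have nM: "norm (M k) = Psi (real m - real CARD('d) / 2) h (sqrt (\<Sum>j\<in>UNIV. (y j - of_int (k j))\<^sup>2)) / kappa TYPE('d) m" for k
    using kappa_pos[where 'd='d, of m] m_ge_1[OF m h] Psi_nonneg
    unfolding M_def moment_eq_Psi norm_of_real by (simp add: abs_of_nonneg)
  have M: "(\<lambda>k. norm (M k)) summable_on UNIV"
    using summable_on_cmult_left[OF Psi_summable[of y], of "inverse (kappa TYPE('d) m)"] unfolding nM divide_inverse .
  have contW: "continuous_on (space torus) W" unfolding W_def
    by (intro continuous_on_divide continuous_intros continuous_per) (use per0_nonzero in blast)
  \<comment> \<open>Points with equal cis values differ by 2 pi times an integer vector, under which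
    \<open>periodized\<close> is invariant.\<close>
  have perW: "W t = W t'" if cis: "\<And>j. cis (t j) = cis (t' j)" for t t'
  proof -
    have "\<forall>j. \<exists>n. t j = t' j + 2 * pi * of_int n"
    proof
      fix j
      obtain n where "\<i> * of_real (t j) = \<i> * of_real (t' j) + of_real (of_int (2 * n) * pi) * \<i>"
        using cis[of j] unfolding cis_conv_exp exp_eq by blast
      from arg_cong[OF this, of Im] show "\<exists>n. t j = t' j + 2 * pi * of_int n"
        by (intro exI[of _ n]) (simp add: mult_ac)
    qed
    then obtain l where "\<And>j. t j = t' j + 2 * pi * of_int (l j)" by metis
    then have "ct t = lshift l (ct t')" by (auto simp: lshift_def ct_def)
    then show ?thesis by (simp add: W_def periodized_lshift)
  qed
  have \<alpha>: "\<alpha> k = (\<integral>t. W t * phase (iph k) (ct t) \<partial>torus)" for k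
    by (simp add: \<alpha>_def inverse_coeff_def W_def)
  have card: "cardinal_int m h y = (\<integral>t. per y t * W t \<partial>torus)"
    by (simp add: cardinal_int_def W_def)
  obtain BW where BW: "\<And>t. t \<in> space torus \<Longrightarrow> norm (W t) \<le> BW"
  proof
    fix t :: "'d \<Rightarrow> real" assume t: "t \<in> space torus"
    have le: "norm (symb h (ct t)) ^ m \<le> symb_bound TYPE('d) ^ m"
      by (intro power_mono norm_symb_le ct_in_strip_box t h) auto
    have "norm (W t) = norm (symb h (ct t)) ^ m / norm (numer m h (\<lambda>_. 0) (ct t))"
      by (simp add: W_def per_eq norm_divide norm_power)
    also have "\<dots> \<le> symb_bound TYPE('d) ^ m / 1"
      using norm_denom_torus_ge_1[OF m h t] symb_bound_ge[where 'd='d] le by (intro frac_le) auto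
    finally show "norm (W t) \<le> symb_bound TYPE('d) ^ m / 1" .
  qed
  have intW: "integrable torus (\<lambda>t. W t * phase (iph k) (ct t))" for k
    by (rule integrable_torus_continuous[where B=BW])
       (use BW in \<open>auto intro!: continuous_intros contW continuous_phase_ct simp: norm_mult norm_phase_ct\<close>)
  have Sb: "0 \<le> numer_bound TYPE('d) m / (h\<^sup>2) ^ m" using numer_bound_ge_1[OF m h] by simp
  have intPW: "integrable torus (\<lambda>t. per y t * W t)"
  proof (rule integrable_torus_continuous)
    show "continuous_on (space torus) (\<lambda>t. per y t * W t)" by (intro continuous_on_mult continuous_per contW)
    show "norm (per y t * W t) \<le> numer_bound TYPE('d) m / (h\<^sup>2) ^ m * BW" if "t \<in> space torus" for t
      unfolding norm_mult using norm_per_le[OF that, of y] BW[OF that] Sb by (intro mult_mono) auto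
  qed
  have \<alpha>_le: "norm (\<alpha> k) \<le> ?P * BW" for k unfolding \<alpha>
    by (rule norm_integral_torus_le) (use BW in \<open>simp add: norm_mult norm_phase_ct\<close>)
  have S: "(\<lambda>k. \<alpha> k * M k) summable_on UNIV"
    by (rule norm_infsum_le_infsum(2)[OF summable_on_cmult_right[OF M, of "?P * BW"]])
       (use \<alpha>_le in \<open>simp add: norm_mult mult_right_mono\<close>)
  \<comment> \<open>Chosen before e: the first summand collects the errors of the coefficients, the
    second that of the integral.\<close>
  define C where "C = ?P * (\<Sum>\<^sub>\<infinity>k. norm (M k)) + ?P * (?P * (numer_bound TYPE('d) m / (h\<^sup>2) ^ m))"
  have "norm ((\<Sum>\<^sub>\<infinity>k. \<alpha> k * M k) - ?P * cardinal_int m h y) \<le> C * e" if e: "e > 0" for e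
  proof -
    obtain T where T: "trig T" "\<And>t. t \<in> space torus \<Longrightarrow> norm (W t - T t) < e"
      using trig_dense[OF contW perW e] by blast
    obtain B where B: "\<And>t. norm (T t) \<le> B" using trig_continuous_bounded(2)[OF T(1)] by blast
    define \<tau> where "\<tau> k = (\<integral>t. T t * phase (iph k) (ct t) \<partial>torus)" for k
    have intT: "integrable torus (\<lambda>t. T t * phase (iph k) (ct t))" for k
      by (rule integrable_torus_continuous[where B=B])
         (use B in \<open>auto intro!: continuous_intros trig_continuous_bounded(1)[OF T(1)] continuous_phase_ct simp: norm_mult norm_phase_ct\<close>)
    have intPT: "integrable torus (\<lambda>t. per y t * T t)"
    proof (rule integrable_torus_continuous)
      show "continuous_on (space torus) (\<lambda>t. per y t * T t)"
        by (intro continuous_on_mult continuous_per trig_continuous_bounded(1)[OF T(1)])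
      show "norm (per y t * T t) \<le> numer_bound TYPE('d) m / (h\<^sup>2) ^ m * B" if "t \<in> space torus" for t
        unfolding norm_mult using norm_per_le[OF that, of y] B[of t] Sb by (intro mult_mono) auto
    qed
    have rep: "((\<lambda>k. \<tau> k * M k) has_sum ?P * (\<integral>t. per y t * T t \<partial>torus)) UNIV"
      unfolding \<tau>_def M_def by (rule trig_reproduction[OF T(1)])
    have d1: "norm (\<alpha> k - \<tau> k) \<le> ?P * e" for k
    proof -
      have "\<alpha> k - \<tau> k = (\<integral>t. W t * phase (iph k) (ct t) - T t * phase (iph k) (ct t) \<partial>torus)"
        unfolding \<alpha> \<tau>_def using intW intT by (rule Bochner_Integration.integral_diff[symmetric])
      also have "norm \<dots> \<le> ?P * e"
        by (rule norm_integral_torus_le)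
           (use T(2) in \<open>simp add: left_diff_distrib[symmetric] norm_mult norm_phase_ct less_imp_le\<close>)
      finally show ?thesis .
    qed
    have "(\<Sum>\<^sub>\<infinity>k. \<alpha> k * M k) - (\<Sum>\<^sub>\<infinity>k. \<tau> k * M k) = (\<Sum>\<^sub>\<infinity>k. (\<alpha> k - \<tau> k) * M k)"
      using infsum_diff_banach[OF S has_sum_imp_summable[OF rep]] by (simp add: left_diff_distrib)
    also have "norm \<dots> \<le> (\<Sum>\<^sub>\<infinity>k. ?P * e * norm (M k))"
      by (rule norm_infsum_le_infsum(3)[OF summable_on_cmult_right[OF M]])
         (use d1 in \<open>simp add: norm_mult mult_right_mono\<close>)
    also have "\<dots> = ?P * e * (\<Sum>\<^sub>\<infinity>k. norm (M k))" by (rule infsum_cmult_right')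
    finally have 1: "norm ((\<Sum>\<^sub>\<infinity>k. \<alpha> k * M k) - ?P * (\<integral>t. per y t * T t \<partial>torus)) \<le> ?P * e * (\<Sum>\<^sub>\<infinity>k. norm (M k))"
      unfolding infsumI[OF rep] .
    have "(\<integral>t. per y t * T t \<partial>torus) - cardinal_int m h y = (\<integral>t. per y t * T t - per y t * W t \<partial>torus)"
      unfolding card using intPT intPW by (rule Bochner_Integration.integral_diff[symmetric])
    also have "norm \<dots> \<le> ?P * (numer_bound TYPE('d) m / (h\<^sup>2) ^ m * e)"
    proof (rule norm_integral_torus_le)
      fix t :: "'d \<Rightarrow> real" assume t: "t \<in> space torus"
      show "norm (per y t * T t - per y t * W t) \<le> numer_bound TYPE('d) m / (h\<^sup>2) ^ m * e"
        unfolding right_diff_distrib[symmetric] norm_mult norm_minus_commute[of "T t"]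
        using norm_per_le[OF t, of y] T(2)[OF t] Sb by (intro mult_mono) auto
    qed
    finally have 2: "norm ((\<integral>t. per y t * T t \<partial>torus) - cardinal_int m h y) \<le> ?P * (numer_bound TYPE('d) m / (h\<^sup>2) ^ m * e)" .
    have "norm (?P * (\<integral>t. per y t * T t \<partial>torus) - ?P * cardinal_int m h y)
        = ?P * norm ((\<integral>t. per y t * T t \<partial>torus) - cardinal_int m h y)"
      unfolding right_diff_distrib[symmetric] norm_mult norm_of_real by simp
    also have "\<dots> \<le> ?P * (?P * (numer_bound TYPE('d) m / (h\<^sup>2) ^ m * e))" using 2 P by (intro mult_left_mono) auto
    finally have "norm (?P * (\<integral>t. per y t * T t \<partial>torus) - ?P * cardinal_int m h y) \<le> ?P * (?P * (numer_bound TYPE('d) m / (h\<^sup>2) ^ m * e))" .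
    then have "norm ((\<Sum>\<^sub>\<infinity>k. \<alpha> k * M k) - ?P * cardinal_int m h y)
        \<le> ?P * e * (\<Sum>\<^sub>\<infinity>k. norm (M k)) + ?P * (?P * (numer_bound TYPE('d) m / (h\<^sup>2) ^ m * e))"
      using 1 norm_triangle_ineq[of "(\<Sum>\<^sub>\<infinity>k. \<alpha> k * M k) - ?P * (\<integral>t. per y t * T t \<partial>torus)"
         "?P * (\<integral>t. per y t * T t \<partial>torus) - ?P * cardinal_int m h y"] by simp
    also have "\<dots> = C * e" by (simp add: C_def algebra_simps)
    finally show ?thesis .
  qed
  note le = this
  have lim: "(\<lambda>n. C * (1 / Suc n)) \<longlonglongrightarrow> C * 0"
    by (intro tendsto_mult_left LIMSEQ_Suc[OF lim_1_over_n])
  have "norm ((\<Sum>\<^sub>\<infinity>k. \<alpha> k * M k) - ?P * cardinal_int m h y) \<le> C * 0"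
  proof (rule LIMSEQ_le_const[OF lim], intro exI[of _ 0] allI impI)
    fix n
    show "norm ((\<Sum>\<^sub>\<infinity>k. \<alpha> k * M k) - ?P * cardinal_int m h y) \<le> C * (1 / Suc n)" by (rule le) simp
  qed
  then have "(\<Sum>\<^sub>\<infinity>k. \<alpha> k * M k) = ?P * cardinal_int m h y" by simp
  then show ?thesis using has_sum_infsum[OF S] unfolding \<alpha>_def M_def by simp
qed

end

subsection \<open>The Lagrange function\<close>

text \<open>Associativity of convolution: p with u gives 0, while a with p gives the unit, so
  convolving all three yields both 0 and u. With \<open>a\<close> and \<open>p\<close> absolutely
  summable and \<open>u\<close> bounded, the double sum converges absolutely and may be
  interchanged.\<close>

lemma convolution_inverse_unique:
  fixes a p u :: "'g::ab_group_add \<Rightarrow> real"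
  assumes a: "(\<lambda>k. \<bar>a k\<bar>) summable_on UNIV" and p: "(\<lambda>k. \<bar>p k\<bar>) summable_on UNIV"
    and u: "\<And>k. \<bar>u k\<bar> \<le> B"
    and inv: "\<And>n. ((\<lambda>i. a i * p (n - i)) has_sum (if n = 0 then 1 else 0)) UNIV"
    and zero: "\<And>k. ((\<lambda>j. u j * p (k - j)) has_sum 0) UNIV"
  shows "u l = 0"
proof -
  define F where "F k j = a (l - k) * (u j * p (k - j))" for k j
  define S where "S = (\<Sum>\<^sub>\<infinity>k. \<bar>p k\<bar>)"
  have bij: "bij_betw (\<lambda>k. c - k) UNIV UNIV" for c :: 'g
    by (rule bij_betw_byWitness[where f'="\<lambda>k. c - k"]) auto
  have p': "(\<lambda>j. \<bar>p (k - j)\<bar>) summable_on UNIV" for k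
    by (rule iffD2[OF summable_on_reindex_bij_betw[OF bij] p])
  have S: "(\<Sum>\<^sub>\<infinity>j. \<bar>p (k - j)\<bar>) = S" for k
    unfolding S_def by (rule infsum_reindex_bij_betw[OF bij])
  have a': "(\<lambda>k. \<bar>a (l - k)\<bar>) summable_on UNIV"
    by (rule iffD2[OF summable_on_reindex_bij_betw[OF bij] a])
  have maj: "\<bar>F k j\<bar> \<le> \<bar>a (l - k)\<bar> * B * \<bar>p (k - j)\<bar>" for k j
    unfolding F_def abs_mult mult.assoc by (intro mult_left_mono mult_right_mono u) auto
  have row: "(\<lambda>j. \<bar>a (l - k)\<bar> * B * \<bar>p (k - j)\<bar>) summable_on UNIV" for k
    by (rule summable_on_cmult_right[OF p'])
  have rowF: "(\<lambda>j. norm (F k j)) summable_on UNIV" for k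
    by (rule summable_on_comparison_test[OF row[of k]]) (use maj in auto)
  have rowle: "(\<Sum>\<^sub>\<infinity>j. norm (F k j)) \<le> \<bar>a (l - k)\<bar> * (B * S)" for k
  proof -
    have "(\<Sum>\<^sub>\<infinity>j. norm (F k j)) \<le> (\<Sum>\<^sub>\<infinity>j. \<bar>a (l - k)\<bar> * B * \<bar>p (k - j)\<bar>)"
      by (rule infsum_mono[OF rowF row]) (use maj in auto)
    also have "\<dots> = \<bar>a (l - k)\<bar> * (B * S)" by (simp add: infsum_cmult_right' S)
    finally show ?thesis .
  qed
  have col: "(\<lambda>k. \<Sum>\<^sub>\<infinity>j. norm (F k j)) summable_on UNIV"
    by (rule summable_on_comparison_test[OF summable_on_cmult_left[OF a', of "B * S"] rowle]) (rule infsum_nonneg, simp)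
  have "(\<lambda>q. norm (case_prod F q)) summable_on (SIGMA k:UNIV. UNIV)"
  proof (rule summable_on_SigmaI[OF _ col])
    show "((\<lambda>j. norm (case_prod F (k, j))) has_sum (\<Sum>\<^sub>\<infinity>j. norm (F k j))) UNIV" for k
      unfolding prod.case by (rule has_sum_infsum[OF rowF])
  qed simp
  then have sum: "case_prod F summable_on UNIV \<times> UNIV" by (rule abs_summable_summable)
  have "(\<Sum>\<^sub>\<infinity>k. \<Sum>\<^sub>\<infinity>j. F k j) = (\<Sum>\<^sub>\<infinity>j. \<Sum>\<^sub>\<infinity>k. F k j)"
    by (rule infsum_swap_banach[OF sum])
  moreover have "(\<Sum>\<^sub>\<infinity>j. F k j) = 0" for k
    unfolding F_def by (simp add: infsum_cmult_right' infsumI[OF zero])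
  moreover have "(\<Sum>\<^sub>\<infinity>k. F k j) = (if j = l then u l else 0)" for j
  proof -
    have "(\<Sum>\<^sub>\<infinity>k. F k j) = (\<Sum>\<^sub>\<infinity>i. F (l - i) j)"
      by (rule infsum_reindex_bij_betw[OF bij, symmetric])
    also have "\<dots> = (\<Sum>\<^sub>\<infinity>i. u j * (a i * p (l - j - i)))"
      unfolding F_def by (simp add: algebra_simps)
    also have "\<dots> = u j * (if l - j = 0 then 1 else 0)"
      unfolding infsum_cmult_right' infsumI[OF inv] ..
    finally show ?thesis by auto
  qed
  moreover have "(\<Sum>\<^sub>\<infinity>j. if j = l then u l else 0) = u l"
    by (rule infsumI) (rule has_sum_finite_neutralI[of "{l}"]; simp)
  ultimately show ?thesis by simp
qed

text \<open>Moving one contour gives decay in that coordinate only. Taking the bound at the largest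
  coordinate, whose modulus times d is at least the sum of all moduli, trades a factor d in the rate
  for a product that can be summed over the lattice.\<close>

lemma le_prod_exp_of_le_exp:
  fixes z :: "'d::finite \<Rightarrow> real"
  assumes le: "\<And>i. X \<le> C * exp (- b * \<bar>z i\<bar>)" and b: "b \<ge> 0" and C: "C \<ge> 0"
  shows "X \<le> C * (\<Prod>i\<in>UNIV. exp (- (b / real CARD('d)) * \<bar>z i\<bar>))"
proof -
  have "Max (range (\<lambda>i. \<bar>z i\<bar>)) \<in> range (\<lambda>i. \<bar>z i\<bar>)" by (rule Max_in) auto
  then obtain i where i: "Max (range (\<lambda>i. \<bar>z i\<bar>)) = \<bar>z i\<bar>" by blast
  have "\<bar>z j\<bar> \<le> \<bar>z i\<bar>" for j unfolding i[symmetric] by (rule Max_ge) auto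
  then have "(\<Sum>j\<in>(UNIV::'d set). \<bar>z j\<bar>) \<le> real CARD('d) * \<bar>z i\<bar>"
    using sum_bounded_above[of "UNIV::'d set" "\<lambda>j. \<bar>z j\<bar>" "\<bar>z i\<bar>"] by simp
  then have "b / real CARD('d) * (\<Sum>j\<in>UNIV. \<bar>z j\<bar>) \<le> b / real CARD('d) * (real CARD('d) * \<bar>z i\<bar>)"
    using b by (intro mult_left_mono) auto
  then have "- b * \<bar>z i\<bar> \<le> (\<Sum>j\<in>UNIV. - (b / real CARD('d)) * \<bar>z j\<bar>)"
    by (simp only: sum_distrib_left[symmetric]) simp
  then have "exp (- b * \<bar>z i\<bar>) \<le> (\<Prod>j\<in>UNIV. exp (- (b / real CARD('d)) * \<bar>z j\<bar>))"
    by (simp only: exp_sum[symmetric] finite exp_le_cancel_iff)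
  then have "C * exp (- b * \<bar>z i\<bar>) \<le> C * (\<Prod>j\<in>UNIV. exp (- (b / real CARD('d)) * \<bar>z j\<bar>))"
    using C by (rule mult_left_mono)
  with le[of i] show ?thesis by linarith
qed

lemma bij_vec_nth: "bij_betw (vec_nth :: 'b^'d \<Rightarrow> _) UNIV UNIV"
  by (rule bij_betw_byWitness[where f'=vec_lambda]) auto

lemma grid_point_diff: "grid_point h k - grid_point h j = grid_point h (k - j)"
  by (simp add: grid_point_def vec_eq_iff algebra_simps)

text \<open>\<open>exp b\<close> is the price of a shifted centre in
  \<open>exp_abs_shift_int\<close>; the power comes from summing coordinate by coordinate.\<close>

definition lattice_sum :: "'d::finite itself \<Rightarrow> real \<Rightarrow> real" where
  "lattice_sum _ b = (exp b * (\<Sum>\<^sub>\<infinity>n::int. exp (- b * \<bar>real_of_int n\<bar>))) ^ CARD('d)"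

lemma lattice_exp_sum:
  fixes y :: "'d::finite \<Rightarrow> real"
  assumes b: "b > 0"
  shows "(\<lambda>k. \<Prod>i\<in>UNIV. exp (- b * \<bar>y i - of_int (k i)\<bar>)) summable_on UNIV"
    and "(\<Sum>\<^sub>\<infinity>k. \<Prod>i\<in>UNIV. exp (- b * \<bar>y i - of_int (k i)\<bar>)) \<le> lattice_sum TYPE('d) b"
proof -
  have s: "(\<lambda>n::int. norm (exp (- b * \<bar>y j - of_int n\<bar>))) summable_on UNIV" for j
    using exp_abs_shift_int(1)[OF b, of "y j"] by simp
  show "(\<lambda>k. \<Prod>i\<in>UNIV. exp (- b * \<bar>y i - of_int (k i)\<bar>)) summable_on UNIV"
    using summable_on_prod_fun[OF s] by (rule abs_summable_summable)
  have "(\<Sum>\<^sub>\<infinity>k. \<Prod>i\<in>UNIV. exp (- b * \<bar>y i - of_int (k i)\<bar>)) = (\<Prod>i\<in>UNIV. \<Sum>\<^sub>\<infinity>n. exp (- b * \<bar>y i - of_int n\<bar>))"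
    by (rule infsum_prod_fun[OF s])
  also have "\<dots> \<le> (\<Prod>i\<in>(UNIV::'d set). exp b * (\<Sum>\<^sub>\<infinity>n::int. exp (- b * \<bar>real_of_int n\<bar>)))"
    by (intro prod_mono conjI exp_abs_shift_int(2)[OF b] infsum_nonneg) auto
  finally show "(\<Sum>\<^sub>\<infinity>k. \<Prod>i\<in>UNIV. exp (- b * \<bar>y i - of_int (k i)\<bar>)) \<le> lattice_sum TYPE('d) b"
    by (simp add: lattice_sum_def)
qed

section \<open>Identification of the Lagrange function and summation over the grid\<close>

context
  fixes m :: nat and h :: real and ty :: "'d::finite itself"
  assumes m: "real m > real CARD('d) / 2" and h: "0 < h" "h \<le> 1"
begin

text \<open>The ratio between the kernel and \<open>moment\<close>, collected from
  \<open>matern_eq_Psi\<close>, \<open>Psi_scale\<close> and \<open>moment_eq_Psi\<close>. It tends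
  to 0 with h but is divided out again in \<open>lagrange_coeff\<close>.\<close>

definition "scale_const = 2 powr ((real m - real CARD('d) / 2) - 1) * h powr (2 * (real m - real CARD('d) / 2)) * kappa TYPE('d) m"

text \<open>One factor \<open>(2 * pi) ^ CARD('d)\<close> normalises the Fourier coefficient, the
  other turns the integral into a mean. Taking real parts is harmless since the kernel is
  real.\<close>

definition lagrange_coeff :: "int^'d \<Rightarrow> real" where
  "lagrange_coeff j = Re (inverse_coeff m h (\<lambda>i. j $ i)) / (scale_const * ((2 * pi) ^ CARD('d))\<^sup>2)"

definition cardinal_fun :: "real^'d \<Rightarrow> real" where
  "cardinal_fun x = Re (cardinal_int m h (\<lambda>i. x $ i / h)) / ((2 * pi) ^ CARD('d))"

lemma scale_const_pos: "scale_const > 0"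
  using kappa_pos[where 'd='d, of m] m_ge_1[OF m h] h by (simp add: scale_const_def)

lemma norm_sub_grid_point:
  "norm (x - grid_point h j) = h * sqrt (\<Sum>i\<in>UNIV. (x $ i / h - of_int (j $ i))\<^sup>2)" for x :: "real^'d"
proof -
  have "x $ i - h * of_int (j $ i) = h * (x $ i / h - of_int (j $ i))" for i using h by (simp add: field_simps)
  then have "norm (x - grid_point h j) = sqrt (\<Sum>i\<in>UNIV. (h * (x $ i / h - of_int (j $ i)))\<^sup>2)"
    by (simp add: norm_vec_def L2_set_def grid_point_def)
  also have "\<dots> = h * sqrt (\<Sum>i\<in>UNIV. (x $ i / h - of_int (j $ i))\<^sup>2)"
    unfolding power_mult_distrib sum_distrib_left[symmetric] real_sqrt_mult using h by simp
  finally show ?thesis .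
qed

lemma matern_sub_grid_point:
  "matern m (x - grid_point h j) = 2 powr ((real m - real CARD('d) / 2) - 1) * h powr (2 * (real m - real CARD('d) / 2)) * Psi (real m - real CARD('d) / 2) h (sqrt (\<Sum>i\<in>UNIV. (x $ i / h - of_int (j $ i))\<^sup>2))"
  for x :: "real^'d"
proof -
  have "(real m - real CARD('d) / 2) > 0" using m by simp
  then show ?thesis unfolding matern_eq_Psi[OF m] norm_sub_grid_point by (simp add: Psi_scale[OF _ h(1)])
qed

lemma matern_sub_grid_point_moment:
  "of_real (matern m (x - grid_point h j)) = of_real scale_const * moment m h (\<lambda>i. x $ i / h - of_int (j $ i))"
  for x :: "real^'d"
proof -
  have "kappa TYPE('d) m \<noteq> 0" using kappa_pos[where 'd='d, of m] m_ge_1[OF m h] by force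
  then show ?thesis unfolding matern_sub_grid_point moment_eq_Psi[OF m h] scale_const_def by simp
qed

lemma cardinal_fun_has_sum:
  "((\<lambda>j. lagrange_coeff j * matern m (x - grid_point h j)) has_sum cardinal_fun x) UNIV"
proof -
  let ?y = "\<lambda>i. x $ i / h"
  let ?f = "\<lambda>k. inverse_coeff m h k * moment m h (\<lambda>i. ?y i - of_int (k i))"
  have "((\<lambda>j. ?f (\<lambda>i. j $ i)) has_sum ((2 * pi) ^ CARD('d)) * cardinal_int m h ?y) UNIV"
    using has_sum_reindex_bij_betw[OF bij_vec_nth, of ?f] cardinal_int_has_sum[OF m h, of ?y] by simp
  from has_sum_cmult_right[OF has_sum_bounded_linear[OF bounded_linear_Re this], of "1 / ((2 * pi) ^ CARD('d))\<^sup>2"]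
  have "((\<lambda>j. 1 / ((2 * pi) ^ CARD('d))\<^sup>2 * Re (?f (\<lambda>i. j $ i))) has_sum 1 / ((2 * pi) ^ CARD('d))\<^sup>2 * Re (((2 * pi) ^ CARD('d)) * cardinal_int m h ?y)) UNIV" .
  moreover have "1 / ((2 * pi) ^ CARD('d))\<^sup>2 * Re (((2 * pi) ^ CARD('d)) * cardinal_int m h ?y) = cardinal_fun x"
  proof -
    have "Re (complex_of_real p * z) = p * Re z" for p z by simp
    then show ?thesis unfolding cardinal_fun_def by (simp add: power2_eq_square)
  qed
  moreover have "1 / ((2 * pi) ^ CARD('d))\<^sup>2 * Re (?f (\<lambda>i. j $ i)) = lagrange_coeff j * matern m (x - grid_point h j)" for j
  proof -
    have "moment m h (\<lambda>i. ?y i - of_int (j $ i)) = of_real (matern m (x - grid_point h j) / scale_const)"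
      using matern_sub_grid_point_moment[of x j] scale_const_pos by (simp add: field_simps)
    then show ?thesis by (simp add: lagrange_coeff_def)
  qed
  ultimately show ?thesis by simp
qed

lemma lagrange_coeff_summable: "(\<lambda>j. \<bar>lagrange_coeff j\<bar>) summable_on UNIV"
proof -
  define b where "b = decay TYPE('d) m / 2 / real CARD('d)"
  define C where "C = ((2 * pi) ^ CARD('d)) * (2 * symb_bound TYPE('d) ^ m) / (scale_const * ((2 * pi) ^ CARD('d))\<^sup>2)"
  have b: "b > 0" using decay_bounds(1)[OF m h] by (simp add: b_def)
  have C: "C \<ge> 0" using scale_const_pos symb_bound_ge[where 'd='d] by (simp add: C_def)
  let ?p = "\<lambda>k. \<Prod>i\<in>UNIV. exp (- b * \<bar>0 - of_int (k i)\<bar>)"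
  have "(\<lambda>j :: int^'d. ?p (\<lambda>i. j $ i)) summable_on UNIV"
    by (rule iffD2[OF summable_on_reindex_bij_betw[OF bij_vec_nth, of ?p]]) (rule lattice_exp_sum(1)[OF b, of "\<lambda>_. 0"])
  then have "(\<lambda>j :: int^'d. C * ?p (\<lambda>i. j $ i)) summable_on UNIV" by (rule summable_on_cmult_right)
  then show ?thesis
  proof (rule summable_on_comparison_test)
    fix j :: "int^'d"
    have "\<bar>lagrange_coeff j\<bar> \<le> C * (\<Prod>i\<in>UNIV. exp (- (decay TYPE('d) m / 2 / real CARD('d)) * \<bar>real_of_int (j $ i)\<bar>))"
    proof (rule le_prod_exp_of_le_exp[OF _ _ C])
      fix i
      have "\<bar>lagrange_coeff j\<bar> \<le> norm (inverse_coeff m h (\<lambda>i. j $ i)) / (scale_const * ((2 * pi) ^ CARD('d))\<^sup>2)"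
        unfolding lagrange_coeff_def abs_divide using scale_const_pos
        by (simp add: divide_right_mono abs_Re_le_cmod)
      also have "\<dots> \<le> (((2 * pi) ^ CARD('d)) * (2 * symb_bound TYPE('d) ^ m * exp (- (decay TYPE('d) m / 2) * \<bar>of_int (j $ i)\<bar>))) / (scale_const * ((2 * pi) ^ CARD('d))\<^sup>2)"
        using norm_inverse_coeff_le[OF m h, of "\<lambda>i. j $ i" i] scale_const_pos by (intro divide_right_mono) auto
      also have "\<dots> = C * exp (- (decay TYPE('d) m / 2) * \<bar>real_of_int (j $ i)\<bar>)" by (simp add: C_def)
      finally show "\<bar>lagrange_coeff j\<bar> \<le> C * exp (- (decay TYPE('d) m / 2) * \<bar>real_of_int (j $ i)\<bar>)" .
    qed (use decay_bounds(1)[OF m h] in simp)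
    then show "\<bar>lagrange_coeff j\<bar> \<le> C * ?p (\<lambda>i. j $ i)" by (simp add: b_def)
  qed simp
qed

lemma cardinal_fun_grid_point: "cardinal_fun (grid_point h k) = (if k = 0 then 1 else 0)"
proof -
  have "cardinal_int m h (\<lambda>i. grid_point h k $ i / h) = (\<integral>t. phase (\<lambda>i. of_int (k $ i)) (ct t) \<partial>torus)"
    unfolding cardinal_int_def
  proof (rule Bochner_Integration.integral_cong[OF refl])
    fix t :: "'d \<Rightarrow> real" assume t: "t \<in> space torus"
    have "(\<lambda>i. grid_point h k $ i / h) = (\<lambda>i. (\<lambda>_. 0) i + of_int (k $ i))"
      using h by (simp add: grid_point_def fun_eq_iff)
    then have "periodized m h (\<lambda>i. grid_point h k $ i / h) (ct t) = phase (\<lambda>i. of_int (k $ i)) (ct t) * periodized m h (\<lambda>_. 0) (ct t)"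
      using periodized_phase[of m h "\<lambda>_. 0" "\<lambda>i. k $ i" "ct t"] by simp
    then show "periodized m h (\<lambda>i. grid_point h k $ i / h) (ct t) / periodized m h (\<lambda>_. 0) (ct t) = phase (\<lambda>i. of_int (k $ i)) (ct t)"
      using per0_nonzero[OF m h t] by simp
  qed
  also have "\<dots> = of_real (if k = 0 then ((2 * pi) ^ CARD('d)) else 0)"
    using integral_phase_torus[of "\<lambda>i. k $ i"] by (simp add: vec_eq_iff fun_eq_iff)
  finally show ?thesis unfolding cardinal_fun_def by simp
qed

lemma matern_grid_summable: "(\<lambda>j. \<bar>matern m (grid_point h j :: real^'d)\<bar>) summable_on UNIV"
proof -
  let ?c = "2 powr ((real m - real CARD('d) / 2) - 1) * h powr (2 * (real m - real CARD('d) / 2))"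
  let ?p = "\<lambda>k. Psi (real m - real CARD('d) / 2) h (sqrt (\<Sum>i\<in>UNIV. (0 - of_int (k i))\<^sup>2))"
  have "(\<lambda>j :: int^'d. ?p (\<lambda>i. j $ i)) summable_on UNIV"
    by (rule iffD2[OF summable_on_reindex_bij_betw[OF bij_vec_nth, of ?p]]) (rule Psi_summable[OF m h, of "\<lambda>_. 0"])
  then have "(\<lambda>j :: int^'d. ?c * ?p (\<lambda>i. j $ i)) summable_on UNIV" by (rule summable_on_cmult_right)
  moreover have "\<bar>matern m (grid_point h j :: real^'d)\<bar> = ?c * ?p (\<lambda>i. j $ i)" for j
  proof -
    have "(grid_point h j :: real^'d) = grid_point h j - grid_point h 0" by (simp add: grid_point_def vec_eq_iff)
    also have "matern m \<dots> = ?c * ?p (\<lambda>i. j $ i)"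
      unfolding matern_sub_grid_point using h by (simp add: grid_point_def)
    finally show ?thesis using Psi_nonneg by simp
  qed
  ultimately show ?thesis by simp
qed

text \<open>The coefficients of a competitor differ from \<open>lagrange_coeff\<close> by a bounded
  sequence that convolution with the sampled kernel annihilates. The cardinal property says that
  \<open>lagrange_coeff\<close> is a convolution inverse of that kernel, so the difference
  vanishes.\<close>

lemma lagrange_eq_cardinal_fun: "lagrange m h = cardinal_fun"
  unfolding lagrange_def
proof (rule the_equality)
  have bc: "bounded (range lagrange_coeff)"
  proof -
    have "\<bar>lagrange_coeff j\<bar> \<le> (\<Sum>\<^sub>\<infinity>j. \<bar>lagrange_coeff j\<bar>)" for j
      using finite_sum_le_infsum[OF lagrange_coeff_summable, of "{j}"] by simp
    then show ?thesis by (auto simp: bounded_iff)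
  qed
  show "cardinal_fun \<in> shift_space m h \<and> (\<forall>j. cardinal_fun (grid_point h j) = (if j = 0 then 1 else 0))"
    using bc cardinal_fun_has_sum cardinal_fun_grid_point unfolding shift_space_def by blast
  fix s :: "real^'d \<Rightarrow> real" assume s: "s \<in> shift_space m h \<and> (\<forall>j. s (grid_point h j) = (if j = 0 then 1 else 0))"
  then obtain c :: "int^'d \<Rightarrow> real" where c: "bounded (range c)"
    and cs: "\<And>x. ((\<lambda>j. c j * matern m (x - grid_point h j)) has_sum s x) UNIV"
    unfolding shift_space_def by blast
  obtain B1 B2 where B: "\<And>j. \<bar>c j\<bar> \<le> B1" "\<And>j. \<bar>lagrange_coeff j\<bar> \<le> B2"
    using c bc unfolding bounded_iff by auto
  have "c j - lagrange_coeff j = 0" for j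
  proof (rule convolution_inverse_unique[OF lagrange_coeff_summable matern_grid_summable])
    show "\<bar>c k - lagrange_coeff k\<bar> \<le> B1 + B2" for k using B[of k] by linarith
    show "((\<lambda>i. lagrange_coeff i * matern m (grid_point h (n - i))) has_sum (if n = 0 then 1 else 0)) UNIV" for n
      using cardinal_fun_has_sum[of "grid_point h n"] unfolding grid_point_diff cardinal_fun_grid_point .
    show "((\<lambda>j. (c j - lagrange_coeff j) * matern m (grid_point h (k - j))) has_sum 0) UNIV" for k
    proof -
      have "((\<lambda>j. c j * matern m (grid_point h (k - j)) + - (lagrange_coeff j * matern m (grid_point h (k - j))))
         has_sum s (grid_point h k) + - cardinal_fun (grid_point h k)) UNIV"
        using has_sum_add[OF cs[of "grid_point h k"] has_sum_uminusI[OF cardinal_fun_has_sum[of "grid_point h k"]]]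
        unfolding grid_point_diff .
      then show ?thesis using s cardinal_fun_grid_point[of k] by (simp add: left_diff_distrib)
    qed
  qed
  then have "c = lagrange_coeff" by (simp add: fun_eq_iff)
  then show "s = cardinal_fun" using cs cardinal_fun_has_sum has_sum_unique by (intro ext) blast
qed

text \<open>In the variable x / h the grid is the integer lattice, so neither the decay rate nor the
  lattice sum involves \<open>h\<close>.\<close>

lemma lebesgue_constant_le:
  "lebesgue_constant TYPE('d) m h
     \<le> ennreal (2 * numer_bound TYPE('d) m * lattice_sum TYPE('d) (decay TYPE('d) m / 2 / real CARD('d)))"
  unfolding lebesgue_constant_eq_SUP lagrange_eq_cardinal_fun
proof (rule SUP_least)
  fix x :: "real^'d"
  define b where "b = decay TYPE('d) m / 2 / real CARD('d)"
  define C where "C = 2 * numer_bound TYPE('d) m"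
  have b: "b > 0" using decay_bounds(1)[OF m h] by (simp add: b_def)
  have C: "C \<ge> 0" using numer_bound_ge_1[OF m h] by (simp add: C_def)
  let ?p = "\<lambda>k. \<Prod>i\<in>UNIV. exp (- b * \<bar>x $ i / h - of_int (k i)\<bar>)"
  have le: "\<bar>cardinal_fun (x - grid_point h j)\<bar> \<le> C * ?p (\<lambda>i. j $ i)" for j
    unfolding b_def
  proof (rule le_prod_exp_of_le_exp[OF _ _ C])
    fix i
    have y: "(\<lambda>i. (x - grid_point h j) $ i / h) = (\<lambda>i. x $ i / h - of_int (j $ i))"
      using h by (simp add: grid_point_def diff_divide_distrib fun_eq_iff)
    have "\<bar>cardinal_fun (x - grid_point h j)\<bar> \<le> norm (cardinal_int m h (\<lambda>i. x $ i / h - of_int (j $ i))) / ((2 * pi) ^ CARD('d))"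
      unfolding cardinal_fun_def y abs_divide by (simp add: divide_right_mono abs_Re_le_cmod)
    also have "\<dots> \<le> (((2 * pi) ^ CARD('d)) * (2 * numer_bound TYPE('d) m * exp (- (decay TYPE('d) m / 2) * \<bar>x $ i / h - of_int (j $ i)\<bar>))) / ((2 * pi) ^ CARD('d))"
      by (intro divide_right_mono norm_cardinal_int_le[OF m h]) auto
    also have "\<dots> = C * exp (- (decay TYPE('d) m / 2) * \<bar>x $ i / h - of_int (j $ i)\<bar>)" by (simp add: C_def)
    finally show "\<bar>cardinal_fun (x - grid_point h j)\<bar> \<le> C * exp (- (decay TYPE('d) m / 2) * \<bar>x $ i / h - of_int (j $ i)\<bar>)" .
  qed (use decay_bounds(1)[OF m h] in simp)
  have sp: "(\<lambda>j :: int^'d. ?p (\<lambda>i. j $ i)) summable_on UNIV"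
    by (rule iffD2[OF summable_on_reindex_bij_betw[OF bij_vec_nth, of ?p]]) (rule lattice_exp_sum(1)[OF b, of "\<lambda>i. x $ i / h"])
  have sC: "(\<lambda>j :: int^'d. C * ?p (\<lambda>i. j $ i)) summable_on UNIV" using sp by (rule summable_on_cmult_right)
  have sL: "(\<lambda>j. \<bar>cardinal_fun (x - grid_point h j)\<bar>) summable_on UNIV"
    by (rule summable_on_comparison_test[OF sC]) (use le in auto)
  have "(\<Sum>\<^sub>\<infinity>j. \<bar>cardinal_fun (x - grid_point h j)\<bar>) \<le> (\<Sum>\<^sub>\<infinity>j :: int^'d. C * ?p (\<lambda>i. j $ i))"
    by (rule infsum_mono[OF sL sC le])
  also have "\<dots> = C * (\<Sum>\<^sub>\<infinity>k. ?p k)"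
    unfolding infsum_cmult_right' using infsum_reindex_bij_betw[OF bij_vec_nth, of ?p] by simp
  also have "\<dots> \<le> C * lattice_sum TYPE('d) b"
    by (rule mult_left_mono[OF lattice_exp_sum(2)[OF b] C])
  finally show "(\<Sum>\<^sub>\<infinity>j. ennreal \<bar>cardinal_fun (x - grid_point h j)\<bar>)
      \<le> ennreal (2 * numer_bound TYPE('d) m * lattice_sum TYPE('d) (decay TYPE('d) m / 2 / real CARD('d)))"
    unfolding b_def[symmetric] C_def[symmetric] by (subst infsum_ennreal_eq[OF sL]) (auto intro: ennreal_leI)
qed

end

theorem corollary4p1:
  fixes m :: nat
  assumes "m > 0" and "real m > real CARD('d::finite) / 2"
  shows "\<exists>C::real. C > 0 \<and>
           (\<forall>h::real. 0 < h \<and> h \<le> 1 \<longrightarrow> lebesgue_constant TYPE('d) m h \<le> ennreal C)"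
proof -
  define C where "C = 2 * numer_bound TYPE('d) m * lattice_sum TYPE('d) (decay TYPE('d) m / 2 / real CARD('d))"
  \<comment> \<open>The maximum with 1 gives positivity of the constant at once.\<close>
  have "lebesgue_constant TYPE('d) m h \<le> ennreal (max C 1)" if "0 < h" "h \<le> 1" for h
    using lebesgue_constant_le[OF assms(2) that] unfolding C_def[symmetric]
    by (rule order_trans) (rule ennreal_leI, simp)
  then show ?thesis by (intro exI[of _ "max C 1"]) auto
qed

end
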